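(* A smooth vector field $X$ on a closed orientable Riemannian manifold $(M,g)$ is a Killing vector field if and only if it satisfies $$0=\Delta X+\nabla\operatorname{div}(X)+\operatorname{Ric}(X,\cdot)+(\mathcal{L}_Xg)(X,\cdot)+\frac12\operatorname{div}(X)\,X .$$
   Context: Closed means compact without boundary. $\nabla$ is the Levi-Civita connection of $g$, $\Delta=g^{k\ell}\nabla_k\nabla_\ell$ is the (rough) Laplacian on vector fields, $\operatorname{div}(X)=\nabla_iX^i$, $\operatorname{Ric}=(R_{ij})$ is the Ricci curvature. Vector fields and 1-forms are identified via $g$. In this statement $\mathcal{L}_Xg$ is normalized by $2(\mathcal{L}_Xg)_{ij}=\nabla_iX_j+\nabla_jX_i$, i.e. it is one half of the standard Lie derivative of $g$. In components the equation reads $0=\Delta X^i+\nabla^i\operatorname{div}(X)+R^i{}_jX^j+\tfrac12(\nabla^iX^j+\nabla^jX^i)X_j+\tfrac12\operatorname{div}(X)X^i$. $X$ is Killing if $\nabla_iX_j+\nabla_jX_i=0$. *)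

theory Defs
  imports "HOL-Analysis.Analysis"
begin

section \<open>Smooth functions between Euclidean spaces\<close>

text \<open>\<open>f\<close> is \<open>k\<close> times continuously differentiable on the open set \<open>S\<close>. On a finite-dimensional
  space it is enough to ask the directional derivatives of \<open>f\<close> to be \<open>k - 1\<close> times continuously
  differentiable.\<close>

primrec Ck_on :: "nat \<Rightarrow> ('e::euclidean_space \<Rightarrow> 'f::real_normed_vector) \<Rightarrow> 'e set \<Rightarrow> bool" where
  "Ck_on 0 f S \<longleftrightarrow> continuous_on S f"
| "Ck_on (Suc k) f S \<longleftrightarrow>
     (\<forall>x\<in>S. f differentiable (at x)) \<and> (\<forall>v. Ck_on k (\<lambda>x. frechet_derivative f (at x) v) S)"

definition smooth_on :: "('e::euclidean_space \<Rightarrow> 'f::real_normed_vector) \<Rightarrow> 'e set \<Rightarrow> bool" where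
  "smooth_on f S \<longleftrightarrow> (\<forall>k. Ck_on k f S)"


section \<open>Smooth manifolds\<close>

text \<open>A chart is a pair of its domain and its coordinate map; the values of the coordinate map
  outside the domain are irrelevant. The dimension is \<open>CARD('n)\<close>.\<close>

type_synonym ('a, 'n) chart = "'a set \<times> ('a \<Rightarrow> real^'n)"

definition chart_inv :: "('a, 'n::finite) chart \<Rightarrow> real^'n \<Rightarrow> 'a" where
  "chart_inv c = inv_into (fst c) (snd c)"

definition is_chart :: "'a topology \<Rightarrow> ('a, 'n::finite) chart \<Rightarrow> bool" where
  "is_chart M c \<longleftrightarrow> openin M (fst c) \<and> open (snd c ` fst c) \<and>
     homeomorphic_map (subtopology M (fst c)) (top_of_set (snd c ` fst c)) (snd c)"

definition transition :: "('a, 'n::finite) chart \<Rightarrow> ('a, 'n) chart \<Rightarrow> real^'n \<Rightarrow> real^'n" where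
  "transition c d = snd d \<circ> chart_inv c"

definition smooth_atlas :: "'a topology \<Rightarrow> ('a, 'n::finite) chart set \<Rightarrow> bool" where
  "smooth_atlas M A \<longleftrightarrow> (\<forall>c\<in>A. is_chart M c) \<and> (\<Union>c\<in>A. fst c) = topspace M \<and>
     (\<forall>c\<in>A. \<forall>d\<in>A. smooth_on (transition c d) (snd c ` (fst c \<inter> fst d)))"

definition smooth_manifold :: "'a topology \<Rightarrow> ('a, 'n::finite) chart set \<Rightarrow> bool" where
  "smooth_manifold M A \<longleftrightarrow> Hausdorff_space M \<and> second_countable M \<and> smooth_atlas M A"

text \<open>Charts take values in open subsets of Euclidean space, so there is no boundary.\<close>

definition closed_manifold :: "'a topology \<Rightarrow> ('a, 'n::finite) chart set \<Rightarrow> bool" where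
  "closed_manifold M A \<longleftrightarrow> smooth_manifold M A \<and> compact_space M"

definition transition_jacobian ::
    "('a, 'n::finite) chart \<Rightarrow> ('a, 'n) chart \<Rightarrow> 'a \<Rightarrow> real^'n^'n" where
  "transition_jacobian c d p = jacobian (transition c d) (at (snd c p))"

definition orientable :: "'a topology \<Rightarrow> ('a, 'n::finite) chart set \<Rightarrow> bool" where
  "orientable M A \<longleftrightarrow> (\<exists>B. smooth_atlas M B \<and> smooth_atlas M (A \<union> B) \<and>
     (\<forall>c\<in>B. \<forall>d\<in>B. \<forall>p \<in> fst c \<inter> fst d. det (transition_jacobian c d p) > 0))"


section \<open>Vector fields and Riemannian metrics\<close>

text \<open>Tensor fields are families of component functions, one for each chart of the atlas, obeying
  the transformation law of the tensor type: \<open>X c p\<close> is the vector of the \<open>X\<^sup>i(p)\<close>, and \<open>g c p\<close> the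
  matrix of the \<open>g\<^sub>i\<^sub>j(p)\<close>, with respect to the coordinate frame of the chart \<open>c\<close>.\<close>

type_synonym ('a, 'n) vec_field = "('a, 'n) chart \<Rightarrow> 'a \<Rightarrow> real^'n"
type_synonym ('a, 'n) bil_field = "('a, 'n) chart \<Rightarrow> 'a \<Rightarrow> real^'n^'n"

definition smooth_in_chart ::
    "('a, 'n::finite) chart \<Rightarrow> ('a \<Rightarrow> 'f::real_normed_vector) \<Rightarrow> bool" where
  "smooth_in_chart c f \<longleftrightarrow> smooth_on (f \<circ> chart_inv c) (snd c ` fst c)"

definition smooth_vector_field :: "('a, 'n::finite) chart set \<Rightarrow> ('a, 'n) vec_field \<Rightarrow> bool" where
  "smooth_vector_field A X \<longleftrightarrow> (\<forall>c\<in>A. smooth_in_chart c (X c)) \<and>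
     (\<forall>c\<in>A. \<forall>d\<in>A. \<forall>p \<in> fst c \<inter> fst d. X d p = transition_jacobian c d p *v X c p)"

definition riemannian_metric :: "('a, 'n::finite) chart set \<Rightarrow> ('a, 'n) bil_field \<Rightarrow> bool" where
  "riemannian_metric A g \<longleftrightarrow> (\<forall>c\<in>A. smooth_in_chart c (g c)) \<and>
     (\<forall>c\<in>A. \<forall>d\<in>A. \<forall>p \<in> fst c \<inter> fst d.
        g c p = transpose (transition_jacobian c d p) ** g d p ** transition_jacobian c d p) \<and>
     (\<forall>c\<in>A. \<forall>p\<in>fst c. transpose (g c p) = g c p \<and> (\<forall>v. v \<noteq> 0 \<longrightarrow> v \<bullet> (g c p *v v) > 0))"

text \<open>The musical isomorphisms \<open>X\<^sub>i = g\<^sub>i\<^sub>j X\<^sup>j\<close> and \<open>\<omega>\<^sup>i = g\<^sup>i\<^sup>j \<omega>\<^sub>j\<close>.\<close>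

definition lower :: "('a, 'n::finite) bil_field \<Rightarrow> ('a, 'n) vec_field \<Rightarrow> ('a, 'n) vec_field" where
  "lower g X c p = g c p *v X c p"

definition raise :: "('a, 'n::finite) bil_field \<Rightarrow> ('a, 'n) vec_field \<Rightarrow> ('a, 'n) vec_field" where
  "raise g \<omega> c p = matrix_inv (g c p) *v \<omega> c p"


section \<open>The Levi-Civita connection and its curvature\<close>

definition partial :: "('a, 'n::finite) chart \<Rightarrow> 'n \<Rightarrow> ('a \<Rightarrow> real) \<Rightarrow> 'a \<Rightarrow> real" where
  "partial c i f p = frechet_derivative (f \<circ> chart_inv c) (at (snd c p)) (axis i 1)"

text \<open>\<open>christoffel g c k i j\<close> is \<open>\<Gamma>\<^sup>k\<^sub>i\<^sub>j\<close>, with \<open>\<nabla>\<^sub>i \<partial>\<^sub>j = \<Gamma>\<^sup>k\<^sub>i\<^sub>j \<partial>\<^sub>k\<close>. Lemma \<open>christoffel_unique\<close> below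
  shows that this is the unique torsion-free connection for which \<open>g\<close> is parallel.\<close>

definition christoffel ::
    "('a, 'n::finite) bil_field \<Rightarrow> ('a, 'n) chart \<Rightarrow> 'n \<Rightarrow> 'n \<Rightarrow> 'n \<Rightarrow> 'a \<Rightarrow> real" where
  "christoffel g c k i j p = (1/2) * (\<Sum>l\<in>UNIV. matrix_inv (g c p) $ k $ l *
     (partial c i (\<lambda>q. g c q $ j $ l) p + partial c j (\<lambda>q. g c q $ i $ l) p
        - partial c l (\<lambda>q. g c q $ i $ j) p))"

text \<open>\<open>nabla_vec g X c i k\<close> is \<open>\<nabla>\<^sub>i X\<^sup>k\<close>, \<open>nabla_covec g \<omega> c i j\<close> is \<open>\<nabla>\<^sub>i \<omega>\<^sub>j\<close>, and
  \<open>nabla2_vec g X c l i k\<close> is \<open>\<nabla>\<^sub>l \<nabla>\<^sub>i X\<^sup>k\<close>, a component of the covariant derivative of the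
  (1,1)-tensor \<open>\<nabla>X\<close>.\<close>

definition nabla_vec ::
    "('a, 'n::finite) bil_field \<Rightarrow> ('a, 'n) vec_field \<Rightarrow> ('a, 'n) chart \<Rightarrow> 'n \<Rightarrow> 'n \<Rightarrow> 'a \<Rightarrow> real" where
  "nabla_vec g X c i k p =
     partial c i (\<lambda>q. X c q $ k) p + (\<Sum>j\<in>UNIV. christoffel g c k i j p * X c p $ j)"

definition nabla_covec ::
    "('a, 'n::finite) bil_field \<Rightarrow> ('a, 'n) vec_field \<Rightarrow> ('a, 'n) chart \<Rightarrow> 'n \<Rightarrow> 'n \<Rightarrow> 'a \<Rightarrow> real" where
  "nabla_covec g \<omega> c i j p =
     partial c i (\<lambda>q. \<omega> c q $ j) p - (\<Sum>k\<in>UNIV. christoffel g c k i j p * \<omega> c p $ k)"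

definition nabla2_vec ::
    "('a, 'n::finite) bil_field \<Rightarrow> ('a, 'n) vec_field \<Rightarrow> ('a, 'n) chart
      \<Rightarrow> 'n \<Rightarrow> 'n \<Rightarrow> 'n \<Rightarrow> 'a \<Rightarrow> real" where
  "nabla2_vec g X c l i k p = partial c l (nabla_vec g X c i k) p
     + (\<Sum>m\<in>UNIV. christoffel g c k l m p * nabla_vec g X c i m p)
     - (\<Sum>m\<in>UNIV. christoffel g c m l i p * nabla_vec g X c m k p)"

definition rough_laplacian ::
    "('a, 'n::finite) bil_field \<Rightarrow> ('a, 'n) vec_field \<Rightarrow> ('a, 'n) vec_field" where
  "rough_laplacian g X c p =
     (\<chi> i. \<Sum>k\<in>UNIV. \<Sum>l\<in>UNIV. matrix_inv (g c p) $ k $ l * nabla2_vec g X c k l i p)"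

definition divergence ::
    "('a, 'n::finite) bil_field \<Rightarrow> ('a, 'n) vec_field \<Rightarrow> ('a, 'n) chart \<Rightarrow> 'a \<Rightarrow> real" where
  "divergence g X c p = (\<Sum>i\<in>UNIV. nabla_vec g X c i i p)"

definition gradient ::
    "('a, 'n::finite) bil_field \<Rightarrow> (('a, 'n) chart \<Rightarrow> 'a \<Rightarrow> real) \<Rightarrow> ('a, 'n) vec_field" where
  "gradient g f = raise g (\<lambda>c p. \<chi> i. partial c i (f c) p)"

text \<open>\<open>riemann g c l k i j\<close> is the coefficient of \<open>\<partial>\<^sub>l\<close> in \<open>R(\<partial>\<^sub>i, \<partial>\<^sub>j) \<partial>\<^sub>k = \<nabla>\<^sub>i \<nabla>\<^sub>j \<partial>\<^sub>k - \<nabla>\<^sub>j \<nabla>\<^sub>i \<partial>\<^sub>k\<close>, and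
  \<open>R\<^sub>j\<^sub>k\<close> is the trace of \<open>Y \<mapsto> R(Y, \<partial>\<^sub>j) \<partial>\<^sub>k\<close>; round spheres have positive Ricci curvature.\<close>

definition riemann ::
    "('a, 'n::finite) bil_field \<Rightarrow> ('a, 'n) chart \<Rightarrow> 'n \<Rightarrow> 'n \<Rightarrow> 'n \<Rightarrow> 'n \<Rightarrow> 'a \<Rightarrow> real" where
  "riemann g c l k i j p =
     partial c i (christoffel g c l j k) p - partial c j (christoffel g c l i k) p
     + (\<Sum>m\<in>UNIV. christoffel g c l i m p * christoffel g c m j k p)
     - (\<Sum>m\<in>UNIV. christoffel g c l j m p * christoffel g c m i k p)"

definition ricci :: "('a, 'n::finite) bil_field \<Rightarrow> ('a, 'n) bil_field" where
  "ricci g c p = (\<chi> j k. \<Sum>i\<in>UNIV. riemann g c i k i j p)"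

text \<open>One half of the usual Lie derivative of \<open>g\<close>: \<open>2 (L\<^sub>X g)\<^sub>i\<^sub>j = \<nabla>\<^sub>i X\<^sub>j + \<nabla>\<^sub>j X\<^sub>i\<close>.\<close>

definition lie_metric ::
    "('a, 'n::finite) bil_field \<Rightarrow> ('a, 'n) vec_field \<Rightarrow> ('a, 'n) bil_field" where
  "lie_metric g X c p =
     (\<chi> i j. (1/2) * (nabla_covec g (lower g X) c i j p + nabla_covec g (lower g X) c j i p))"

text \<open>The vector field corresponding to the 1-form \<open>T(X, \<cdot>)\<close>, for a bilinear form \<open>T\<close>.\<close>

definition contract ::
    "('a, 'n::finite) bil_field \<Rightarrow> ('a, 'n) bil_field \<Rightarrow> ('a, 'n) vec_field \<Rightarrow> ('a, 'n) vec_field" where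
  "contract g T X = raise g (\<lambda>c p. X c p v* T c p)"

definition killing_field ::
    "('a, 'n::finite) chart set \<Rightarrow> ('a, 'n) bil_field \<Rightarrow> ('a, 'n) vec_field \<Rightarrow> bool" where
  "killing_field A g X \<longleftrightarrow> (\<forall>c\<in>A. \<forall>p\<in>fst c. \<forall>i j.
     nabla_covec g (lower g X) c i j p + nabla_covec g (lower g X) c j i p = 0)"


section \<open>Characterization of the Christoffel symbols\<close>

lemma partial_cong:
  assumes "is_chart M c" "p \<in> fst c" "\<And>q. q \<in> fst c \<Longrightarrow> f q = h q"
  shows "partial c i f p = partial c i h p"
proof -
  have op: "open (snd c ` fst c)" and mem: "snd c p \<in> snd c ` fst c"
    using assms by (auto simp: is_chart_def)
  have eq: "(f \<circ> chart_inv c) y = (h \<circ> chart_inv c) y" if "y \<in> snd c ` fst c" for y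
    using assms(3) that by (auto simp: chart_inv_def inv_into_into)
  have "((f \<circ> chart_inv c) has_derivative D) (at (snd c p))
      \<longleftrightarrow> ((h \<circ> chart_inv c) has_derivative D) (at (snd c p))"
    (is "?f \<longleftrightarrow> ?h") for D
  proof
    assume ?f
    then show ?h
      by (rule has_derivative_transform_within_open[OF _ op mem]) (simp_all only: eq)
  next
    assume ?h
    then show ?f
      by (rule has_derivative_transform_within_open[OF _ op mem]) (simp_all only: eq)
  qed
  then show ?thesis
    by (simp add: partial_def frechet_derivative_def)
qed

lemma metric_inverse:
  assumes "riemannian_metric A g" "c \<in> A" "p \<in> fst c"
  shows "matrix_inv (g c p) ** g c p = mat 1" "g c p ** matrix_inv (g c p) = mat 1"
proof -
  have "\<forall>v. v \<noteq> 0 \<longrightarrow> v \<bullet> (g c p *v v) > 0"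
    using assms unfolding riemannian_metric_def by blast
  then have "\<forall>v. g c p *v v = 0 \<longrightarrow> v = 0"
    by (metis inner_zero_right less_irrefl)
  then have "invertible (g c p)"
    by (simp add: invertible_left_inverse matrix_left_invertible_ker)
  then have "\<exists>B. g c p ** B = mat 1 \<and> B ** g c p = mat 1"
    by (simp add: invertible_def)
  then have "g c p ** matrix_inv (g c p) = mat 1 \<and> matrix_inv (g c p) ** g c p = mat 1"
    unfolding matrix_inv_def by (rule someI_ex)
  then show "matrix_inv (g c p) ** g c p = mat 1" "g c p ** matrix_inv (g c p) = mat 1"
    by auto
qed

lemma christoffel_unique:
  fixes C :: "'n::finite \<Rightarrow> 'n \<Rightarrow> 'n \<Rightarrow> real"
  assumes "smooth_atlas M A" "riemannian_metric A g" "c \<in> A" "p \<in> fst c"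
  shows "(\<forall>k i j. C k i j = christoffel g c k i j p) \<longleftrightarrow>
    (\<forall>k i j. C k i j = C k j i) \<and>
    (\<forall>k i j. partial c k (\<lambda>q. g c q $ i $ j) p
       - (\<Sum>l\<in>UNIV. C l k i * g c p $ l $ j) - (\<Sum>l\<in>UNIV. C l k j * g c p $ i $ l) = 0)"
proof -
  define D where "D k i j = partial c k (\<lambda>q. g c q $ i $ j) p" for k i j
  define L where "L m i j = (\<Sum>l\<in>UNIV. g c p $ m $ l * C l i j)" for m i j
  have ch: "is_chart M c"
    using assms by (simp add: smooth_atlas_def)
  have gsym: "g c q $ i $ j = g c q $ j $ i" if "q \<in> fst c" for q i j
  proof -
    have "transpose (g c q) = g c q"
      using assms that unfolding riemannian_metric_def by blast
    then have "transpose (g c q) $ j $ i = g c q $ j $ i" by simp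
    then show ?thesis by (simp add: transpose_def)
  qed
  have Dsym: "D k i j = D k j i" for k i j
    unfolding D_def by (rule partial_cong[OF ch assms(4)]) (rule gsym)
  have chr: "(\<chi> k. christoffel g c k i j p)
      = matrix_inv (g c p) *v (\<chi> l. (1/2) * (D i j l + D j i l - D l i j))" for i j
    by (simp add: vec_eq_iff christoffel_def D_def matrix_vector_mult_def sum_distrib_left
        algebra_simps)
  have Lvec: "(\<chi> m. L m i j) = g c p *v (\<chi> k. C k i j)" for i j
    by (simp add: L_def matrix_vector_mult_def vec_eq_iff)
  have swap: "g c p *v x = y \<longleftrightarrow> x = matrix_inv (g c p) *v y" for x y
    by (auto simp: matrix_vector_mul_assoc metric_inverse[OF assms(2-4)])
  have "(\<forall>k. C k i j = christoffel g c k i j p)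
      \<longleftrightarrow> (\<forall>m. L m i j = (1/2) * (D i j m + D j i m - D m i j))" for i j
  proof -
    have "(\<forall>k. C k i j = christoffel g c k i j p)
        \<longleftrightarrow> (\<chi> k. C k i j) = (\<chi> k. christoffel g c k i j p)"
      by (simp add: vec_eq_iff)
    also have "\<dots> \<longleftrightarrow> (\<chi> m. L m i j) = (\<chi> m. (1/2) * (D i j m + D j i m - D m i j))"
      unfolding chr Lvec swap ..
    finally show ?thesis by (simp add: vec_eq_iff)
  qed
  then have 1: "(\<forall>k i j. C k i j = christoffel g c k i j p)
      \<longleftrightarrow> (\<forall>m i j. L m i j = (1/2) * (D i j m + D j i m - D m i j))"
    by blast
  have 2: "(\<forall>k i j. C k i j = C k j i) \<longleftrightarrow> (\<forall>m i j. L m i j = L m j i)"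
  proof -
    have "(\<forall>k. C k i j = C k j i) \<longleftrightarrow> (\<forall>m. L m i j = L m j i)" for i j
    proof -
      have "(\<forall>k. C k i j = C k j i) \<longleftrightarrow> (\<chi> k. C k i j) = (\<chi> k. C k j i)"
        by (simp add: vec_eq_iff)
      also have "\<dots> \<longleftrightarrow> (\<chi> m. L m i j) = (\<chi> m. L m j i)"
        unfolding Lvec swap by (simp add: matrix_vector_mul_assoc metric_inverse[OF assms(2-4)])
      finally show ?thesis by (simp add: vec_eq_iff)
    qed
    then show ?thesis by blast
  qed
  have 3: "(\<Sum>l\<in>UNIV. C l k i * g c p $ l $ j) = L j k i" for k i j
    unfolding L_def by (rule sum.cong[OF refl]) (metis gsym[OF assms(4)] mult.commute)
  have 4: "(\<Sum>l\<in>UNIV. C l k j * g c p $ i $ l) = L i k j" for k i j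
    unfolding L_def by (rule sum.cong) (auto simp: mult.commute)
  have "(\<forall>m i j. L m i j = (1/2) * (D i j m + D j i m - D m i j)) \<longleftrightarrow>
    (\<forall>m i j. L m i j = L m j i) \<and> (\<forall>k i j. D k i j - L j k i - L i k j = 0)" (is "?l \<longleftrightarrow> ?r")
  proof
    assume ?l
    then have l: "L m i j = (1/2) * (D i j m + D j i m - D m i j)" for m i j
      by blast
    show ?r
    proof (intro conjI allI)
      fix m i j
      show "L m i j = L m j i"
        unfolding l Dsym[of m i j] by simp
      show "D m i j - L j m i - L i m j = 0"
        unfolding l Dsym[of m i j] by (simp add: field_simps)
    qed
  next
    assume r: ?r
    show ?l
    proof (intro allI)
      fix m i j
      have "D i j m = L j i m + L m i j" "D j i m = L m j i + L i j m" "D m i j = L j m i + L i m j"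
        using r by (simp_all add: algebra_simps)
      moreover have "L m i j = L m j i" "L j i m = L j m i" "L i j m = L i m j"
        using r by blast+
      ultimately show "L m i j = (1/2) * (D i j m + D j i m - D m i j)"
        by simp
    qed
  qed
  then show ?thesis
    unfolding 1 2 3 4 by (simp only: D_def)
qed

end

theory Submission
  imports Defs
begin

text \<open>Let \<open>T\<^sub>i\<^sub>j = \<nabla>\<^sub>i X\<^sub>j + \<nabla>\<^sub>j X\<^sub>i\<close>. By the Ricci identity the first three terms of the equation
  are the divergence of \<open>T\<close>, so the equation reads
  \<open>0 = \<nabla>\<^sup>i T\<^sub>i\<^sub>j + T\<^sub>j\<^sub>k X\<^sup>k / 2 + div(X) X\<^sub>j / 2\<close>. It clearly holds when \<open>T = 0\<close>. Conversely, contracting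
  with \<open>X\<close> turns it into \<open>div(W) = |T|\<^sup>2 / 2\<close> for the vector field
  \<open>W = T(X, \<cdot>) + |X|\<^sup>2 X / 2\<close>, and on a closed manifold a vector field of nonnegative divergence
  has divergence zero. For the latter, take a partition of unity \<open>\<rho>\<^sub>a\<close> subordinate to charts.
  Integration by parts in the chart of \<open>\<rho>\<^sub>a\<close> gives
  \<open>\<Sum>\<^sub>a \<integral> \<rho>\<^sub>a div(W) = - \<Sum>\<^sub>a \<integral> d\<rho>\<^sub>a(W) = - \<Sum>\<^sub>a \<Sum>\<^sub>b \<integral> \<rho>\<^sub>b d\<rho>\<^sub>a(W)\<close>; moving each summand to the
  chart of \<open>\<rho>\<^sub>b\<close> and summing over \<open>a\<close> first gives zero. In this form only the change of variables
  for functions is needed, not the invariance of the divergence.\<close>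

section \<open>Continuously differentiable functions\<close>

text \<open>The field \<open>W\<close> is dictated by the Leibniz rule. The divergence of
  \<open>T(X, .)\<close> is the divergence of \<open>T\<close> contracted with \<open>X\<close>,
  plus \<open>T\<close> contracted with the covariant derivative of \<open>X\<close>; since
  \<open>T\<close> is twice the symmetric part of that derivative, the second contribution is
  \<open>|T|^2 / 2\<close>. The divergence of \<open>|X|^2 X / 2\<close> is
  \<open>T(X, X) / 2 + |X|^2 div(X) / 2\<close>, exactly what the last two terms of the equation
  contribute after contraction with \<open>X\<close>. Fields are families of components, so
  \<open>W\<close> must be shown to obey the transformation law of vectors. This succeeds without a
  transformation law for Christoffel symbols: \<open>T(X, .)\<close> is the Lie derivative along
  \<open>X\<close> of the 1-form of \<open>X\<close>, whose coordinate expression is free of them.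
  The partition of unity is differentiated only once, hence bumps of class C^1 serve.\<close>

lemma Ck_on_subset: "Ck_on k f S \<Longrightarrow> T \<subseteq> S \<Longrightarrow> Ck_on k f T"
proof (induction k arbitrary: f)
  case 0 then show ?case using continuous_on_subset by simp blast
next
  case (Suc k) then show ?case unfolding Ck_on.simps by (meson subsetD)
qed

lemma has_derivative_cong_open:
  assumes "open S" "x \<in> S" "\<And>y. y \<in> S \<Longrightarrow> f y = h y"
  shows "(f has_derivative D) (at x) \<longleftrightarrow> (h has_derivative D) (at x)"
  using has_derivative_transform_within_open[OF _ assms(1,2), of f D UNIV h]
    has_derivative_transform_within_open[OF _ assms(1,2), of h D UNIV f] assms(3)
  by auto

lemma frechet_derivative_cong_open:
  assumes "open S" "x \<in> S" "\<And>y. y \<in> S \<Longrightarrow> f y = h y"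
  shows "frechet_derivative f (at x) = frechet_derivative h (at x)"
  by (simp add: frechet_derivative_def has_derivative_cong_open[OF assms])

lemma differentiable_cong_open:
  assumes "open S" "x \<in> S" "\<And>y. y \<in> S \<Longrightarrow> f y = h y"
  shows "f differentiable (at x) \<longleftrightarrow> h differentiable (at x)"
  by (simp add: differentiable_def has_derivative_cong_open[OF assms])

lemma Ck_on_cong:
  assumes "open S" "\<And>y. y \<in> S \<Longrightarrow> f y = h y"
  shows "Ck_on k f S \<longleftrightarrow> Ck_on k h S"
  using assms(2)
proof (induction k arbitrary: f h)
  case 0 then show ?case by (simp cong: continuous_on_cong)
next
  case (Suc k)
  have "Ck_on k (\<lambda>x. frechet_derivative f (at x) v) S
      \<longleftrightarrow> Ck_on k (\<lambda>x. frechet_derivative h (at x) v) S" for v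
    by (rule Suc.IH) (simp add: frechet_derivative_cong_open[OF assms(1) _ Suc.prems])
  moreover have "(\<forall>x\<in>S. f differentiable (at x)) \<longleftrightarrow> (\<forall>x\<in>S. h differentiable (at x))"
    by (simp add: differentiable_cong_open[OF assms(1) _ Suc.prems])
  ultimately show ?case by simp
qed

lemma Ck_on_SucI:
  assumes "open S" "\<And>x. x \<in> S \<Longrightarrow> (f has_derivative f' x) (at x)"
    "\<And>v. Ck_on k (\<lambda>x. f' x v) S"
  shows "Ck_on (Suc k) f S"
proof -
  have "f differentiable (at x)" if "x \<in> S" for x
    using assms(2) that by (auto simp: differentiable_def)
  moreover have "Ck_on k (\<lambda>x. frechet_derivative f (at x) v) S" for v
    using assms(3)[of v]
    by (subst Ck_on_cong[OF assms(1), of _ "\<lambda>x. f' x v"])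
       (simp_all add: frechet_derivative_at[OF assms(2), symmetric])
  ultimately show ?thesis by simp
qed

lemma Ck_on_Suc_derivative:
  assumes "Ck_on (Suc k) f S" "x \<in> S"
  shows "(f has_derivative frechet_derivative f (at x)) (at x)"
  using assms frechet_derivative_works by auto

lemma Ck_on_imp_continuous_on: "Ck_on k f S \<Longrightarrow> continuous_on S f"
proof (cases k)
  case (Suc k') 
  assume "Ck_on k f S"
  then show ?thesis using Suc
    by (auto intro!: continuous_at_imp_continuous_on differentiable_imp_continuous_within)
qed simp

lemma Ck_on_Suc_imp: "Ck_on (Suc k) f S \<Longrightarrow> Ck_on k f S"
proof (induction k arbitrary: f)
  case 0 then show ?case using Ck_on_imp_continuous_on[of "Suc 0"] by simp
next
  case (Suc k)
  have "Ck_on k (\<lambda>x. frechet_derivative f (at x) v) S" for v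
    using Suc.prems by (intro Suc.IH) simp
  with Suc.prems show ?case by simp
qed

lemma Ck_on_const: "open S \<Longrightarrow> Ck_on k (\<lambda>x. a) S"
proof (induction k arbitrary: a)
  case (Suc k) then show ?case by (intro Ck_on_SucI[where f'="\<lambda>x v. 0"]) auto
qed simp

lemma Ck_on_add:
  assumes "open S"
  shows "Ck_on k f S \<Longrightarrow> Ck_on k h S \<Longrightarrow> Ck_on k (\<lambda>x. f x + h x) S"
proof (induction k arbitrary: f h)
  case 0 then show ?case by (simp add: continuous_on_add)
next
  case (Suc k)
  show ?case
    by (rule Ck_on_SucI[OF assms has_derivative_add[OF Ck_on_Suc_derivative[OF Suc.prems(1)]
        Ck_on_Suc_derivative[OF Suc.prems(2)]]]) (use Suc in auto)
qed

lemma (in bounded_linear) Ck_on_compose: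
  assumes "open S"
  shows "Ck_on k g S \<Longrightarrow> Ck_on k (\<lambda>x. f (g x)) S"
proof (induction k arbitrary: g)
  case 0 then show ?case by (simp add: continuous_on)
next
  case (Suc k)
  show ?case
    by (rule Ck_on_SucI[OF assms has_derivative[OF Ck_on_Suc_derivative[OF Suc.prems(1)]]])
       (use Suc in auto)
qed

lemma (in bounded_bilinear) Ck_on_bilinear:
  assumes "open S"
  shows "Ck_on k f S \<Longrightarrow> Ck_on k h S \<Longrightarrow> Ck_on k (\<lambda>x. prod (f x) (h x)) S"
proof (induction k arbitrary: f h)
  case 0 then show ?case by (simp add: continuous_on)
next
  case (Suc k)
  show ?case
    by (rule Ck_on_SucI[OF assms FDERIV[OF Ck_on_Suc_derivative[OF Suc.prems(1)]
        Ck_on_Suc_derivative[OF Suc.prems(2)]]])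
      (use Suc Ck_on_Suc_imp[OF Suc.prems(1)] Ck_on_Suc_imp[OF Suc.prems(2)]
        in \<open>auto intro!: Ck_on_add[OF assms]\<close>)
qed

lemmas Ck_on_mult = bounded_bilinear.Ck_on_bilinear[OF bounded_bilinear_mult]
lemmas Ck_on_scaleR = bounded_bilinear.Ck_on_bilinear[OF bounded_bilinear_scaleR]

lemma Ck_on_sum:
  assumes "open S" "\<And>i. i \<in> I \<Longrightarrow> Ck_on k (f i) S"
  shows "Ck_on k (\<lambda>x. \<Sum>i\<in>I. f i x) S"
  using assms(2)
  by (induction I rule: infinite_finite_induct) (auto intro!: Ck_on_add Ck_on_const assms(1))

lemma Ck_on_prod:
  fixes f :: "'i \<Rightarrow> 'e::euclidean_space \<Rightarrow> real"
  assumes "open S" "\<And>i. i \<in> I \<Longrightarrow> Ck_on k (f i) S"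
  shows "Ck_on k (\<lambda>x. \<Prod>i\<in>I. f i x) S"
  using assms(2)
  by (induction I rule: infinite_finite_induct) (auto intro!: Ck_on_mult Ck_on_const assms(1))

text \<open>The chain rule evaluates the derivative of \<open>f\<close> in a direction that varies
  with the point. Expanding this direction in \<open>Basis\<close> yields a finite sum of products
  with fixed directions, and the induction hypothesis, available for all outer functions, covers the
  derivative of \<open>f\<close> in each of them.\<close>

lemma Ck_on_compose:
  fixes g :: "'d::euclidean_space \<Rightarrow> 'e::euclidean_space"
  assumes "open S" "open T" and gk: "Ck_on k g S" and sub: "\<And>x. x \<in> S \<Longrightarrow> g x \<in> T"
    and fk: "Ck_on k f T"
  shows "Ck_on k (\<lambda>x. f (g x)) S"
  using gk fk
proof (induction k arbitrary: f)
  case 0 then show ?case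
    using sub by (auto intro: continuous_on_compose2)
next
  case (Suc k)
  let ?D = "\<lambda>x v. \<Sum>b\<in>Basis. (frechet_derivative g (at x) v \<bullet> b) *\<^sub>R frechet_derivative f (at (g x)) b"
  have der: "((\<lambda>x. f (g x)) has_derivative ?D x) (at x)" if "x \<in> S" for x
  proof -
    have g: "(g has_derivative frechet_derivative g (at x)) (at x)"
      using Ck_on_Suc_derivative[OF Suc.prems(1) that] .
    have f: "(f has_derivative frechet_derivative f (at (g x))) (at (g x))"
      using Ck_on_Suc_derivative[OF Suc.prems(2) sub[OF that]] .
    have lin: "linear (frechet_derivative f (at (g x)))"
      using f has_derivative_linear by blast
    have "((\<lambda>x. f (g x)) has_derivative
        (\<lambda>v. frechet_derivative f (at (g x)) (frechet_derivative g (at x) v))) (at x)"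
      by (rule has_derivative_compose[OF g f])
    also have "(\<lambda>v. frechet_derivative f (at (g x)) (frechet_derivative g (at x) v)) = ?D x"
    proof
      fix v
      show "frechet_derivative f (at (g x)) (frechet_derivative g (at x) v) = ?D x v"
        by (subst euclidean_representation[symmetric, of "frechet_derivative g (at x) v"])
           (simp only: linear_sum[OF lin] linear_scale[OF lin] o_def)
    qed
    finally show ?thesis .
  qed
  show ?case
  proof (rule Ck_on_SucI[OF assms(1) der])
    fix v
    have "Ck_on k (\<lambda>x. frechet_derivative g (at x) v) S"
      using Suc.prems(1) by simp
    then have 1: "Ck_on k (\<lambda>x. frechet_derivative g (at x) v \<bullet> b) S" for b
      by (rule bounded_linear.Ck_on_compose[OF bounded_linear_inner_left assms(1)])
    have 2: "Ck_on k (\<lambda>x. frechet_derivative f (at (g x)) b) S" for b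
      by (rule Suc.IH[OF Ck_on_Suc_imp[OF Suc.prems(1)]]) (use Suc.prems(2) in simp)
    show "Ck_on k (\<lambda>x. ?D x v) S"
      by (intro Ck_on_sum Ck_on_scaleR 1 2 assms(1))
  qed
qed

text \<open>The derivative of \<open>1 / f\<close> is a polynomial in \<open>1 / f\<close> and the
  derivative of \<open>f\<close>, so each degree of regularity of \<open>1 / f\<close> yields the
  next one. The square root below is bootstrapped in the same way.\<close>

lemma Ck_on_inverse:
  fixes f :: "'e::euclidean_space \<Rightarrow> real"
  assumes "open S" "Ck_on k f S" "\<And>x. x \<in> S \<Longrightarrow> f x \<noteq> 0"
  shows "Ck_on k (\<lambda>x. inverse (f x)) S"
  using assms(2)
proof (induction k)
  case 0 then show ?case using assms(3) by (simp add: continuous_on_inverse)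
next
  case (Suc k)
  have k: "Ck_on k (\<lambda>x. inverse (f x)) S"
    by (rule Suc.IH[OF Ck_on_Suc_imp[OF Suc.prems]])
  show ?case
  proof (rule Ck_on_SucI[OF assms(1)])
    show "((\<lambda>x. inverse (f x)) has_derivative
        (\<lambda>v. -1 * (inverse (f x) * frechet_derivative f (at x) v * inverse (f x)))) (at x)" if "x \<in> S" for x
      using Deriv.has_derivative_inverse[OF assms(3)[OF that] Ck_on_Suc_derivative[OF Suc.prems that]]
      by simp
    show "Ck_on k (\<lambda>x. -1 * (inverse (f x) * frechet_derivative f (at x) v * inverse (f x))) S" for v
      by (intro Ck_on_mult Ck_on_const assms(1) k) (use Suc.prems in simp)
  qed
qed

lemma Ck_on_sqrt:
  fixes f :: "'e::euclidean_space \<Rightarrow> real"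
  assumes "open S" "Ck_on k f S" "\<And>x. x \<in> S \<Longrightarrow> f x > 0"
  shows "Ck_on k (\<lambda>x. sqrt (f x)) S"
  using assms(2)
proof (induction k)
  case 0 then show ?case by (simp add: continuous_on_real_sqrt)
next
  case (Suc k)
  have k: "Ck_on k (\<lambda>x. sqrt (f x)) S"
    by (rule Suc.IH[OF Ck_on_Suc_imp[OF Suc.prems]])
  show ?case
  proof (rule Ck_on_SucI[OF assms(1)])
    show "((\<lambda>x. sqrt (f x)) has_derivative
        (\<lambda>v. frechet_derivative f (at x) v * (inverse (sqrt (f x)) * (1/2)))) (at x)" if "x \<in> S" for x
      using has_derivative_real_sqrt[OF assms(3)[OF that] Ck_on_Suc_derivative[OF Suc.prems that]]
      by simp
    have ne: "sqrt (f x) \<noteq> 0" if "x \<in> S" for x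
      using assms(3)[OF that] by simp
    have "Ck_on k (\<lambda>x. frechet_derivative f (at x) v) S" for v
      using Suc.prems by simp
    then show "Ck_on k (\<lambda>x. frechet_derivative f (at x) v * (inverse (sqrt (f x)) * (1/2))) S" for v
      by (intro Ck_on_mult Ck_on_const Ck_on_inverse assms(1) k ne)
  qed
qed

text \<open>Regularity is local. This serves to glue a function given on a chart region to its zero
  extension off a compact support.\<close>

lemma Ck_on_Union:
  assumes "\<And>S. S \<in> \<S> \<Longrightarrow> open S" "\<And>S. S \<in> \<S> \<Longrightarrow> Ck_on k f S"
  shows "Ck_on k f (\<Union>\<S>)"
  using assms(2)
proof (induction k arbitrary: f)
  case 0 then show ?case using assms(1) by (auto intro!: continuous_on_open_Union)
next
  case (Suc k)
  have "Ck_on k (\<lambda>x. frechet_derivative f (at x) v) (\<Union>\<S>)" for v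
    by (rule Suc.IH) (use Suc.prems in auto)
  with Suc.prems show ?case by auto
qed

section \<open>Symmetry of second derivatives\<close>

lemma second_difference_mvt:
  fixes f :: "'e::euclidean_space \<Rightarrow> real"
  assumes f: "Ck_on 2 f S" and h: "h > 0"
    and sub: "\<And>s t. 0 \<le> s \<Longrightarrow> s \<le> h \<Longrightarrow> 0 \<le> t \<Longrightarrow> t \<le> h \<Longrightarrow> x + s *\<^sub>R u + t *\<^sub>R v \<in> S"
  obtains s t where "0 \<le> s" "s \<le> h" "0 \<le> t" "t \<le> h"
    "f (x + h *\<^sub>R u + h *\<^sub>R v) - f (x + h *\<^sub>R u) - f (x + h *\<^sub>R v) + f x =
      h * h * frechet_derivative (\<lambda>y. frechet_derivative f (at y) u) (at (x + s *\<^sub>R u + t *\<^sub>R v)) v"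
proof -
  let ?F = "\<lambda>y. frechet_derivative f (at y) u"
  have 2: "Ck_on (Suc (Suc 0)) f S" using f by (simp add: numeral_2_eq_2)
  have F1: "Ck_on (Suc 0) ?F S" using 2 by simp
  have line: "((\<lambda>s. G (a + s *\<^sub>R w)) has_real_derivative frechet_derivative G (at (a + s *\<^sub>R w)) w) (at s)"
    if "G differentiable (at (a + s *\<^sub>R w))" for G :: "'e \<Rightarrow> real" and a w s
  proof -
    have G: "(G has_derivative frechet_derivative G (at (a + s *\<^sub>R w))) (at (a + s *\<^sub>R w))"
      using that frechet_derivative_works by blast
    have "((\<lambda>s. a + s *\<^sub>R w) has_derivative (\<lambda>t. t *\<^sub>R w)) (at s)"
      by (auto intro!: derivative_eq_intros)
    from has_derivative_compose[OF this G]
    have "((\<lambda>s. G (a + s *\<^sub>R w)) has_derivative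
        (\<lambda>t. frechet_derivative G (at (a + s *\<^sub>R w)) (t *\<^sub>R w))) (at s)" .
    also have "(\<lambda>t. frechet_derivative G (at (a + s *\<^sub>R w)) (t *\<^sub>R w))
        = (*) (frechet_derivative G (at (a + s *\<^sub>R w)) w)"
      by (rule ext) (simp only: linear_scale[OF has_derivative_linear[OF G]] real_scaleR_def mult.commute)
    finally show ?thesis
      by (simp only: has_field_derivative_def)
  qed
  \<comment> \<open>A second difference is the difference along \<open>u\<close> of a difference
    along \<open>v\<close>. One mean value theorem in each direction turns it into a mixed
    derivative at an intermediate point.\<close>
  define \<phi> where "\<phi> s = f ((x + h *\<^sub>R v) + s *\<^sub>R u) - f (x + s *\<^sub>R u)" for s
  have "\<exists>s. 0 < s \<and> s < h \<and> \<phi> h - \<phi> 0 = (h - 0) * (?F ((x + h *\<^sub>R v) + s *\<^sub>R u) - ?F (x + s *\<^sub>R u))"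
  proof (rule MVT2[OF h])
    fix s :: real assume s: "0 \<le> s" "s \<le> h"
    have "(x + h *\<^sub>R v) + s *\<^sub>R u \<in> S" "x + s *\<^sub>R u \<in> S"
      using sub[of s h] sub[of s 0] s h by (simp_all add: algebra_simps)
    then show "(\<phi> has_real_derivative ?F ((x + h *\<^sub>R v) + s *\<^sub>R u) - ?F (x + s *\<^sub>R u)) (at s)"
      unfolding \<phi>_def[abs_def] using 2 by (intro DERIV_diff line) auto
  qed
  then obtain s where s: "0 < s" "s < h"
    "\<phi> h - \<phi> 0 = h * (?F ((x + h *\<^sub>R v) + s *\<^sub>R u) - ?F (x + s *\<^sub>R u))" by auto
  have "\<exists>t. 0 < t \<and> t < h \<and> ?F ((x + s *\<^sub>R u) + h *\<^sub>R v) - ?F ((x + s *\<^sub>R u) + 0 *\<^sub>R v) =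
      (h - 0) * frechet_derivative ?F (at ((x + s *\<^sub>R u) + t *\<^sub>R v)) v"
  proof (rule MVT2[OF h])
    fix t :: real assume t: "0 \<le> t" "t \<le> h"
    have "(x + s *\<^sub>R u) + t *\<^sub>R v \<in> S"
      using sub[of s t] s t h by simp
    then show "((\<lambda>t. ?F ((x + s *\<^sub>R u) + t *\<^sub>R v)) has_real_derivative
        frechet_derivative ?F (at ((x + s *\<^sub>R u) + t *\<^sub>R v)) v) (at t)"
      using F1 by (intro line) auto
  qed
  then obtain t where t: "0 < t" "t < h"
    "?F ((x + s *\<^sub>R u) + h *\<^sub>R v) - ?F (x + s *\<^sub>R u) = h * frechet_derivative ?F (at ((x + s *\<^sub>R u) + t *\<^sub>R v)) v"
    by auto
  have "(x + h *\<^sub>R v) + s *\<^sub>R u = (x + s *\<^sub>R u) + h *\<^sub>R v" by simp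
  with s(3) t(3) have "\<phi> h - \<phi> 0 = h * (h * frechet_derivative ?F (at (x + s *\<^sub>R u + t *\<^sub>R v)) v)"
    by metis
  moreover have "\<phi> h - \<phi> 0 = f (x + h *\<^sub>R u + h *\<^sub>R v) - f (x + h *\<^sub>R u) - f (x + h *\<^sub>R v) + f x"
    by (simp add: \<phi>_def algebra_simps)
  ultimately show ?thesis
    using s t by (intro that[of s t]) auto
qed

text \<open>The second difference does not change when \<open>u\<close> and \<open>v\<close> are
  exchanged, so the two mixed derivatives take a common value at two points of one small
  parallelogram at \<open>x\<close>. Continuity moves both points to \<open>x\<close>.\<close>

lemma second_derivative_symmetric:
  fixes f :: "'e::euclidean_space \<Rightarrow> real"
  assumes "open S" "Ck_on 2 f S" "x \<in> S"
  shows "frechet_derivative (\<lambda>y. frechet_derivative f (at y) u) (at x) v =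
         frechet_derivative (\<lambda>y. frechet_derivative f (at y) v) (at x) u"
proof -
  define A where "A u v y = frechet_derivative (\<lambda>y. frechet_derivative f (at y) u) (at y) v" for u v y
  have cont: "isCont (A u v) x" for u v
  proof -
    have "continuous_on S (A u v)"
      using assms(2) by (simp add: A_def numeral_2_eq_2)
    then show ?thesis using assms continuous_on_eq_continuous_at by blast
  qed
  have "\<bar>A u v x - A v u x\<bar> \<le> e" if "e > 0" for e
  proof -
    obtain d1 where d1: "d1 > 0" "\<And>y. dist y x < d1 \<Longrightarrow> \<bar>A u v y - A u v x\<bar> < e/2"
      using cont[of u v] \<open>e > 0\<close> unfolding continuous_at_eps_delta dist_real_def
      by (meson half_gt_zero)
    obtain d2 where d2: "d2 > 0" "\<And>y. dist y x < d2 \<Longrightarrow> \<bar>A v u y - A v u x\<bar> < e/2"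
      using cont[of v u] \<open>e > 0\<close> unfolding continuous_at_eps_delta dist_real_def
      by (meson half_gt_zero)
    obtain d3 where d3: "d3 > 0" "ball x d3 \<subseteq> S"
      using assms open_contains_ball by blast
    define d where "d = min d1 (min d2 d3)"
    have d: "d > 0" "d \<le> d1" "d \<le> d2" "d \<le> d3" using d1 d2 d3 by (auto simp: d_def)
    \<comment> \<open>The two sides of the parallelogram together have length at most
      \<open>d / 2\<close>; the summand 1 keeps the denominator positive when
      \<open>u = v = 0\<close>.\<close>
    define h where "h = d / (2 * (norm u + norm v + 1))"
    have pos: "norm u + norm v + 1 > 0" by (smt (verit) norm_ge_zero)
    have h: "h > 0" using d pos by (simp add: h_def)
    have near: "dist (x + s *\<^sub>R u + t *\<^sub>R v) x < d" if "0 \<le> s" "s \<le> h" "0 \<le> t" "t \<le> h" for s t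
    proof -
      have "dist (x + s *\<^sub>R u + t *\<^sub>R v) x = norm (s *\<^sub>R u + t *\<^sub>R v)" by (simp add: dist_norm)
      also have "\<dots> \<le> s * norm u + t * norm v"
        using norm_triangle_ineq[of "s *\<^sub>R u" "t *\<^sub>R v"] that by simp
      also have "\<dots> \<le> h * norm u + h * norm v"
        using that by (intro add_mono mult_right_mono) auto
      also have "\<dots> \<le> h * (norm u + norm v + 1)" using h by (simp add: algebra_simps)
      also have "\<dots> = d / 2" using pos by (simp add: h_def field_simps)
      also have "\<dots> < d" using d by simp
      finally show ?thesis .
    qed
    have near': "dist (x + s *\<^sub>R v + t *\<^sub>R u) x < d" if "0 \<le> s" "s \<le> h" "0 \<le> t" "t \<le> h" for s t
      using near[of t s] that by (simp add: algebra_simps)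
    have inS: "y \<in> S" if "dist y x < d" for y
      using that d d3(2) by (auto simp: mem_ball dist_commute)
    obtain s t where st: "0 \<le> s" "s \<le> h" "0 \<le> t" "t \<le> h"
      "f (x + h *\<^sub>R u + h *\<^sub>R v) - f (x + h *\<^sub>R u) - f (x + h *\<^sub>R v) + f x = h * h * A u v (x + s *\<^sub>R u + t *\<^sub>R v)"
      unfolding A_def by (rule second_difference_mvt[OF assms(2) h, of x u v]) (use near inS in blast)+
    obtain s' t' where st': "0 \<le> s'" "s' \<le> h" "0 \<le> t'" "t' \<le> h"
      "f (x + h *\<^sub>R v + h *\<^sub>R u) - f (x + h *\<^sub>R v) - f (x + h *\<^sub>R u) + f x = h * h * A v u (x + s' *\<^sub>R v + t' *\<^sub>R u)"
      unfolding A_def by (rule second_difference_mvt[OF assms(2) h, of x v u]) (use near' inS in blast)+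
    have "h * h * A u v (x + s *\<^sub>R u + t *\<^sub>R v) = h * h * A v u (x + s' *\<^sub>R v + t' *\<^sub>R u)"
      using st(5) st'(5) by (simp add: algebra_simps)
    then have "A u v (x + s *\<^sub>R u + t *\<^sub>R v) = A v u (x + s' *\<^sub>R v + t' *\<^sub>R u)" using h by simp
    moreover have "\<bar>A u v (x + s *\<^sub>R u + t *\<^sub>R v) - A u v x\<bar> < e/2"
      using near[OF st(1-4)] d by (intro d1) auto
    moreover have "\<bar>A v u (x + s' *\<^sub>R v + t' *\<^sub>R u) - A v u x\<bar> < e/2"
      using near'[OF st'(1-4)] d by (intro d2) auto
    ultimately show ?thesis by linarith
  qed
  then have "A u v x = A v u x"
    by (metis abs_ge_zero abs_le_zero_iff dense_ge eq_iff_diff_eq_0)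
  then show ?thesis by (simp add: A_def)
qed

section \<open>Matrices\<close>

lemma inner_matrix_vector_right: "x \<bullet> (B *v y) = (transpose B *v x) \<bullet> y" for B :: "real^'n::finite^'m::finite"
  by (metis dot_lmul_matrix vector_transpose_matrix transpose_transpose)

text \<open>Symmetric elimination takes the place of a spectral theorem: splitting off one square
  \<open>(w \<bullet> x) * (w \<bullet> y)\<close> leaves a positive semidefinite form of smaller
  rank.\<close>

lemma psd_sum_of_squares:
  fixes H :: "real^'n::finite^'n"
  assumes "transpose H = H" "\<And>x. x \<bullet> (H *v x) \<ge> 0"
  shows "\<exists>vs. \<forall>x y. x \<bullet> (H *v y) = (\<Sum>v\<leftarrow>vs. (v \<bullet> x) * (v \<bullet> y))"
  using assms
proof (induction "dim (range (\<lambda>x. H *v x))" arbitrary: H rule: less_induct)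
  case less
  show ?case
  proof (cases "\<forall>x. x \<bullet> (H *v x) = 0")
    case True
    \<comment> \<open>Polarization: a symmetric form that vanishes on the diagonal vanishes.\<close>
    have "x \<bullet> (H *v y) = 0" for x y
    proof -
      have "(x + y) \<bullet> (H *v (x + y)) = 0" "x \<bullet> (H *v x) = 0" "y \<bullet> (H *v y) = 0"
        using True by blast+
      moreover have "y \<bullet> (H *v x) = x \<bullet> (H *v y)"
        using inner_matrix_vector_right[of y H x] less.prems(1) by (simp add: inner_commute)
      ultimately show ?thesis
        by (simp add: matrix_vector_right_distrib inner_add_left inner_add_right)
    qed
    then show ?thesis by (intro exI[of _ "[]"]) simp
  next
    case False
    then obtain x0 where x0: "x0 \<bullet> (H *v x0) \<noteq> 0" by blast
    define d where "d = x0 \<bullet> (H *v x0)"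
    have d: "d > 0" using x0 less.prems(2)[of x0] by (simp add: d_def)
    \<comment> \<open>The scaling gives \<open>w \<bullet> x0 = sqrt d\<close>, which puts
      \<open>x0\<close> into the kernel of \<open>H'\<close>.\<close>
    define w where "w = (1 / sqrt d) *\<^sub>R (H *v x0)"
    have sym: "x \<bullet> (H *v y) = (H *v x) \<bullet> y" for x y
      using inner_matrix_vector_right[of x H y] less.prems(1) by simp
    define H' where "H' = H - (\<chi> i j. w $ i * w $ j)"
    have H'v: "H' *v y = H *v y - (w \<bullet> y) *\<^sub>R w" for y
      by (simp add: H'_def vec_eq_iff matrix_vector_mult_def inner_vec_def sum_subtractf
          sum_distrib_left sum_distrib_right algebra_simps)
    have H': "x \<bullet> (H' *v y) = x \<bullet> (H *v y) - (w \<bullet> x) * (w \<bullet> y)" for x y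
      by (simp add: H'v inner_diff_right inner_commute mult.commute)
    have wx: "w \<bullet> y = (1 / sqrt d) * (x0 \<bullet> (H *v y))" for y
      by (simp add: w_def sym)
    have w0: "w \<bullet> x0 = sqrt d"
      using d by (simp add: wx d_def[symmetric] real_div_sqrt)
    have sym': "transpose H' = H'"
      using less.prems(1) by (simp add: H'_def transpose_def vec_eq_iff mult.commute)
    have psd': "x \<bullet> (H' *v x) \<ge> 0" for x
    proof -
      \<comment> \<open>This \<open>t\<close> minimizes the form \<open>H\<close> along the line
        \<open>x - t *\<^sub>R x0\<close>. The minimum is the value of the form \<open>H'\<close> at
        \<open>x\<close>; its sign is the Cauchy-Schwarz inequality.\<close>
      define t where "t = (x0 \<bullet> (H *v x)) / d"
      have "0 \<le> (x - t *\<^sub>R x0) \<bullet> (H *v (x - t *\<^sub>R x0))" by (rule less.prems)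
      also have "\<dots> = x \<bullet> (H *v x) - 2 * t * (x0 \<bullet> (H *v x)) + t * t * d"
        using sym[of x x0] by (simp add: matrix_vector_mult_diff_distrib inner_diff_left inner_diff_right
            d_def inner_commute[of "H *v x"] algebra_simps matrix_vector_mult_scaleR)
      also have "\<dots> = x \<bullet> (H *v x) - (x0 \<bullet> (H *v x))^2 / d"
        using d by (simp add: t_def power2_eq_square field_simps)
      also have "\<dots> = x \<bullet> (H' *v x)"
        using d by (simp add: H' wx power2_eq_square field_simps)
      finally show ?thesis .
    qed
    \<comment> \<open>The range does not grow, and it loses \<open>H *v x0\<close>: the range of
      \<open>H'\<close> is orthogonal to \<open>x0\<close>, whereas
      \<open>x0 \<bullet> (H *v x0)\<close> is nonzero.\<close>
    have "range (\<lambda>x. H' *v x) \<subset> range (\<lambda>x. H *v x)"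
    proof
      have "H' *v y = H *v (y - ((w \<bullet> y) / sqrt d) *\<^sub>R x0)" for y
        by (simp add: H'v w_def matrix_vector_mult_diff_distrib matrix_vector_mult_scaleR)
      then show "range (\<lambda>x. H' *v x) \<subseteq> range (\<lambda>x. H *v x)" by auto
      have "x0 \<bullet> (H' *v y) = 0" for y
        using d by (simp add: H' w0 wx flip: d_def)
      moreover have "x0 \<bullet> (H *v x0) \<noteq> 0" by (rule x0)
      ultimately show "range (\<lambda>x. H' *v x) \<noteq> range (\<lambda>x. H *v x)"
        by (metis rangeE rangeI)
    qed
    moreover have "subspace (range (\<lambda>x. B *v x))" for B :: "real^'n^'n"
      by (metis matrix_vector_mul_linear linear_subspace_image subspace_UNIV)
    ultimately have "dim (range (\<lambda>x. H' *v x)) < dim (range (\<lambda>x. H *v x))"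
      by (intro dim_psubset) (metis span_eq_iff)
    from less.hyps[OF this sym' psd'] obtain vs where
      vs: "\<And>x y. x \<bullet> (H' *v y) = (\<Sum>v\<leftarrow>vs. (v \<bullet> x) * (v \<bullet> y))" by blast
    have "x \<bullet> (H *v y) = (\<Sum>v\<leftarrow>w # vs. (v \<bullet> x) * (v \<bullet> y))" for x y
      using H'[of x y] vs[of x y] by simp
    then show ?thesis by blast
  qed
qed

lemma trace_psd_mult:
  fixes H :: "real^'n::finite^'n"
  assumes "\<And>x y. x \<bullet> (H *v y) = (\<Sum>v\<leftarrow>vs. (v \<bullet> x) * (v \<bullet> y))"
  shows "trace (H ** B) = (\<Sum>v\<leftarrow>vs. v \<bullet> (B *v v))"
proof -
  have H: "H $ i $ k = (\<Sum>v\<leftarrow>vs. v $ i * v $ k)" for i k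
    using assms[of "axis i 1" "axis k 1"]
    by (simp add: inner_axis inner_axis' matrix_vector_mult_basis column_def)
  have "trace (H ** B) = (\<Sum>i\<in>UNIV. \<Sum>k\<in>UNIV. \<Sum>v\<leftarrow>vs. v $ i * v $ k * B $ k $ i)"
    by (simp add: trace_def matrix_matrix_mult_def H sum_list_mult_const)
  also have "\<dots> = (\<Sum>v\<leftarrow>vs. \<Sum>i\<in>UNIV. \<Sum>k\<in>UNIV. v $ i * v $ k * B $ k $ i)"
    by (induction vs) (simp_all add: sum.distrib)
  also have "(\<lambda>v. \<Sum>i\<in>UNIV. \<Sum>k\<in>UNIV. v $ i * v $ k * B $ k $ i) = (\<lambda>v. v \<bullet> (B *v v))"
    by (rule ext, subst sum.swap)
      (simp add: inner_vec_def matrix_vector_mult_def sum_distrib_left algebra_simps)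
  finally show ?thesis .
qed

text \<open>For \<open>H\<close> the inverse metric the trace is \<open>|T|^2\<close>. Writing the
  outer \<open>H\<close> as a sum of squares turns it into a sum of values of the form
  \<open>H\<close> at the vectors \<open>transpose T *v v\<close>. If it is zero, all these vectors
  vanish; then \<open>H\<close> pairs \<open>T *v y\<close> to zero with every vector, in particular
  with itself.\<close>

lemma trace_pd_square:
  fixes H T :: "real^'n::finite^'n"
  assumes sym: "transpose H = H" and pd: "\<And>x. x \<noteq> 0 \<Longrightarrow> x \<bullet> (H *v x) > 0"
  shows "trace (H ** (T ** H ** transpose T)) \<ge> 0"
    and "trace (H ** (T ** H ** transpose T)) = 0 \<Longrightarrow> T = 0"
proof -
  have psd: "x \<bullet> (H *v x) \<ge> 0" for x using pd[of x] by (cases "x = 0") auto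
  obtain vs where vs: "\<And>x y. x \<bullet> (H *v y) = (\<Sum>v\<leftarrow>vs. (v \<bullet> x) * (v \<bullet> y))"
    using psd_sum_of_squares[OF sym psd] by blast
  define q where "q v = (transpose T *v v) \<bullet> (H *v (transpose T *v v))" for v
  have q0: "q v \<ge> 0" for v using psd by (simp add: q_def)
  have tr: "trace (H ** (T ** H ** transpose T)) = (\<Sum>v\<leftarrow>vs. q v)"
    unfolding trace_psd_mult[OF vs] q_def
    by (simp add: matrix_vector_mul_assoc[symmetric] inner_matrix_vector_right[of _ T])
  then show "trace (H ** (T ** H ** transpose T)) \<ge> 0"
    using q0 by (auto intro!: sum_list_nonneg)
  assume "trace (H ** (T ** H ** transpose T)) = 0"
  then have "\<forall>v\<in>set vs. q v = 0"
    using tr q0 sum_list_nonneg_eq_0_iff[of "map q vs"] by auto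
  then have Tv: "transpose T *v v = 0" if "v \<in> set vs" for v
    using pd that unfolding q_def by (metis less_irrefl)
  have "(T *v y) \<bullet> (H *v x) = 0" for x y
  proof -
    have "(\<Sum>v\<leftarrow>vs. (v \<bullet> (T *v y)) * (v \<bullet> x)) = (\<Sum>v\<leftarrow>vs. 0)"
      by (intro arg_cong[where f = sum_list] map_cong refl)
        (simp only: inner_matrix_vector_right[of _ T] Tv inner_zero_left mult_zero_left)
    then show ?thesis by (simp add: vs)
  qed
  then have "T *v y = 0" for y
    using pd by (metis less_irrefl)
  then show "T = 0" by (simp add: matrix_eq)
qed

section \<open>Determinants: Jacobi's formula and Cramer's rule\<close>

lemma has_derivative_det:
  fixes F :: "'e::real_normed_vector \<Rightarrow> real^'n::finite^'n"
  assumes "\<And>i j. ((\<lambda>x. F x $ i $ j) has_derivative (\<lambda>v. F' v $ i $ j)) (at x)"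
  shows "((\<lambda>x. det (F x)) has_derivative
    (\<lambda>v. \<Sum>i\<in>UNIV. det (\<chi> j. if j = i then F' v $ j else F x $ j))) (at x)"
proof -
  have "((\<lambda>x. det (F x)) has_derivative
    (\<lambda>v. \<Sum>p | p permutes UNIV. of_int (sign p) *
      (\<Sum>i\<in>UNIV. F' v $ i $ p i * (\<Prod>j\<in>UNIV - {i}. F x $ j $ p j)))) (at x)"
    unfolding det_def
    by (intro has_derivative_sum has_derivative_mult_right has_derivative_prod assms)
  also have "(\<lambda>v. \<Sum>p | p permutes UNIV. of_int (sign p) *
      (\<Sum>i\<in>UNIV. F' v $ i $ p i * (\<Prod>j\<in>UNIV - {i}. F x $ j $ p j)))
    = (\<lambda>v. \<Sum>i\<in>UNIV. det (\<chi> j. if j = i then F' v $ j else F x $ j))"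
  proof
    fix v
    have "(\<Prod>j\<in>UNIV. (\<chi> j. if j = i then F' v $ j else F x $ j) $ j $ p j)
        = F' v $ i $ p i * (\<Prod>j\<in>UNIV - {i}. F x $ j $ p j)" for i and p :: "'n \<Rightarrow> 'n"
      by (subst prod.remove[of _ i]) (auto intro!: prod.cong)
    then show "(\<Sum>p | p permutes UNIV. of_int (sign p) *
          (\<Sum>i\<in>UNIV. F' v $ i $ p i * (\<Prod>j\<in>UNIV - {i}. F x $ j $ p j)))
        = (\<Sum>i\<in>UNIV. det (\<chi> j. if j = i then F' v $ j else F x $ j))"
      unfolding det_def by (subst sum.swap) (simp add: sum_distrib_left)
  qed
  finally show ?thesis .
qed

text \<open>Row \<open>i\<close> of \<open>B ** A\<close> is a combination of the rows of
  \<open>A\<close>, and only its \<open>i\<close>-th coefficient survives next to the other rows.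
  Together with \<open>has_derivative_det\<close> this is Jacobi's formula for a derivative of the
  form \<open>B ** A\<close>; no inverse of \<open>A\<close> enters.\<close>

lemma sum_det_replace_row:
  fixes A B :: "real^'n::finite^'n"
  shows "(\<Sum>i\<in>UNIV. det (\<chi> j. if j = i then (B ** A) $ j else A $ j)) = trace B * det A"
proof -
  have "det (\<chi> j. if j = i then (B ** A) $ j else A $ j) = B $ i $ i * det A" for i
  proof -
    have "(B ** A) $ i = (\<Sum>k\<in>UNIV. (B $ i) $ k *s row k A)"
      by (simp add: vec_eq_iff matrix_matrix_mult_def row_def)
    then have "(\<chi> j. if j = i then (B ** A) $ j else A $ j)
        = (\<chi> j. if j = i then \<Sum>k\<in>UNIV. (B $ i) $ k *s row k A else row j A)"
      by (simp add: vec_eq_iff row_def)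
    then show ?thesis by (simp only: cramer_lemma_transpose)
  qed
  then show ?thesis by (simp add: trace_def sum_distrib_right)
qed

text \<open>Exhibits the entries of an inverse as quotients of determinants, which is the source of
  the smoothness of the inverse metric.\<close>

lemma inverse_entry_cramer:
  fixes A :: "real^'n::finite^'n"
  assumes "A ** B = mat 1"
  shows "B $ k $ j = det (\<chi> i l. if l = k then axis j 1 $ i else A $ i $ l) / det A"
proof -
  have "det A \<noteq> 0"
    using assms det_mul[of A B] by auto
  moreover have "A *v (B *v axis j 1) = axis j 1"
    by (simp add: matrix_vector_mul_assoc assms)
  ultimately have "B *v axis j 1 = (\<chi> k. det (\<chi> i l. if l = k then axis j 1 $ i else A $ i $ l) / det A)"
    using cramer by blast
  then show ?thesis
    by (simp add: vec_eq_iff matrix_vector_mult_basis column_def)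
qed

lemma Ck_on_det:
  fixes F :: "'e::euclidean_space \<Rightarrow> real^'n::finite^'n"
  assumes "open S" "\<And>i j. Ck_on k (\<lambda>x. F x $ i $ j) S"
  shows "Ck_on k (\<lambda>x. det (F x)) S"
  unfolding det_def by (intro Ck_on_sum Ck_on_mult Ck_on_const Ck_on_prod assms)

section \<open>Calculus in a chart\<close>

definition Ck_in :: "nat \<Rightarrow> ('a, 'n::finite) chart \<Rightarrow> 'a set \<Rightarrow> ('a \<Rightarrow> real) \<Rightarrow> bool" where
  "Ck_in k c V f \<longleftrightarrow> Ck_on k (f \<circ> chart_inv c) (snd c ` V)"

lemma chart_inv_chart: "is_chart M c \<Longrightarrow> q \<in> fst c \<Longrightarrow> chart_inv c (snd c q) = q"
  unfolding is_chart_def chart_inv_def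
  by (metis homeomorphic_imp_injective_map inf.absorb_iff2 inv_into_f_f openin_subset topspace_subtopology)

lemma chart_chart_inv: "y \<in> snd c ` fst c \<Longrightarrow> snd c (chart_inv c y) = y"
  by (simp add: chart_inv_def f_inv_into_f)

lemma open_map_chart:
  assumes "is_chart M c" "openin M V" "V \<subseteq> fst c"
  shows "open (snd c ` V)"
proof -
  have "openin (subtopology M (fst c)) V"
    using assms by (metis inf.absorb_iff2 inf_commute openin_subtopology_Int)
  then have "openin (top_of_set (snd c ` fst c)) (snd c ` V)"
    using assms(1) unfolding is_chart_def homeomorphic_eq_everything_map open_map_def by blast
  then show ?thesis
    using assms(1) openin_open_eq unfolding is_chart_def by blast
qed

text \<open>\<open>V\<close> will be a whole chart domain, the overlap of two domains, or a domain
  with a compact support removed.\<close>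

locale chart_region =
  fixes M :: "'a topology" and c :: "('a, 'n::finite) chart" and V :: "'a set"
  assumes chart: "is_chart M c" and openV: "openin M V" and sub: "V \<subseteq> fst c"
begin

lemma open_image: "open (snd c ` V)"
  using open_map_chart[OF chart openV sub] .

lemma inv_chart: "q \<in> V \<Longrightarrow> chart_inv c (snd c q) = q"
  using chart_inv_chart[OF chart] sub by blast

lemma image_inv: "y \<in> snd c ` V \<Longrightarrow> chart_inv c y \<in> V \<and> snd c (chart_inv c y) = y"
  using inv_chart by auto

lemma Ck_in_cong:
  assumes "\<And>q. q \<in> V \<Longrightarrow> f q = h q"
  shows "Ck_in k c V f \<longleftrightarrow> Ck_in k c V h"
  unfolding Ck_in_def by (rule Ck_on_cong[OF open_image]) (use assms image_inv in auto)

lemma Ck_in_const: "Ck_in k c V (\<lambda>q. a)"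
  unfolding Ck_in_def o_def by (intro Ck_on_const open_image)

lemma Ck_in_add: "Ck_in k c V f \<Longrightarrow> Ck_in k c V h \<Longrightarrow> Ck_in k c V (\<lambda>q. f q + h q)"
  unfolding Ck_in_def o_def by (intro Ck_on_add open_image)

lemma Ck_in_mult: "Ck_in k c V f \<Longrightarrow> Ck_in k c V h \<Longrightarrow> Ck_in k c V (\<lambda>q. f q * h q)"
  unfolding Ck_in_def o_def by (intro Ck_on_mult open_image)

lemma Ck_in_uminus: "Ck_in k c V f \<Longrightarrow> Ck_in k c V (\<lambda>q. - f q)"
  using Ck_in_mult[OF Ck_in_const[of k "-1"]] by simp

lemma Ck_in_diff: "Ck_in k c V f \<Longrightarrow> Ck_in k c V h \<Longrightarrow> Ck_in k c V (\<lambda>q. f q - h q)"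
  using Ck_in_add[OF _ Ck_in_uminus] by simp

lemma Ck_in_sum: "(\<And>i. i \<in> I \<Longrightarrow> Ck_in k c V (f i)) \<Longrightarrow> Ck_in k c V (\<lambda>q. \<Sum>i\<in>I. f i q)"
  unfolding Ck_in_def o_def by (intro Ck_on_sum open_image)

lemma Ck_in_inverse:
  assumes "Ck_in k c V f" "\<And>q. q \<in> V \<Longrightarrow> f q \<noteq> 0"
  shows "Ck_in k c V (\<lambda>q. inverse (f q))"
  using assms image_inv unfolding Ck_in_def o_def by (auto intro!: Ck_on_inverse open_image)

lemma Ck_in_divide:
  assumes "Ck_in k c V f" "Ck_in k c V h" "\<And>q. q \<in> V \<Longrightarrow> h q \<noteq> 0"
  shows "Ck_in k c V (\<lambda>q. f q / h q)"
  unfolding divide_inverse by (intro Ck_in_mult Ck_in_inverse assms)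

lemma Ck_in_sqrt:
  assumes "Ck_in k c V f" "\<And>q. q \<in> V \<Longrightarrow> f q > 0"
  shows "Ck_in k c V (\<lambda>q. sqrt (f q))"
  using assms image_inv unfolding Ck_in_def o_def by (auto intro!: Ck_on_sqrt open_image)

lemma Ck_in_det:
  assumes "\<And>i j. Ck_in k c V (\<lambda>q. F q $ i $ j)"
  shows "Ck_in k c V (\<lambda>q. det (F q :: real^'m::finite^'m))"
  using assms unfolding Ck_in_def o_def by (intro Ck_on_det open_image)

lemmas Ck_in_intros = Ck_in_const Ck_in_add Ck_in_mult Ck_in_uminus Ck_in_diff Ck_in_sum

lemma Ck_in_partial:
  assumes "Ck_in (Suc k) c V f"
  shows "Ck_in k c V (partial c i f)"
proof -
  have "Ck_on k (\<lambda>y. frechet_derivative (f \<circ> chart_inv c) (at y) (axis i 1)) (snd c ` V)"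
    using assms unfolding Ck_in_def by simp
  then show ?thesis
    unfolding Ck_in_def
    by (rule iffD1[OF Ck_on_cong[OF open_image], rotated]) (use image_inv in \<open>auto simp: partial_def\<close>)
qed

lemma has_derivative_chart:
  assumes "Ck_in (Suc k) c V f" "p \<in> V"
  shows "((f \<circ> chart_inv c) has_derivative (\<lambda>v. \<Sum>i\<in>UNIV. v $ i * partial c i f p)) (at (snd c p))"
proof -
  have D: "((f \<circ> chart_inv c) has_derivative frechet_derivative (f \<circ> chart_inv c) (at (snd c p))) (at (snd c p))"
    using Ck_on_Suc_derivative assms unfolding Ck_in_def by blast
  have lin: "linear (frechet_derivative (f \<circ> chart_inv c) (at (snd c p)))"
    using D has_derivative_linear by blast
  have "frechet_derivative (f \<circ> chart_inv c) (at (snd c p)) v = (\<Sum>i\<in>UNIV. v $ i * partial c i f p)" for v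
  proof -
    have "frechet_derivative (f \<circ> chart_inv c) (at (snd c p)) (\<Sum>i\<in>UNIV. v $ i *\<^sub>R axis i 1)
        = (\<Sum>i\<in>UNIV. v $ i * partial c i f p)"
      by (simp only: linear_sum[OF lin] linear_scale[OF lin] partial_def real_scaleR_def)
    moreover have "(\<Sum>i\<in>UNIV. v $ i *\<^sub>R axis i 1) = v"
      using basis_expansion[of v] by (simp add: scalar_mult_eq_scaleR)
    ultimately show ?thesis by simp
  qed
  then have "frechet_derivative (f \<circ> chart_inv c) (at (snd c p)) = (\<lambda>v. \<Sum>i\<in>UNIV. v $ i * partial c i f p)"
    by blast
  then show ?thesis using D by simp
qed

lemma partialI:
  assumes "((\<lambda>y. f (chart_inv c y)) has_derivative D) (at (snd c p))"
  shows "partial c i f p = D (axis i 1)"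
  using frechet_derivative_at[OF assms] unfolding partial_def o_def by metis

lemma has_derivative_chart_partial:
  assumes "Ck_in (Suc 0) c V f" "p \<in> V"
  obtains D where "((\<lambda>y. f (chart_inv c y)) has_derivative D) (at (snd c p))"
    "\<And>i. partial c i f p = D (axis i 1)"
  using has_derivative_chart[OF assms] partialI unfolding o_def by blast

lemma partial_cong_region:
  assumes "p \<in> V" "\<And>q. q \<in> V \<Longrightarrow> f q = h q"
  shows "partial c i f p = partial c i h p"
proof -
  have "frechet_derivative (f \<circ> chart_inv c) (at (snd c p)) = frechet_derivative (h \<circ> chart_inv c) (at (snd c p))"
    by (rule frechet_derivative_cong_open[OF open_image]) (use assms image_inv in auto)
  then show ?thesis by (simp add: partial_def)
qed

lemma partial_const: "partial c i (\<lambda>q. a) p = 0"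
  by (subst partialI[OF has_derivative_const]) simp

lemma partial_add:
  assumes "p \<in> V" "Ck_in (Suc 0) c V f" "Ck_in (Suc 0) c V h"
  shows "partial c i (\<lambda>q. f q + h q) p = partial c i f p + partial c i h p"
  by (rule has_derivative_chart_partial[OF assms(2,1)], rule has_derivative_chart_partial[OF assms(3,1)])
    (subst partialI[OF has_derivative_add], assumption+, simp)

lemma partial_mult:
  assumes "p \<in> V" "Ck_in (Suc 0) c V f" "Ck_in (Suc 0) c V h"
  shows "partial c i (\<lambda>q. f q * h q) p = partial c i f p * h p + f p * partial c i h p"
  by (rule has_derivative_chart_partial[OF assms(2,1)], rule has_derivative_chart_partial[OF assms(3,1)])
    (subst partialI[OF has_derivative_mult], assumption+, simp add: inv_chart[OF assms(1)])

lemma partial_sum: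
  assumes "p \<in> V" "\<And>j. j \<in> I \<Longrightarrow> Ck_in (Suc 0) c V (f j)"
  shows "partial c i (\<lambda>q. \<Sum>j\<in>I. f j q) p = (\<Sum>j\<in>I. partial c i (f j) p)"
  using assms(2)
  by (induction I rule: infinite_finite_induct) (simp_all add: partial_const partial_add assms(1) Ck_in_sum)

text \<open>The regularity of the quotient is known from \<open>Ck_in_divide\<close>, so its
  derivative can be solved for in the product rule for \<open>f = (f / h) * h\<close>. The square
  root is treated likewise.\<close>

lemma partial_divide:
  assumes "p \<in> V" "Ck_in (Suc 0) c V f" "Ck_in (Suc 0) c V h" "\<And>q. q \<in> V \<Longrightarrow> h q \<noteq> 0"
  shows "partial c i (\<lambda>q. f q / h q) p = (partial c i f p * h p - f p * partial c i h p) / (h p * h p)"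
proof -
  have "partial c i f p = partial c i (\<lambda>q. f q / h q * h q) p"
    by (rule partial_cong_region[OF assms(1)]) (simp add: assms(4))
  also have "\<dots> = partial c i (\<lambda>q. f q / h q) p * h p + f p / h p * partial c i h p"
    by (intro partial_mult Ck_in_divide assms)
  finally show ?thesis using assms(4)[OF assms(1)] by (simp add: field_simps)
qed

lemma partial_sqrt:
  assumes "p \<in> V" "Ck_in (Suc 0) c V f" "\<And>q. q \<in> V \<Longrightarrow> f q > 0"
  shows "partial c i (\<lambda>q. sqrt (f q)) p = partial c i f p / (2 * sqrt (f p))"
proof -
  have "partial c i f p = partial c i (\<lambda>q. sqrt (f q) * sqrt (f q)) p"
    by (rule partial_cong_region[OF assms(1)]) (simp add: assms(3) less_imp_le)
  also have "\<dots> = 2 * (sqrt (f p) * partial c i (\<lambda>q. sqrt (f q)) p)"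
    by (subst partial_mult) (use assms in \<open>auto intro!: Ck_in_sqrt\<close>)
  finally show ?thesis using assms(3)[OF assms(1)] by (simp add: field_simps)
qed

lemma partial_commute:
  assumes "Ck_in 2 c V f" "p \<in> V"
  shows "partial c i (partial c j f) p = partial c j (partial c i f) p"
proof -
  let ?F = "f \<circ> chart_inv c"
  have "partial c i (partial c j f) p =
      frechet_derivative (\<lambda>y. frechet_derivative ?F (at y) (axis j 1)) (at (snd c p)) (axis i 1)" for i j
  proof -
    have "frechet_derivative (partial c j f \<circ> chart_inv c) (at (snd c p)) =
        frechet_derivative (\<lambda>y. frechet_derivative ?F (at y) (axis j 1)) (at (snd c p))"
      by (rule frechet_derivative_cong_open[OF open_image]) (use assms image_inv in \<open>auto simp: partial_def\<close>)
    then show ?thesis by (simp add: partial_def[of _ _ "partial c j f"])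
  qed
  then show ?thesis
    using second_derivative_symmetric[OF open_image, of ?F "snd c p"] assms
    unfolding Ck_in_def by auto
qed

text \<open>Jacobi's formula; \<open>B\<close> plays the role of the derivative of \<open>F\<close>
  times the inverse of \<open>F\<close>.\<close>

lemma partial_det:
  fixes F :: "'a \<Rightarrow> real^'m::finite^'m"
  assumes "p \<in> V" "\<And>i j. Ck_in (Suc 0) c V (\<lambda>q. F q $ i $ j)"
    and "\<And>j k. partial c i (\<lambda>q. F q $ j $ k) p = (B ** F p) $ j $ k"
  shows "partial c i (\<lambda>q. det (F q)) p = trace B * det (F p)"
proof -
  define F' where "F' v = (\<chi> j k. \<Sum>i\<in>UNIV. v $ i * partial c i (\<lambda>q. F q $ j $ k) p)" for v :: "real^'n"
  have "((\<lambda>y. det (F (chart_inv c y))) has_derivative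
    (\<lambda>v. \<Sum>i\<in>UNIV. det (\<chi> j. if j = i then F' v $ j else F (chart_inv c (snd c p)) $ j))) (at (snd c p))"
    by (rule has_derivative_det) (use has_derivative_chart[OF assms(2,1)] in \<open>simp add: F'_def o_def\<close>)
  from partialI[OF this]
  have "partial c i (\<lambda>q. det (F q)) p = (\<Sum>l\<in>UNIV. det (\<chi> j. if j = l then F' (axis i 1) $ j else F p $ j))"
    by (simp only: inv_chart[OF assms(1)])
  also have "F' (axis i 1) = B ** F p"
    by (simp add: F'_def vec_eq_iff axis_def assms(3) if_distrib[of "\<lambda>x. x * _"] cong: if_cong)
  finally show ?thesis by (simp only: sum_det_replace_row)
qed

lemma Ck_in_Suc_imp: "Ck_in (Suc k) c V f \<Longrightarrow> Ck_in k c V f"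
  unfolding Ck_in_def by (rule Ck_on_Suc_imp)

end

lemma Ck_in_subset: "Ck_in k c V f \<Longrightarrow> W \<subseteq> V \<Longrightarrow> Ck_in k c W f"
  unfolding Ck_in_def by (rule Ck_on_subset) auto

section \<open>The Levi-Civita connection in a chart\<close>

lemma matrix_simps:
  fixes A B :: "real^'k::finite^'m::finite" and C :: "real^'n::finite^'k" and D :: "real^'m^'l::finite"
  shows "(A + B) ** C = A ** C + B ** C" "(A - B) ** C = A ** C - B ** C" "(- A) ** C = - (A ** C)"
    "D ** (A + B) = D ** A + D ** B" "D ** (A - B) = D ** A - D ** B" "D ** (- A) = - (D ** A)"
    "transpose (A + B) = transpose A + transpose B" "transpose (A - B) = transpose A - transpose B"
    "transpose (- A) = - transpose A"
  by (simp_all add: matrix_matrix_mult_def transpose_def vec_eq_iff sum.distrib sum_subtractf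
      sum_negf algebra_simps)

definition partial_mat :: "('a, 'n::finite) chart \<Rightarrow> 'n \<Rightarrow> ('a \<Rightarrow> real^'k::finite^'m::finite) \<Rightarrow> 'a \<Rightarrow> real^'k^'m" where
  "partial_mat c a F p = (\<chi> i j. partial c a (\<lambda>q. F q $ i $ j) p)"

definition partial_vec :: "('a, 'n::finite) chart \<Rightarrow> 'n \<Rightarrow> ('a \<Rightarrow> real^'m::finite) \<Rightarrow> 'a \<Rightarrow> real^'m" where
  "partial_vec c a Y p = (\<chi> i. partial c a (\<lambda>q. Y q $ i) p)"

context chart_region
begin

lemma partial_mat_mult:
  assumes "p \<in> V" "\<And>i j. Ck_in (Suc 0) c V (\<lambda>q. F q $ i $ j)" "\<And>i j. Ck_in (Suc 0) c V (\<lambda>q. K q $ i $ j)"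
  shows "partial_mat c a (\<lambda>q. F q ** K q) p = partial_mat c a F p ** K p + F p ** partial_mat c a K p"
  by (simp add: partial_mat_def vec_eq_iff matrix_matrix_mult_def partial_sum partial_mult assms
      Ck_in_mult sum.distrib)

lemma partial_mat_add:
  assumes "p \<in> V" "\<And>i j. Ck_in (Suc 0) c V (\<lambda>q. F q $ i $ j)" "\<And>i j. Ck_in (Suc 0) c V (\<lambda>q. K q $ i $ j)"
  shows "partial_mat c a (\<lambda>q. F q + K q) p = partial_mat c a F p + partial_mat c a K p"
  by (simp add: partial_mat_def vec_eq_iff partial_add assms)

lemma partial_mat_transpose: "partial_mat c a (\<lambda>q. transpose (F q)) p = transpose (partial_mat c a F p)"
  by (simp add: partial_mat_def vec_eq_iff transpose_def)

lemma partial_vec_mult: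
  assumes "p \<in> V" "\<And>i j. Ck_in (Suc 0) c V (\<lambda>q. F q $ i $ j)" "\<And>i. Ck_in (Suc 0) c V (\<lambda>q. Y q $ i)"
  shows "partial_vec c a (\<lambda>q. F q *v Y q) p = partial_mat c a F p *v Y p + F p *v partial_vec c a Y p"
  by (simp add: partial_mat_def partial_vec_def vec_eq_iff matrix_vector_mult_def partial_sum partial_mult
      assms Ck_in_mult sum.distrib)

lemma partial_inner:
  assumes "p \<in> V" "\<And>i. Ck_in (Suc 0) c V (\<lambda>q. Y q $ i)" "\<And>i. Ck_in (Suc 0) c V (\<lambda>q. Z q $ i)"
  shows "partial c a (\<lambda>q. Y q \<bullet> (Z q :: real^'m::finite)) p
    = partial_vec c a Y p \<bullet> Z p + Y p \<bullet> partial_vec c a Z p"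
  by (simp add: partial_vec_def inner_vec_def partial_sum partial_mult assms Ck_in_mult sum.distrib)

lemma partial_vec_scaleR:
  assumes "p \<in> V" "Ck_in (Suc 0) c V f" "\<And>i. Ck_in (Suc 0) c V (\<lambda>q. Y q $ i)"
  shows "partial_vec c a (\<lambda>q. f q *\<^sub>R Y q) p = partial c a f p *\<^sub>R Y p + f p *\<^sub>R partial_vec c a Y p"
  by (simp add: partial_vec_def vec_eq_iff partial_mult assms)

lemma partial_mat_cong:
  assumes "p \<in> V" "\<And>q. q \<in> V \<Longrightarrow> F q = K q"
  shows "partial_mat c a F p = partial_mat c a K p"
  unfolding partial_mat_def vec_eq_iff by (auto intro!: partial_cong_region assms arg_cong[where f="\<lambda>A. A $ _ $ _"])

lemma partial_vec_cong:
  assumes "p \<in> V" "\<And>q. q \<in> V \<Longrightarrow> Y q = Z q"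
  shows "partial_vec c a Y p = partial_vec c a Z p"
  unfolding partial_vec_def vec_eq_iff by (auto intro!: partial_cong_region assms arg_cong[where f="\<lambda>A. A $ _"])

lemma Ck_in_mat_mult:
  assumes "\<And>i j. Ck_in k c V (\<lambda>q. F q $ i $ j)" "\<And>i j. Ck_in k c V (\<lambda>q. K q $ i $ j)"
  shows "Ck_in k c V (\<lambda>q. (F q ** K q) $ i $ j)"
  using assms by (auto simp: matrix_matrix_mult_def intro!: Ck_in_sum Ck_in_mult)

lemma Ck_in_mat_vec:
  assumes "\<And>i j. Ck_in k c V (\<lambda>q. F q $ i $ j)" "\<And>i. Ck_in k c V (\<lambda>q. Y q $ i)"
  shows "Ck_in k c V (\<lambda>q. (F q *v Y q) $ i)"
  using assms by (auto simp: matrix_vector_mult_def intro!: Ck_in_sum Ck_in_mult)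

lemma Ck_in_inner:
  assumes "\<And>i. Ck_in k c V (\<lambda>q. Y q $ i)" "\<And>i. Ck_in k c V (\<lambda>q. Z q $ i)"
  shows "Ck_in k c V (\<lambda>q. Y q \<bullet> (Z q :: real^'m::finite))"
  using assms by (auto simp: inner_vec_def intro!: Ck_in_sum Ck_in_mult)

lemma Ck_in_mat_add:
  assumes "\<And>i j. Ck_in k c V (\<lambda>q. F q $ i $ j)" "\<And>i j. Ck_in k c V (\<lambda>q. K q $ i $ j)"
  shows "Ck_in k c V (\<lambda>q. (F q + K q) $ i $ j)"
  using assms by (simp add: Ck_in_add)

lemma Ck_in_vec_scaleR:
  assumes "Ck_in k c V f" "\<And>i. Ck_in k c V (\<lambda>q. Y q $ i)"
  shows "Ck_in k c V (\<lambda>q. (f q *\<^sub>R Y q) $ i)"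
  using assms by (simp add: Ck_in_mult)

lemma Ck_in_mat_transpose:
  "Ck_in k c V (\<lambda>q. F q $ j $ i) \<Longrightarrow> Ck_in k c V (\<lambda>q. transpose (F q) $ i $ j)"
  by (simp add: transpose_def)

end

lemma smooth_in_chart_Ck_in_vec:
  fixes Y :: "'a \<Rightarrow> real^'m::finite"
  assumes "is_chart M c"
  shows "smooth_in_chart (c :: ('a, 'n::finite) chart) Y \<longleftrightarrow> (\<forall>k i. Ck_in k c (fst c) (\<lambda>q. Y q $ i))"
proof -
  have op: "open (snd c ` fst c)" using assms by (simp add: is_chart_def)
  have "Ck_on k (Y \<circ> chart_inv c) (snd c ` fst c) \<longleftrightarrow>
      (\<forall>i. Ck_on k (\<lambda>y. Y (chart_inv c y) $ i) (snd c ` fst c))" (is "?l \<longleftrightarrow> ?r") for k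
  proof
    assume ?l then show ?r
      using bounded_linear.Ck_on_compose[OF bounded_linear_vec_nth op] by (auto simp: o_def)
  next
    assume r: ?r
    have "Ck_on k (\<lambda>y. \<Sum>i\<in>UNIV. Y (chart_inv c y) $ i *\<^sub>R (axis i 1 :: real^'m)) (snd c ` fst c)"
      using r by (intro Ck_on_sum Ck_on_scaleR Ck_on_const op) auto
    moreover have "(\<lambda>y. \<Sum>i\<in>UNIV. Y (chart_inv c y) $ i *\<^sub>R (axis i 1 :: real^'m)) = Y \<circ> chart_inv c"
      by (rule ext) (simp add: basis_expansion flip: scalar_mult_eq_scaleR)
    ultimately show ?l by simp
  qed
  then show ?thesis by (auto simp: smooth_in_chart_def smooth_on_def Ck_in_def o_def)
qed

lemma smooth_in_chart_Ck_in_mat: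
  assumes "smooth_in_chart (c :: ('a, 'n::finite) chart) (F :: 'a \<Rightarrow> real^'k::finite^'m::finite)" "is_chart M c"
  shows "Ck_in k c (fst c) (\<lambda>q. F q $ i $ j)"
proof -
  have op: "open (snd c ` fst c)" using assms by (simp add: is_chart_def)
  have "bounded_linear (\<lambda>A :: real^'k^'m. A $ i $ j)"
    using bounded_linear_compose[OF bounded_linear_vec_nth bounded_linear_vec_nth] .
  from bounded_linear.Ck_on_compose[OF this op] show ?thesis
    using assms(1) by (auto simp: smooth_in_chart_def smooth_on_def Ck_in_def o_def)
qed

locale metric_chart =
  fixes M :: "'a topology" and A :: "('a, 'n::finite) chart set" and g :: "('a, 'n) bil_field"
    and c :: "('a, 'n) chart"
  assumes atlas: "smooth_atlas M A" and metric: "riemannian_metric A g" and cA: "c \<in> A"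
begin

lemma chart_c: "is_chart M c"
  using atlas cA by (simp add: smooth_atlas_def)

sublocale chart_region M c "fst c"
  by unfold_locales (use chart_c in \<open>auto simp: is_chart_def\<close>)

abbreviation H :: "'a \<Rightarrow> real^'n^'n" where "H q \<equiv> matrix_inv (g c q)"

text \<open>The connection matrix in direction \<open>a\<close>, with the upper index as row.
  Covariant derivatives add \<open>\<Gamma> a\<close> on vectors, subtract its transpose on
  covectors, and add the commutator with it on endomorphisms.\<close>

definition \<Gamma> :: "'n \<Rightarrow> 'a \<Rightarrow> real^'n^'n" where
  "\<Gamma> a q = (\<chi> k j. christoffel g c k a j q)"

lemma g_sym: "p \<in> fst c \<Longrightarrow> transpose (g c p) = g c p"
  using metric cA unfolding riemannian_metric_def by blast

lemma g_pos: "p \<in> fst c \<Longrightarrow> v \<noteq> 0 \<Longrightarrow> v \<bullet> (g c p *v v) > 0"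
  using metric cA unfolding riemannian_metric_def by blast

lemma H_g: "p \<in> fst c \<Longrightarrow> H p ** g c p = mat 1" and g_H: "p \<in> fst c \<Longrightarrow> g c p ** H p = mat 1"
  using metric_inverse[OF metric cA] by auto

lemma H_sym: assumes "p \<in> fst c" shows "transpose (H p) = H p"
proof -
  have "transpose (H p) ** g c p = mat 1"
    using arg_cong[OF g_H[OF assms], of transpose] g_sym[OF assms] by (simp add: matrix_transpose_mul)
  then have "transpose (H p) ** g c p ** H p = H p" by simp
  then show ?thesis by (simp add: matrix_mul_assoc[symmetric] g_H[OF assms])
qed

lemma H_pos: assumes "p \<in> fst c" "v \<noteq> 0" shows "v \<bullet> (H p *v v) > 0"
proof -
  have gH: "g c p *v (H p *v v) = v" by (simp add: matrix_vector_mul_assoc g_H[OF assms(1)])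
  then have "H p *v v \<noteq> 0" using assms(2) by auto
  from g_pos[OF assms(1) this] show ?thesis by (simp add: gH inner_commute)
qed

lemma det_g_nonzero: "p \<in> fst c \<Longrightarrow> det (g c p) \<noteq> 0"
  using g_H[of p] by (metis det_I det_mul mult_zero_left zero_neq_one)

lemma Ck_in_g: "Ck_in k c (fst c) (\<lambda>q. g c q $ i $ j)"
  by (rule smooth_in_chart_Ck_in_mat[OF _ chart_c]) (use metric cA in \<open>unfold riemannian_metric_def, blast\<close>)

lemma Ck_in_H: "Ck_in k c (fst c) (\<lambda>q. H q $ i $ j)"
proof -
  have "Ck_in k c (fst c) (\<lambda>q. det (\<chi> i' l. if l = i then axis j 1 $ i' else g c q $ i' $ l) / det (g c q))"
  proof (intro Ck_in_divide Ck_in_det Ck_in_g det_g_nonzero)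
    show "Ck_in k c (fst c) (\<lambda>q. (\<chi> i' l. if l = i then axis j 1 $ i' else g c q $ i' $ l) $ i' $ l)" for i' l
      by (cases "l = i") (simp_all add: Ck_in_g Ck_in_const)
  qed
  then show ?thesis
    by (subst Ck_in_cong) (auto simp: inverse_entry_cramer[OF g_H])
qed

lemma Ck_in_christoffel: "Ck_in k c (fst c) (christoffel g c i a j)"
  unfolding christoffel_def[abs_def]
  by (intro Ck_in_intros Ck_in_H Ck_in_partial Ck_in_g)

lemma Ck_in_\<Gamma>: "Ck_in k c (fst c) (\<lambda>q. \<Gamma> a q $ i $ j)"
  by (simp add: \<Gamma>_def Ck_in_christoffel)

lemma christoffel_sym: "p \<in> fst c \<Longrightarrow> christoffel g c k i j p = christoffel g c k j i p"
  using christoffel_unique[OF atlas metric cA, of p "\<lambda>k i j. christoffel g c k i j p"] by auto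

text \<open>Metric compatibility, obtained by applying \<open>christoffel_unique\<close> to the
  Christoffel symbols themselves.\<close>

lemma partial_g:
  assumes "p \<in> fst c"
  shows "partial_mat c a (g c) p = transpose (\<Gamma> a p) ** g c p + g c p ** \<Gamma> a p"
proof -
  have "partial c a (\<lambda>q. g c q $ i $ j) p = (\<Sum>l\<in>UNIV. christoffel g c l a i p * g c p $ l $ j)
      + (\<Sum>l\<in>UNIV. christoffel g c l a j p * g c p $ i $ l)" for i j
    using christoffel_unique[OF atlas metric cA assms, of "\<lambda>k i j. christoffel g c k i j p"]
    by (auto simp: algebra_simps)
  then show ?thesis
    by (simp add: vec_eq_iff partial_mat_def \<Gamma>_def matrix_matrix_mult_def transpose_def mult.commute)
qed

text \<open>Follows by differentiating \<open>H ** g c = mat 1\<close>: the inverse metric is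
  parallel as well.\<close>

lemma partial_H:
  assumes p: "p \<in> fst c"
  shows "partial_mat c a H p = - (\<Gamma> a p ** H p) - H p ** transpose (\<Gamma> a p)"
proof -
  have "partial_mat c a (\<lambda>q. H q ** g c q) p = partial_mat c a (\<lambda>q. mat 1) p"
    by (rule partial_mat_cong[OF p]) (simp add: H_g)
  also have "\<dots> = 0" by (simp add: partial_mat_def partial_const vec_eq_iff)
  finally have "partial_mat c a H p ** g c p = - (H p ** partial_mat c a (g c) p)"
    by (simp add: partial_mat_mult[OF p Ck_in_H Ck_in_g] eq_neg_iff_add_eq_0)
  then have "partial_mat c a H p ** (g c p ** H p) = - (H p ** partial_mat c a (g c) p ** H p)"
    by (simp add: matrix_mul_assoc matrix_simps)
  also have "\<dots> = - ((H p ** transpose (\<Gamma> a p)) ** (g c p ** H p)) - (H p ** g c p) ** (\<Gamma> a p ** H p)"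
    by (simp add: partial_g[OF p] matrix_simps matrix_mul_assoc)
  finally show ?thesis by (simp add: g_H[OF p] H_g[OF p])
qed

lemma partial_det_g:
  assumes p: "p \<in> fst c"
  shows "partial c a (\<lambda>q. det (g c q)) p = 2 * trace (\<Gamma> a p) * det (g c p)"
proof -
  \<comment> \<open>The summand \<open>g \<Gamma>\<close> is written as
    \<open>(g \<Gamma> H) g\<close>, so that the derivative has \<open>g\<close> as right factor, as
    \<open>partial_det\<close> demands. Both summands of the left factor have the trace of \<Gamma>,
    whence the factor 2.\<close>
  have "partial_mat c a (g c) p = (transpose (\<Gamma> a p) + g c p ** \<Gamma> a p ** H p) ** g c p"
    by (simp add: partial_g[OF p] matrix_simps matrix_mul_assoc[symmetric] H_g[OF p])
  then have "partial c a (\<lambda>q. g c q $ j $ k) p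
      = ((transpose (\<Gamma> a p) + g c p ** \<Gamma> a p ** H p) ** g c p) $ j $ k" for j k
    unfolding partial_mat_def vec_eq_iff by simp
  from partial_det[OF p Ck_in_g this]
  have "partial c a (\<lambda>q. det (g c q)) p = trace (transpose (\<Gamma> a p) + g c p ** \<Gamma> a p ** H p) * det (g c p)" .
  moreover have "trace (g c p ** \<Gamma> a p ** H p) = trace (\<Gamma> a p)"
    by (subst trace_mul_sym) (simp add: matrix_mul_assoc H_g[OF p])
  moreover have "trace (transpose (\<Gamma> a p)) = trace (\<Gamma> a p)"
    by (simp add: trace_def transpose_def)
  ultimately show ?thesis by (simp add: trace_add)
qed

text \<open>By \<open>partial_det_g\<close> the trace of \<open>\<Gamma> j\<close> is half the
  logarithmic derivative of \<open>det g\<close>. Its derivative by the quotient rule is symmetric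
  because second derivatives of \<open>det g\<close> commute. Working with the quotient instead of a
  logarithm asks only for \<open>det g \<noteq> 0\<close>.\<close>

lemma partial_trace_\<Gamma>_commute:
  assumes p: "p \<in> fst c"
  shows "partial c i (\<lambda>q. trace (\<Gamma> j q)) p = partial c j (\<lambda>q. trace (\<Gamma> i q)) p"
proof -
  let ?d = "\<lambda>q. det (g c q)"
  have d: "Ck_in k c (fst c) ?d" for k by (intro Ck_in_det Ck_in_g)
  have "partial c i (\<lambda>q. trace (\<Gamma> j q)) p
      = (partial c i (partial c j ?d) p * (2 * ?d p) - partial c j ?d p * (2 * partial c i ?d p)) / (2 * ?d p * (2 * ?d p))" for i j
  proof -
    have "partial c i (\<lambda>q. trace (\<Gamma> j q)) p = partial c i (\<lambda>q. partial c j ?d q / (2 * ?d q)) p"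
      by (rule partial_cong_region[OF p]) (simp add: partial_det_g det_g_nonzero)
    also have "\<dots> = (partial c i (partial c j ?d) p * (2 * ?d p) - partial c j ?d p * partial c i (\<lambda>q. 2 * ?d q) p) / (2 * ?d p * (2 * ?d p))"
      by (intro partial_divide Ck_in_partial Ck_in_mult Ck_in_const d p) (simp add: det_g_nonzero)
    also have "partial c i (\<lambda>q. 2 * ?d q) p = 2 * partial c i ?d p"
      by (simp add: partial_mult[OF p Ck_in_const d] partial_const)
    finally show ?thesis .
  qed
  then show ?thesis using partial_commute[OF d p, of i j] by simp
qed

text \<open>The matrix under the sum is the curvature endomorphism in the directions
  \<open>i\<close> and \<open>j\<close>: the curl of the connection matrices plus their
  commutator.\<close>

lemma ricci_eq:
  "ricci g c p $ j $ k = (\<Sum>i\<in>UNIV. (partial_mat c i (\<Gamma> j) p - partial_mat c j (\<Gamma> i) p + \<Gamma> i p ** \<Gamma> j p - \<Gamma> j p ** \<Gamma> i p) $ i $ k)"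
  by (simp add: ricci_def riemann_def \<Gamma>_def partial_mat_def matrix_matrix_mult_def)

text \<open>By the first Bianchi identity the antisymmetric part of the Ricci tensor is the trace of the
  curvature endomorphism, the exterior derivative of the closed form \<open>d (log (det g)) / 2\<close>.\<close>

lemma ricci_sym:
  assumes p: "p \<in> fst c"
  shows "transpose (ricci g c p) = ricci g c p"
proof -
  have sy: "\<Gamma> a q $ k $ j = \<Gamma> j q $ k $ a" if "q \<in> fst c" for a k j q
    using christoffel_sym[OF that] by (simp add: \<Gamma>_def)
  have dsy: "partial_mat c i (\<Gamma> a) p $ k $ j = partial_mat c i (\<Gamma> j) p $ k $ a" for a k j i
  proof -
    have "partial c i (\<lambda>q. \<Gamma> a q $ k $ j) p = partial c i (\<lambda>q. \<Gamma> j q $ k $ a) p"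
      by (rule partial_cong_region[OF p sy])
    then show ?thesis by (simp add: partial_mat_def)
  qed
  have tr: "(\<Sum>i\<in>UNIV. partial_mat c a (\<Gamma> k) p $ i $ i) = partial c a (\<lambda>q. trace (\<Gamma> k q)) p" for a k
    by (simp add: partial_mat_def trace_def partial_sum[OF p Ck_in_\<Gamma>])
  have t1: "(\<Sum>i\<in>UNIV. partial_mat c j (\<Gamma> i) p $ i $ k) = partial c j (\<lambda>q. trace (\<Gamma> k q)) p" for j k
    unfolding tr[symmetric] by (rule sum.cong[OF refl]) (rule dsy)
  have t2: "(\<Sum>i\<in>UNIV. (\<Gamma> i p ** \<Gamma> j p) $ i $ k) = (\<Sum>i\<in>UNIV. \<Sum>m\<in>UNIV. \<Gamma> i p $ i $ m * \<Gamma> j p $ m $ k)" for j k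
    by (simp add: matrix_matrix_mult_def)
  have t3: "(\<Sum>i\<in>UNIV. (\<Gamma> j p ** \<Gamma> i p) $ i $ k) = (\<Sum>i\<in>UNIV. \<Sum>m\<in>UNIV. \<Gamma> j p $ i $ m * \<Gamma> k p $ m $ i)" for j k
    unfolding matrix_matrix_mult_def by (simp, intro sum.cong refl arg_cong2[where f="(*)"]) (rule sy[OF p])
  \<comment> \<open>Each of the four terms is symmetric in \<open>j\<close> and \<open>k\<close>:
    the first and the third since the connection is torsion-free, the second since the trace form is
    closed, the last by exchanging the summation indices.\<close>
  have ric: "ricci g c p $ j $ k = (\<Sum>i\<in>UNIV. partial_mat c i (\<Gamma> j) p $ i $ k) - partial c j (\<lambda>q. trace (\<Gamma> k q)) p
      + (\<Sum>i\<in>UNIV. \<Sum>m\<in>UNIV. \<Gamma> i p $ i $ m * \<Gamma> j p $ m $ k) - (\<Sum>i\<in>UNIV. \<Sum>m\<in>UNIV. \<Gamma> j p $ i $ m * \<Gamma> k p $ m $ i)" for j k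
    unfolding ricci_eq by (simp add: sum.distrib sum_subtractf t1 t2 t3)
  have "ricci g c p $ j $ k = ricci g c p $ k $ j" for j k
  proof -
    have "(\<Sum>i\<in>UNIV. \<Sum>m\<in>UNIV. \<Gamma> j p $ i $ m * \<Gamma> k p $ m $ i) = (\<Sum>i\<in>UNIV. \<Sum>m\<in>UNIV. \<Gamma> k p $ i $ m * \<Gamma> j p $ m $ i)"
      by (subst sum.swap) (simp add: mult.commute)
    then show ?thesis
      unfolding ric by (simp only: dsy[of _ j _ k] sy[OF p, of j _ k] partial_trace_\<Gamma>_commute[OF p, of j k])
  qed
  then show ?thesis by (simp add: vec_eq_iff transpose_def)
qed


end

section \<open>The divergence identity\<close>

definition nabla_mat :: "('a, 'n::finite) bil_field \<Rightarrow> ('a, 'n) vec_field \<Rightarrow> ('a, 'n) chart \<Rightarrow> 'a \<Rightarrow> real^'n^'n" where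
  "nabla_mat g Y c p = (\<chi> k i. nabla_vec g Y c i k p)"

text \<open>The field \<open>W\<close>; the factor 2 undoes the normalization of
  \<open>lie_metric\<close>.\<close>

definition lie_flux :: "('a, 'n::finite) bil_field \<Rightarrow> ('a, 'n) vec_field \<Rightarrow> ('a, 'n) vec_field" where
  "lie_flux g X c p = 2 *\<^sub>R contract g (lie_metric g X) X c p + (1/2 * (X c p \<bullet> lower g X c p)) *\<^sub>R X c p"

lemma divergence_eq_trace: "divergence g Y c p = trace (nabla_mat g Y c p)"
  by (simp add: divergence_def nabla_mat_def trace_def)

lemma (in chart_region) partial_vec_add:
  assumes "p \<in> V" "\<And>i. Ck_in (Suc 0) c V (\<lambda>q. Y q $ i)" "\<And>i. Ck_in (Suc 0) c V (\<lambda>q. Z q $ i)"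
  shows "partial_vec c a (\<lambda>q. Y q + Z q) p = partial_vec c a Y p + partial_vec c a Z p"
  by (simp add: partial_vec_def vec_eq_iff partial_add assms)

context metric_chart
begin

lemma nabla_mat_eq: "nabla_mat g Y c p $ k $ i = (partial_vec c i (Y c) p + \<Gamma> i p *v Y c p) $ k"
  by (simp add: nabla_mat_def nabla_vec_def partial_vec_def \<Gamma>_def matrix_vector_mult_def)

lemma divergence_eq: "divergence g Y c p = (\<Sum>i\<in>UNIV. (partial_vec c i (Y c) p + \<Gamma> i p *v Y c p) $ i)"
  by (simp add: divergence_eq_trace trace_def nabla_mat_eq)

end

section \<open>Covariant derivatives of the vector field in matrix form\<close>

locale field_chart = metric_chart M A g c
  for M :: "'a topology" and A :: "('a, 'n::finite) chart set" and g c +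
  fixes X :: "('a, 'n) vec_field"
  assumes smooth_X: "smooth_in_chart c (X c)"
begin

lemma Ck_in_X: "Ck_in k c (fst c) (\<lambda>q. X c q $ i)"
  using smooth_in_chart_Ck_in_vec[OF chart_c] smooth_X by blast

lemma Ck_in_partial_X: "Ck_in k c (fst c) (\<lambda>q. partial_vec c i (X c) q $ j)"
  by (simp add: partial_vec_def Ck_in_partial Ck_in_X)

text \<open>In matrix form \<open>\<nabla>\<^sub>i X\<^sup>k\<close> is the entry of \<open>N\<close> in row \<open>k\<close> and column \<open>i\<close>; \<open>N2 a\<close> and \<open>DP a\<close> are
  the covariant derivatives \<open>\<nabla>\<^sub>a\<close> of the (1,1)-tensors \<open>N\<close> and \<open>P\<close>.\<close>

definition N :: "'a \<Rightarrow> real^'n^'n" where "N = nabla_mat g X c"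

definition T :: "'a \<Rightarrow> real^'n^'n" where "T q = transpose (N q) ** g c q + g c q ** N q"

text \<open>\<open>T\<close> with its first index raised. For an endomorphism the divergence
  contracts an upper with a lower index, without derivatives of the metric.\<close>

definition P :: "'a \<Rightarrow> real^'n^'n" where "P q = H q ** T q"

definition N2 :: "'n \<Rightarrow> 'a \<Rightarrow> real^'n^'n" where
  "N2 a q = partial_mat c a N q + \<Gamma> a q ** N q - N q ** \<Gamma> a q"

definition DP :: "'n \<Rightarrow> 'a \<Rightarrow> real^'n^'n" where
  "DP a q = partial_mat c a P q + \<Gamma> a q ** P q - P q ** \<Gamma> a q"

lemma N_entry: "N q $ k $ i = (partial_vec c i (X c) q + \<Gamma> i q *v X c q) $ k"
  by (simp add: N_def nabla_mat_eq)

lemma Ck_in_N: "Ck_in k c (fst c) (\<lambda>q. N q $ i $ j)"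
  unfolding N_entry by (simp add: Ck_in_add Ck_in_partial_X Ck_in_mat_vec Ck_in_\<Gamma> Ck_in_X)

lemma Ck_in_T: "Ck_in k c (fst c) (\<lambda>q. T q $ i $ j)"
  unfolding T_def by (intro Ck_in_mat_add Ck_in_mat_mult Ck_in_mat_transpose Ck_in_N Ck_in_g)

lemma Ck_in_P: "Ck_in k c (fst c) (\<lambda>q. P q $ i $ j)"
  unfolding P_def by (intro Ck_in_mat_mult Ck_in_H Ck_in_T)

lemma nabla2_eq: "nabla2_vec g X c a i k p = N2 a p $ k $ i"
proof -
  have "nabla_vec g X c i k = (\<lambda>q. N q $ k $ i)" for i k
    by (simp add: fun_eq_iff N_def nabla_mat_def)
  then show ?thesis
    by (simp add: nabla2_vec_def N2_def partial_mat_def matrix_matrix_mult_def \<Gamma>_def mult.commute)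
qed

text \<open>Lowering an index commutes with covariant differentiation because \<open>g\<close> is
  parallel: the terms of \<open>partial_g\<close> cancel the covector correction and supply the one
  for vectors.\<close>

lemma nabla_covec_lower:
  assumes p: "p \<in> fst c"
  shows "nabla_covec g (lower g X) c i j p = (transpose (N p) ** g c p) $ i $ j"
proof -
  have "partial_vec c i (lower g X c) p - transpose (\<Gamma> i p) *v lower g X c p
      = g c p *v (partial_vec c i (X c) p + \<Gamma> i p *v X c p)"
    unfolding lower_def[abs_def] partial_vec_mult[OF p Ck_in_g Ck_in_X] partial_g[OF p]
    by (simp only: matrix_vector_mult_add_rdistrib matrix_vector_mul_assoc matrix_vector_right_distrib)
       (simp add: algebra_simps)
  moreover have "nabla_covec g (lower g X) c i j p
      = (partial_vec c i (lower g X c) p - transpose (\<Gamma> i p) *v lower g X c p) $ j"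
    by (simp add: nabla_covec_def partial_vec_def \<Gamma>_def matrix_vector_mult_def transpose_def vector_matrix_mult_def mult.commute)
  moreover have "g c p *v (partial_vec c i (X c) p + \<Gamma> i p *v X c p) = (\<chi> j. (g c p ** N p) $ j $ i)"
    by (simp add: vec_eq_iff matrix_vector_mult_def matrix_matrix_mult_def N_entry)
  moreover have "(g c p ** N p) $ j $ i = (transpose (N p) ** g c p) $ i $ j"
  proof -
    have "transpose (g c p ** N p) = transpose (N p) ** g c p"
      by (simp add: matrix_transpose_mul g_sym[OF p])
    then show ?thesis by (simp add: vec_eq_iff transpose_def)
  qed
  ultimately show ?thesis by simp
qed

lemma T_sym: "p \<in> fst c \<Longrightarrow> transpose (T p) = T p"
  by (simp add: T_def matrix_simps matrix_transpose_mul g_sym add.commute)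

lemma T_entry:
  assumes p: "p \<in> fst c"
  shows "T p $ i $ j = nabla_covec g (lower g X) c i j p + nabla_covec g (lower g X) c j i p"
proof -
  have "transpose (transpose (N p) ** g c p) = g c p ** N p"
    by (simp add: matrix_transpose_mul g_sym[OF p])
  then have "(transpose (N p) ** g c p) $ j $ i = (g c p ** N p) $ i $ j"
    by (simp add: vec_eq_iff transpose_def)
  then show ?thesis by (simp add: nabla_covec_lower[OF p] T_def)
qed

lemma lie_metric_eq: "p \<in> fst c \<Longrightarrow> lie_metric g X c p = (1/2) *\<^sub>R T p"
  by (simp add: lie_metric_def T_entry vec_eq_iff)

lemma contract_lie_metric: "p \<in> fst c \<Longrightarrow> contract g (lie_metric g X) X c p = (1/2) *\<^sub>R (P p *v X c p)"
proof -
  assume p: "p \<in> fst c"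
  have "X c p v* T p = T p *v X c p"
    using transpose_matrix_vector[of "T p" "X c p"] T_sym[OF p] by simp
  then have "X c p v* ((1/2) *\<^sub>R T p) = (1/2) *\<^sub>R (T p *v X c p)"
    by (simp add: vector_matrix_mult_def vec_eq_iff sum_distrib_left mult_ac)
  then show ?thesis
    by (simp add: contract_def raise_def lie_metric_eq[OF p] P_def matrix_vector_mult_scaleR
        matrix_vector_mul_assoc)
qed

lemma P_eq: "p \<in> fst c \<Longrightarrow> P p = H p ** transpose (N p) ** g c p + N p"
  by (simp add: P_def T_def matrix_simps matrix_mul_assoc H_g)

text \<open>As \<open>g\<close> and \<open>H\<close> are parallel, covariant differentiation passes
  through both and acts on \<open>N\<close> alone.\<close>

lemma DP_eq:
  assumes p: "p \<in> fst c"
  shows "DP a p = H p ** transpose (N2 a p) ** g c p + N2 a p"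
proof -
  have "partial_mat c a P p = partial_mat c a (\<lambda>q. H q ** transpose (N q) ** g c q + N q) p"
    by (rule partial_mat_cong[OF p]) (rule P_eq)
  also have "\<dots> = (partial_mat c a H p ** transpose (N p) + H p ** transpose (partial_mat c a N p)) ** g c p
      + H p ** transpose (N p) ** partial_mat c a (g c) p + partial_mat c a N p"
    by (simp add: partial_mat_add partial_mat_mult partial_mat_transpose p Ck_in_mat_mult
        Ck_in_mat_transpose Ck_in_H Ck_in_N Ck_in_g)
  finally show ?thesis
    unfolding DP_def N2_def P_eq[OF p]
    by (simp add: partial_H[OF p] partial_g[OF p] matrix_simps matrix_transpose_mul matrix_mul_assoc)
qed

text \<open>The Ricci identity for \<open>X\<close>. Second partial derivatives cancel, and so do
  the corrections for the lower index of \<open>N\<close>, as the connection is torsion-free; what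
  remains is the curvature endomorphism applied to \<open>X\<close>.\<close>

lemma N2_commutator:
  assumes p: "p \<in> fst c"
  shows "N2 l p $ k $ i - N2 i p $ k $ l =
    ((partial_mat c l (\<Gamma> i) p - partial_mat c i (\<Gamma> l) p + \<Gamma> l p ** \<Gamma> i p - \<Gamma> i p ** \<Gamma> l p) *v X c p) $ k"
proof -
  have col: "(\<chi> k. partial_mat c l N p $ k $ i) = partial_vec c l (partial_vec c i (X c)) p
      + partial_mat c l (\<Gamma> i) p *v X c p + \<Gamma> i p *v partial_vec c l (X c) p" for l i
  proof -
    have "(\<chi> k. partial_mat c l N p $ k $ i) = partial_vec c l (\<lambda>q. partial_vec c i (X c) q + \<Gamma> i q *v X c q) p"
      by (simp add: partial_mat_def partial_vec_def[of _ l] N_entry)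
    also have "\<dots> = partial_vec c l (partial_vec c i (X c)) p + partial_vec c l (\<lambda>q. \<Gamma> i q *v X c q) p"
      by (simp add: partial_vec_def[of _ l] vec_eq_iff partial_add[OF p Ck_in_partial_X Ck_in_mat_vec[OF Ck_in_\<Gamma> Ck_in_X]])
    finally show ?thesis by (simp add: partial_vec_mult[OF p Ck_in_\<Gamma> Ck_in_X])
  qed
  have N2col: "(\<chi> k. N2 l p $ k $ i) = (\<chi> k. partial_mat c l N p $ k $ i)
      + \<Gamma> l p *v (partial_vec c i (X c) p + \<Gamma> i p *v X c p) - N p *v (\<chi> m. \<Gamma> l p $ m $ i)" for l i
    by (simp add: N2_def vec_eq_iff matrix_matrix_mult_def matrix_vector_mult_def N_entry)
  have sy: "(\<chi> m. \<Gamma> l p $ m $ i) = (\<chi> m. \<Gamma> i p $ m $ l)"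
    using christoffel_sym[OF p] by (simp add: \<Gamma>_def)
  have dd: "partial_vec c l (partial_vec c i (X c)) p = partial_vec c i (partial_vec c l (X c)) p"
    unfolding partial_vec_def by (simp add: partial_commute[OF Ck_in_X p, of l i])
  have "(\<chi> k. N2 l p $ k $ i) - (\<chi> k. N2 i p $ k $ l) =
    (partial_mat c l (\<Gamma> i) p - partial_mat c i (\<Gamma> l) p + \<Gamma> l p ** \<Gamma> i p - \<Gamma> i p ** \<Gamma> l p) *v X c p"
    unfolding N2col col sy dd
    by (simp add: matrix_vector_mult_add_rdistrib matrix_vector_mult_diff_rdistrib
        matrix_vector_right_distrib matrix_vector_mul_assoc)
  then show ?thesis by (simp add: vec_eq_iff)
qed

text \<open>Contraction of \<open>N2_commutator\<close>. A commutator has trace zero, so the trace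
  of \<open>N2 j\<close> is the plain derivative of the divergence, while the contracted curvature
  is the Ricci tensor.\<close>

lemma ricci_identity:
  assumes p: "p \<in> fst c"
  shows "(\<Sum>a\<in>UNIV. N2 a p $ a $ j) = partial c j (divergence g X c) p + (ricci g c p *v X c p) $ j"
proof -
  have "(\<Sum>a\<in>UNIV. N2 a p $ a $ j) = (\<Sum>a\<in>UNIV. N2 j p $ a $ a)
      + (\<Sum>a\<in>UNIV. ((partial_mat c a (\<Gamma> j) p - partial_mat c j (\<Gamma> a) p + \<Gamma> a p ** \<Gamma> j p - \<Gamma> j p ** \<Gamma> a p) *v X c p) $ a)"
    unfolding sum.distrib[symmetric] N2_commutator[OF p, symmetric] by simp
  also have "(\<Sum>a\<in>UNIV. ((partial_mat c a (\<Gamma> j) p - partial_mat c j (\<Gamma> a) p + \<Gamma> a p ** \<Gamma> j p - \<Gamma> j p ** \<Gamma> a p) *v X c p) $ a)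
      = (ricci g c p *v X c p) $ j"
    unfolding matrix_vector_mult_def ricci_eq vec_lambda_beta sum_distrib_right by (rule sum.swap)
  also have "(\<Sum>a\<in>UNIV. N2 j p $ a $ a) = trace (partial_mat c j N p)"
    using trace_mul_sym[of "\<Gamma> j p" "N p"]
    by (simp add: N2_def trace_def sum.distrib sum_subtractf)
  also have "\<dots> = partial c j (divergence g X c) p"
  proof -
    have "divergence g X c = (\<lambda>q. \<Sum>i\<in>UNIV. N q $ i $ i)"
      by (simp add: fun_eq_iff divergence_eq_trace trace_def N_def)
    then show ?thesis by (simp add: trace_def partial_mat_def partial_sum[OF p Ck_in_N])
  qed
  finally show ?thesis .
qed

abbreviation equation_field :: "'a \<Rightarrow> real^'n" where
  "equation_field p \<equiv> rough_laplacian g X c p + gradient g (divergence g X) c p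
           + contract g (ricci g) X c p + contract g (lie_metric g X) X c p
           + (1/2 * divergence g X c p) *\<^sub>R X c p"

text \<open>By \<open>DP_eq\<close> the divergence of \<open>T\<close> has two halves: the
  transposed one is the Laplacian, and \<open>ricci_identity\<close> rewrites the other one as
  gradient plus Ricci term. Symmetry of the Ricci tensor enters because \<open>contract\<close>
  multiplies by \<open>X\<close> from the left.\<close>

lemma lower_equation_field:
  assumes p: "p \<in> fst c"
  shows "g c p *v equation_field p = (\<chi> j. \<Sum>a\<in>UNIV. DP a p $ a $ j) + (1/2) *\<^sub>R (T p *v X c p)
    + (1/2 * divergence g X c p) *\<^sub>R (g c p *v X c p)"
proof -
  have gH: "g c p *v (H p *v v) = v" for v
    by (simp add: matrix_vector_mul_assoc g_H[OF p])
  have lap: "(g c p *v rough_laplacian g X c p) $ j = (\<Sum>a\<in>UNIV. (H p ** transpose (N2 a p) ** g c p) $ a $ j)" for j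
  proof -
    have "(\<Sum>a\<in>UNIV. (H p ** transpose (N2 a p) ** g c p) $ a $ j)
        = (\<Sum>a\<in>UNIV. \<Sum>l\<in>UNIV. (\<Sum>k\<in>UNIV. H p $ a $ k * N2 a p $ l $ k) * g c p $ l $ j)"
      by (simp add: matrix_matrix_mult_def transpose_def)
    also have "\<dots> = (\<Sum>l\<in>UNIV. g c p $ j $ l * (\<Sum>a\<in>UNIV. \<Sum>k\<in>UNIV. H p $ a $ k * N2 a p $ l $ k))"
    proof (subst sum.swap, rule sum.cong[OF refl])
      fix l
      have "g c p $ l $ j = g c p $ j $ l"
        using arg_cong[OF g_sym[OF p], of "\<lambda>B. B $ j $ l"] by (simp add: transpose_def)
      then show "(\<Sum>a\<in>UNIV. (\<Sum>k\<in>UNIV. H p $ a $ k * N2 a p $ l $ k) * g c p $ l $ j)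
          = g c p $ j $ l * (\<Sum>a\<in>UNIV. \<Sum>k\<in>UNIV. H p $ a $ k * N2 a p $ l $ k)"
        by (simp only: sum_distrib_left[symmetric] mult.commute)
    qed
    finally show ?thesis
      by (simp add: matrix_vector_mult_def rough_laplacian_def nabla2_eq)
  qed
  have grad: "g c p *v gradient g (divergence g X) c p = (\<chi> j. partial c j (divergence g X c) p)"
    by (simp add: gradient_def raise_def gH)
  have "X c p v* ricci g c p = ricci g c p *v X c p"
    using transpose_matrix_vector[of "ricci g c p" "X c p"] ricci_sym[OF p] by simp
  then have ric: "g c p *v contract g (ricci g) X c p = ricci g c p *v X c p"
    by (simp add: contract_def raise_def gH)
  have lie: "g c p *v contract g (lie_metric g X) X c p = (1/2) *\<^sub>R (T p *v X c p)"
    by (simp add: contract_lie_metric[OF p] P_def matrix_vector_mult_scaleR gH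
        flip: matrix_vector_mul_assoc)
  have "(\<chi> j. \<Sum>a\<in>UNIV. DP a p $ a $ j) = g c p *v rough_laplacian g X c p
      + g c p *v gradient g (divergence g X) c p + g c p *v contract g (ricci g) X c p"
    unfolding grad ric by (simp add: vec_eq_iff DP_eq[OF p] sum.distrib lap ricci_identity[OF p])
  then show ?thesis
    by (simp only: matrix_vector_right_distrib lie matrix_vector_mult_scaleR)
qed

text \<open>Write \<open>P = Q + N\<close> with \<open>Q\<close> the adjoint of \<open>N\<close> for
  the metric. Since \<open>Q ** Q\<close> and \<open>N ** N\<close> have equal traces, the trace of
  \<open>P ** P\<close> is twice that of \<open>P ** N\<close>. This is the pairing of the symmetric
  \<open>T\<close> with the covariant derivative of \<open>X\<close>.\<close>

lemma trace_P_N: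
  assumes p: "p \<in> fst c"
  shows "trace (P p ** N p) = 1/2 * trace (H p ** (T p ** H p ** transpose (T p)))"
proof -
  let ?Q = "H p ** transpose (N p) ** g c p"
  have QQ: "trace (?Q ** ?Q) = trace (N p ** N p)"
  proof -
    have "?Q ** ?Q = H p ** (transpose (N p) ** (g c p ** H p) ** transpose (N p) ** g c p)"
      by (simp add: matrix_mul_assoc)
    also have "trace \<dots> = trace (transpose (N p) ** transpose (N p) ** (g c p ** H p))"
      by (subst trace_mul_sym) (simp add: g_H[OF p] flip: matrix_mul_assoc)
    also have "\<dots> = trace (transpose (N p ** N p))"
      by (simp add: g_H[OF p] matrix_transpose_mul)
    finally show ?thesis by (simp add: trace_def transpose_def)
  qed
  have "H p ** (T p ** H p ** transpose (T p)) = P p ** P p"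
    by (simp add: P_def T_sym[OF p] matrix_mul_assoc)
  also have "\<dots> = ?Q ** ?Q + ?Q ** N p + N p ** ?Q + N p ** N p"
    by (simp add: P_eq[OF p] matrix_simps)
  finally have "trace (H p ** (T p ** H p ** transpose (T p))) = 2 * trace (?Q ** N p) + 2 * trace (N p ** N p)"
    using trace_mul_sym[of "N p" ?Q] by (simp add: trace_add QQ)
  then show ?thesis by (simp add: P_eq[OF p] matrix_simps trace_add)
qed

lemma lie_flux_eq: "p \<in> fst c \<Longrightarrow> lie_flux g X c p = P p *v X c p + (1/2 * (X c p \<bullet> (g c p *v X c p))) *\<^sub>R X c p"
  by (simp add: lie_flux_def contract_lie_metric lower_def)

lemma Ck_in_lie_flux: "Ck_in k c (fst c) (\<lambda>q. lie_flux g X c q $ i)"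
proof -
  have "Ck_in k c (fst c) (\<lambda>q. (P q *v X c q) $ i + 1/2 * (X c q \<bullet> (g c q *v X c q)) * X c q $ i)"
    by (intro Ck_in_intros Ck_in_mat_vec Ck_in_inner Ck_in_P Ck_in_g Ck_in_X)
  then show ?thesis
    by (subst Ck_in_cong[where h = "\<lambda>q. (P q *v X c q) $ i + 1/2 * (X c q \<bullet> (g c q *v X c q)) * X c q $ i"])
      (simp_all add: lie_flux_eq)
qed

text \<open>By the Leibniz rule four contributions arise: the divergence of \<open>T\<close>
  contracted with \<open>X\<close>, the trace of \<open>P ** N\<close>, and, from the second summand
  of \<open>W\<close>, \<open>T(X, X) / 2\<close> and \<open>|X|^2 div(X) / 2\<close>. All but the
  trace make up the equation field contracted with \<open>X\<close>.\<close>

lemma divergence_lie_flux: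
  assumes p: "p \<in> fst c"
  shows "divergence g (lie_flux g X) c p = X c p \<bullet> (g c p *v equation_field p)
    + 1/2 * trace (H p ** (T p ** H p ** transpose (T p)))"
proof -
  let ?f = "\<lambda>q. 1/2 * (X c q \<bullet> (g c q *v X c q))"
  let ?Ni = "\<lambda>i. partial_vec c i (X c) p + \<Gamma> i p *v X c p"
  have f: "Ck_in (Suc 0) c (fst c) ?f"
    by (intro Ck_in_mult Ck_in_const Ck_in_inner Ck_in_mat_vec Ck_in_g Ck_in_X)
  \<comment> \<open>The connection terms in the derivative of \<open>g\<close> complete the partial
    derivatives of \<open>X\<close> to covariant ones.\<close>
  have df: "partial c i ?f p = ?Ni i \<bullet> (g c p *v X c p)" for i
  proof -
    have "partial c i ?f p = 1/2 * partial c i (\<lambda>q. X c q \<bullet> (g c q *v X c q)) p"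
      by (simp only: partial_mult[OF p Ck_in_const Ck_in_inner[OF Ck_in_X Ck_in_mat_vec[OF Ck_in_g Ck_in_X]]] partial_const
          mult_zero_left add_0)
    also have "\<dots> = 1/2 * (partial_vec c i (X c) p \<bullet> (g c p *v X c p) + X c p \<bullet> (g c p *v partial_vec c i (X c) p)
        + X c p \<bullet> (transpose (\<Gamma> i p) *v (g c p *v X c p)) + X c p \<bullet> (g c p *v (\<Gamma> i p *v X c p)))"
      by (simp only: partial_inner[OF p Ck_in_X Ck_in_mat_vec[OF Ck_in_g Ck_in_X]]
          partial_vec_mult[OF p Ck_in_g Ck_in_X] partial_g[OF p] matrix_vector_mult_add_rdistrib
          inner_add_right matrix_vector_mul_assoc) simp
    also have "\<dots> = ?Ni i \<bullet> (g c p *v X c p)"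
      using inner_matrix_vector_right[of "X c p" "g c p"] inner_matrix_vector_right[of "X c p" "transpose (\<Gamma> i p)"]
      by (simp only: g_sym[OF p] transpose_transpose inner_add_left inner_commute[of "g c p *v X c p"]) simp
    finally show ?thesis .
  qed
  have "(partial_vec c i (lie_flux g X c) p + \<Gamma> i p *v lie_flux g X c p)
      = DP i p *v X c p + P p *v ?Ni i + (?Ni i \<bullet> (g c p *v X c p)) *\<^sub>R X c p + ?f p *\<^sub>R ?Ni i" for i
  proof -
    have "partial_vec c i (lie_flux g X c) p = partial_vec c i (\<lambda>q. P q *v X c q + ?f q *\<^sub>R X c q) p"
      by (rule partial_vec_cong[OF p]) (rule lie_flux_eq)
    also have "\<dots> = partial_vec c i (\<lambda>q. P q *v X c q) p + partial_vec c i (\<lambda>q. ?f q *\<^sub>R X c q) p"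
      by (rule partial_vec_add[OF p Ck_in_mat_vec[OF Ck_in_P Ck_in_X] Ck_in_vec_scaleR[OF f Ck_in_X]])
    finally show ?thesis
      unfolding partial_vec_mult[OF p Ck_in_P Ck_in_X] partial_vec_scaleR[OF p f Ck_in_X] df lie_flux_eq[OF p] DP_def
      by (simp add: matrix_vector_mult_add_rdistrib matrix_vector_mult_diff_rdistrib
          matrix_vector_right_distrib matrix_vector_mul_assoc matrix_vector_mult_scaleR scaleR_add_right)
  qed
  then have "divergence g (lie_flux g X) c p = (\<Sum>i\<in>UNIV. (DP i p *v X c p) $ i) + (\<Sum>i\<in>UNIV. (P p *v ?Ni i) $ i)
      + (\<Sum>i\<in>UNIV. (?Ni i \<bullet> (g c p *v X c p)) * X c p $ i) + ?f p * divergence g X c p"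
    by (simp only: divergence_eq sum.distrib[symmetric] sum_distrib_left) simp
  also have "(\<Sum>i\<in>UNIV. (DP i p *v X c p) $ i) = X c p \<bullet> (\<chi> j. \<Sum>a\<in>UNIV. DP a p $ a $ j)"
    unfolding matrix_vector_mult_def inner_vec_def vec_lambda_beta
    by (subst sum.swap) (simp add: sum_distrib_left mult.commute)
  also have "(\<Sum>i\<in>UNIV. (P p *v ?Ni i) $ i) = trace (P p ** N p)"
    by (simp add: trace_def matrix_matrix_mult_def matrix_vector_mult_def N_entry)
  \<comment> \<open>The sum is the form \<open>transpose N ** g\<close> evaluated twice at
    \<open>X\<close>. On the diagonal only its symmetric part counts, which is half of
    \<open>T\<close>.\<close>
  also have "(\<Sum>i\<in>UNIV. (?Ni i \<bullet> (g c p *v X c p)) * X c p $ i) = 1/2 * (X c p \<bullet> (T p *v X c p))"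
  proof -
    have "?Ni i = (\<chi> k. N p $ k $ i)" for i
      by (simp only: vec_eq_iff vec_lambda_beta N_entry) simp
    moreover have "(transpose (N p) *v v) $ i = (\<Sum>k\<in>UNIV. N p $ k $ i * v $ k)" for v i
      by (simp only: matrix_vector_mult_def transpose_def vec_lambda_beta)
    ultimately have "(\<Sum>i\<in>UNIV. (?Ni i \<bullet> (g c p *v X c p)) * X c p $ i) = (\<Sum>i\<in>UNIV. X c p $ i * (transpose (N p) *v (g c p *v X c p)) $ i)"
      by (simp add: inner_vec_def mult.commute del: transpose_matrix_vector)
    also have "\<dots> = X c p \<bullet> ((transpose (N p) ** g c p) *v X c p)"
      by (simp only: inner_vec_def inner_real_def matrix_vector_mul_assoc)
    finally have 1: "(\<Sum>i\<in>UNIV. (?Ni i \<bullet> (g c p *v X c p)) * X c p $ i) = X c p \<bullet> ((transpose (N p) ** g c p) *v X c p)" .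
    have "X c p \<bullet> ((transpose (N p) ** g c p) *v X c p) = X c p \<bullet> ((g c p ** N p) *v X c p)"
      using inner_matrix_vector_right[of "X c p" "transpose (N p) ** g c p" "X c p"]
      by (simp only: matrix_transpose_mul transpose_transpose g_sym[OF p] inner_commute[of "X c p"])
    then show ?thesis
      unfolding 1 T_def by (simp add: matrix_vector_mult_add_rdistrib inner_add_right)
  qed
  finally show ?thesis
    unfolding lower_equation_field[OF p] trace_P_N[OF p, symmetric]
    by (simp add: inner_add_right)
qed

end

section \<open>Coordinate form of \<open>T(X, .)\<close>, and the case \<open>T = 0\<close>\<close>

context field_chart
begin

text \<open>The right-hand side is the Lie derivative along \<open>X\<close> of the 1-form of
  \<open>X\<close>; it equals \<open>T(X, .)\<close> because \<open>X\<close> is invariant under its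
  own flow. The Christoffel symbols cancel by torsion-freeness, so only ordinary derivatives have to
  be followed through a change of chart.\<close>

lemma T_X_entry:
  assumes p: "p \<in> fst c"
  shows "(T p *v X c p) $ i = (\<Sum>k\<in>UNIV. X c p $ k * partial c k (\<lambda>q. lower g X c q $ i) p)
    + (\<Sum>k\<in>UNIV. lower g X c p $ k * partial c i (\<lambda>q. X c q $ k) p)"
proof -
  let ?w = "lower g X c"
  have gN: "(g c p ** N p) $ i $ k = partial c k (\<lambda>q. ?w q $ i) p - (\<Sum>m\<in>UNIV. christoffel g c m k i p * ?w p $ m)" for k
  proof -
    have "transpose (transpose (N p) ** g c p) = g c p ** N p"
      by (simp add: matrix_transpose_mul g_sym[OF p])
    then have "(transpose (N p) ** g c p) $ k $ i = (g c p ** N p) $ i $ k"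
      by (simp add: vec_eq_iff transpose_def)
    then show ?thesis using nabla_covec_lower[OF p, of k i] by (simp add: nabla_covec_def)
  qed
  have "((g c p ** N p) *v X c p) $ i = (\<Sum>k\<in>UNIV. X c p $ k * partial c k (\<lambda>q. ?w q $ i) p)
      - (\<Sum>k\<in>UNIV. \<Sum>m\<in>UNIV. christoffel g c m k i p * ?w p $ m * X c p $ k)"
    by (simp add: matrix_vector_mult_def gN sum_subtractf algebra_simps sum_distrib_left)
  moreover have "((transpose (N p) ** g c p) *v X c p) $ i = (\<Sum>m\<in>UNIV. ?w p $ m * N p $ m $ i)"
    by (simp add: lower_def matrix_vector_mul_assoc[symmetric] vector_matrix_mult_def mult.commute)
  moreover have "\<dots> = (\<Sum>k\<in>UNIV. ?w p $ k * partial c i (\<lambda>q. X c q $ k) p)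
      + (\<Sum>m\<in>UNIV. \<Sum>k\<in>UNIV. christoffel g c m k i p * ?w p $ m * X c p $ k)"
    by (simp add: N_entry partial_vec_def \<Gamma>_def matrix_vector_mult_def sum_distrib_left
        distrib_left sum.distrib christoffel_sym[OF p, of _ i] mult_ac)
  moreover have "(\<Sum>m\<in>UNIV. \<Sum>k\<in>UNIV. christoffel g c m k i p * ?w p $ m * X c p $ k)
      = (\<Sum>k\<in>UNIV. \<Sum>m\<in>UNIV. christoffel g c m k i p * ?w p $ m * X c p $ k)"
    by (rule sum.swap)
  ultimately show ?thesis
    by (simp add: T_def matrix_vector_mult_add_rdistrib)
qed

lemma lower_lie_flux:
  assumes p: "p \<in> fst c"
  shows "g c p *v lie_flux g X c p = T p *v X c p + (1/2 * (X c p \<bullet> lower g X c p)) *\<^sub>R lower g X c p"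
  by (simp add: lie_flux_eq[OF p] lower_def P_def matrix_vector_right_distrib matrix_vector_mult_scaleR
      matrix_vector_mul_assoc matrix_mul_assoc g_H[OF p])

text \<open>\<open>T\<close> is assumed to vanish on the whole domain because it gets
  differentiated. The divergence of \<open>X\<close> vanishes too, being half the trace of
  \<open>P\<close>.\<close>

lemma equation_field_zero:
  assumes T0: "\<And>q. q \<in> fst c \<Longrightarrow> T q = 0" and p: "p \<in> fst c"
  shows "equation_field p = 0"
proof -
  have P0: "P q = 0" if "q \<in> fst c" for q by (simp add: P_def T0[OF that])
  have "partial_mat c a P p = partial_mat c a (\<lambda>q. 0) p" for a
    by (rule partial_mat_cong[OF p P0])
  then have DP: "DP a p = 0" for a
    by (simp add: DP_def P0[OF p] partial_mat_def partial_const vec_eq_iff)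
  have "trace (H p ** transpose (N p) ** g c p) = trace (transpose (N p))"
    by (subst trace_mul_sym) (simp add: matrix_mul_assoc g_H[OF p])
  also have "\<dots> = trace (N p)" by (simp add: trace_def transpose_def)
  finally have "trace (P p) = 2 * trace (N p)" by (simp add: P_eq[OF p] trace_add)
  then have "divergence g X c p = 0"
    by (simp add: divergence_eq_trace N_def P0[OF p] trace_def)
  then have "g c p *v equation_field p = 0"
    unfolding lower_equation_field[OF p] by (simp add: DP T0[OF p] vec_eq_iff)
  then have "H p *v (g c p *v equation_field p) = 0" by simp
  then show ?thesis unfolding matrix_vector_mul_assoc by (simp add: H_g[OF p])
qed

end

section \<open>Changes of charts\<close>

locale chart_overlap =
  fixes M :: "'a topology" and A :: "('a, 'n::finite) chart set" and c d :: "('a, 'n) chart"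
  assumes atlas: "smooth_atlas M A" and cA: "c \<in> A" and dA: "d \<in> A"
begin

abbreviation V where "V \<equiv> fst c \<inter> fst d"

lemma charts: "is_chart M c" "is_chart M d"
  using atlas cA dA by (auto simp: smooth_atlas_def)

sublocale c: chart_region M c V
  by unfold_locales (use charts in \<open>auto simp: is_chart_def\<close>)

sublocale d: chart_region M d V
  by unfold_locales (use charts in \<open>auto simp: is_chart_def\<close>)

abbreviation J :: "'a \<Rightarrow> real^'n^'n" where "J \<equiv> transition_jacobian c d"

lemma smooth_transition: "Ck_on k (transition c d) (snd c ` V)"
  using atlas cA dA by (auto simp: smooth_atlas_def smooth_on_def)

lemma transition_image: "y \<in> snd c ` V \<Longrightarrow> transition c d y \<in> snd d ` V"
  using c.image_inv by (auto simp: transition_def)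

lemma transition_chart: "q \<in> V \<Longrightarrow> transition c d (snd c q) = snd d q"
  by (simp add: transition_def c.inv_chart)

lemma chart_inv_transition: "y \<in> snd c ` V \<Longrightarrow> chart_inv d (transition c d y) = chart_inv c y"
  using c.image_inv[of y] by (auto simp: transition_def d.inv_chart)

lemma transition_derivative:
  assumes "q \<in> V"
  shows "(transition c d has_derivative (\<lambda>v. J q *v v)) (at (snd c q))"
proof -
  have "transition c d differentiable (at (snd c q))"
    using smooth_transition[of "Suc 0"] assms by auto
  then show ?thesis
    by (simp add: transition_jacobian_def jacobian_works)
qed

text \<open>Seen as derivatives of the coordinate functions of \<open>d\<close>, the entries of the
  Jacobian inherit regularity and the symmetry of second derivatives from the calculus of scalar
  functions.\<close>

lemma J_entry: "q \<in> V \<Longrightarrow> J q $ a $ b = partial c b (\<lambda>q. snd d q $ a) q"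
proof -
  assume q: "q \<in> V"
  have "((\<lambda>y. transition c d y $ a) has_derivative (\<lambda>v. (J q *v v) $ a)) (at (snd c q))"
    by (rule bounded_linear.has_derivative[OF bounded_linear_vec_nth transition_derivative[OF q]])
  then have "((\<lambda>y. snd d (chart_inv c y) $ a) has_derivative (\<lambda>v. (J q *v v) $ a)) (at (snd c q))"
    by (simp add: transition_def)
  from c.partialI[OF this, of b] show ?thesis
    by (simp add: matrix_vector_mult_basis column_def)
qed

lemma Ck_in_transition: "Ck_in k c V (\<lambda>q. snd d q $ a)"
  using bounded_linear.Ck_on_compose[OF bounded_linear_vec_nth c.open_image smooth_transition[of k]]
  by (simp add: Ck_in_def transition_def o_def)

lemma Ck_in_J: "Ck_in k c V (\<lambda>q. J q $ a $ b)"
  by (subst c.Ck_in_cong[OF J_entry]) (use c.Ck_in_partial[OF Ck_in_transition] in auto)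

lemma partial_J_commute: "q \<in> V \<Longrightarrow> partial c k (\<lambda>q. J q $ a $ i) q = partial c i (\<lambda>q. J q $ a $ k) q"
  using c.partial_commute[OF Ck_in_transition, of q k i a] c.partial_cong_region[OF _ J_entry, of q]
  by simp

lemma Ck_in_change:
  assumes "Ck_in k d V f"
  shows "Ck_in k c V f"
proof -
  have "Ck_on k (\<lambda>y. (f \<circ> chart_inv d) (transition c d y)) (snd c ` V)"
    using assms unfolding Ck_in_def
    by (intro Ck_on_compose[OF c.open_image d.open_image smooth_transition transition_image])
  then show ?thesis unfolding Ck_in_def
    by (rule iffD1[OF Ck_on_cong[OF c.open_image], rotated]) (simp add: chart_inv_transition)
qed

lemma partial_change:
  assumes "Ck_in (Suc 0) d V f" and q: "q \<in> V"
  shows "partial c b f q = (\<Sum>a\<in>UNIV. J q $ a $ b * partial d a f q)"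
proof -
  have "((f \<circ> chart_inv d) has_derivative (\<lambda>v. \<Sum>a\<in>UNIV. v $ a * partial d a f q)) (at (transition c d (snd c q)))"
    using d.has_derivative_chart[OF assms] by (simp add: transition_chart[OF q])
  from has_derivative_compose[OF transition_derivative[OF q] this]
  have "((\<lambda>y. (f \<circ> chart_inv d) (transition c d y)) has_derivative
      (\<lambda>v. \<Sum>a\<in>UNIV. (J q *v v) $ a * partial d a f q)) (at (snd c q))" .
  then have "((\<lambda>y. f (chart_inv c y)) has_derivative
      (\<lambda>v. \<Sum>a\<in>UNIV. (J q *v v) $ a * partial d a f q)) (at (snd c q))"
    by (subst (asm) has_derivative_cong_open[OF c.open_image]) (use q in \<open>auto simp: chart_inv_transition\<close>)
  from c.partialI[OF this] show ?thesis
    by (simp add: matrix_vector_mult_basis column_def)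
qed

end

locale metric_overlap = chart_overlap M A c d
  for M :: "'a topology" and A :: "('a, 'n::finite) chart set" and c d +
  fixes g :: "('a, 'n) bil_field"
  assumes metric: "riemannian_metric A g"
begin

sublocale mc: metric_chart M A g c by unfold_locales (rule atlas metric cA)+
sublocale md: metric_chart M A g d by unfold_locales (rule atlas metric dA)+

lemma g_change: "q \<in> V \<Longrightarrow> g c q = transpose (J q) ** g d q ** J q"
  using metric cA dA unfolding riemannian_metric_def by blast

lemma det_g_change: "q \<in> V \<Longrightarrow> det (g c q) = (det (J q))\<^sup>2 * det (g d q)"
  by (simp add: g_change det_mul det_transpose power2_eq_square)

lemma det_J_nonzero: "q \<in> V \<Longrightarrow> det (J q) \<noteq> 0"
  using mc.det_g_nonzero[of q] det_g_change[of q] by auto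

end

locale field_overlap = metric_overlap M A c d g
  for M :: "'a topology" and A :: "('a, 'n::finite) chart set" and c d g +
  fixes X :: "('a, 'n) vec_field"
  assumes field: "smooth_vector_field A X"
begin

sublocale fc: field_chart M A g c X
  by unfold_locales (use field cA in \<open>auto simp: smooth_vector_field_def\<close>)
sublocale fd: field_chart M A g d X
  by unfold_locales (use field dA in \<open>auto simp: smooth_vector_field_def\<close>)

lemma X_change: "q \<in> V \<Longrightarrow> X d q = J q *v X c q"
  using field cA dA unfolding smooth_vector_field_def by blast

lemma lower_change: "q \<in> V \<Longrightarrow> lower g X c q = transpose (J q) *v lower g X d q"
  unfolding lower_def by (simp only: g_change X_change matrix_vector_mul_assoc matrix_mul_assoc)

text \<open>In \<open>T_X_entry\<close> the derivatives of the Jacobian occur twice, through the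
  derivatives of \<open>X\<close> and through those of its 1-form \<open>w\<close>. By
  \<open>partial_J_commute\<close> the two contributions are equal, and they enter with opposite
  signs.\<close>

lemma T_X_change:
  assumes q: "q \<in> V"
  shows "fc.T q *v X c q = transpose (J q) *v (fd.T q *v X d q)"
proof -
  define w where "w = lower g X d"
  have tw: "(transpose (J q) *v v) $ i = (\<Sum>a\<in>UNIV. J q $ a $ i * v $ a)" for q v i
    by (simp only: matrix_vector_mult_def transpose_def vec_lambda_beta)
  have wc: "lower g X c q $ i = (\<Sum>a\<in>UNIV. J q $ a $ i * w q $ a)" if "q \<in> V" for q i
    by (simp only: lower_change[OF that] tw w_def)
  have CX: "Ck_in k d V (\<lambda>q. X d q $ a)" for k a
    by (rule Ck_in_subset[OF fd.Ck_in_X]) simp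
  have CXc: "Ck_in k c V (\<lambda>q. X c q $ a)" for k a
    by (rule Ck_in_subset[OF fc.Ck_in_X]) simp
  have Cw: "Ck_in k d V (\<lambda>q. w q $ a)" for k a
    unfolding w_def lower_def
    by (rule Ck_in_subset[OF md.Ck_in_mat_vec[OF md.Ck_in_g fd.Ck_in_X]]) simp
  have dX: "partial c i (\<lambda>q. X d q $ a) q = (\<Sum>k\<in>UNIV. partial c i (\<lambda>q. J q $ a $ k) q * X c q $ k)
      + (\<Sum>k\<in>UNIV. J q $ a $ k * partial c i (\<lambda>q. X c q $ k) q)" for i a
  proof -
    have "partial c i (\<lambda>q. X d q $ a) q = partial c i (\<lambda>q. \<Sum>k\<in>UNIV. J q $ a $ k * X c q $ k) q"
      by (rule c.partial_cong_region[OF q]) (simp add: X_change matrix_vector_mult_def)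
    then show ?thesis
      by (simp add: c.partial_sum[OF q] c.partial_mult[OF q] c.Ck_in_mult Ck_in_J CXc sum.distrib)
  qed
  have dw: "partial c k (\<lambda>q. lower g X c q $ i) q = (\<Sum>a\<in>UNIV. partial c i (\<lambda>q. J q $ a $ k) q * w q $ a)
      + (\<Sum>a\<in>UNIV. J q $ a $ i * partial c k (\<lambda>q. w q $ a) q)" for i k
  proof -
    have "partial c k (\<lambda>q. lower g X c q $ i) q = partial c k (\<lambda>q. \<Sum>a\<in>UNIV. J q $ a $ i * w q $ a) q"
      by (rule c.partial_cong_region[OF q wc])
    then show ?thesis
      by (simp add: c.partial_sum[OF q] c.partial_mult[OF q] c.Ck_in_mult Ck_in_J Ck_in_change[OF Cw]
          sum.distrib partial_J_commute[OF q, of k])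
  qed
  have "(fc.T q *v X c q) $ i = (transpose (J q) *v (fd.T q *v X d q)) $ i" for i
  proof -
    have "(\<Sum>k\<in>UNIV. lower g X c q $ k * partial c i (\<lambda>q. X c q $ k) q)
        = (\<Sum>a\<in>UNIV. w q $ a * (\<Sum>k\<in>UNIV. J q $ a $ k * partial c i (\<lambda>q. X c q $ k) q))"
      unfolding wc[OF q] sum_distrib_left sum_distrib_right
      by (subst sum.swap) (simp add: mult_ac)
    also have "\<dots> = (\<Sum>a\<in>UNIV. w q $ a * partial c i (\<lambda>q. X d q $ a) q)
        - (\<Sum>a\<in>UNIV. w q $ a * (\<Sum>k\<in>UNIV. partial c i (\<lambda>q. J q $ a $ k) q * X c q $ k))"
      unfolding dX by (simp add: distrib_left sum.distrib)
    finally have 1: "(\<Sum>k\<in>UNIV. lower g X c q $ k * partial c i (\<lambda>q. X c q $ k) q) = \<dots>" .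
    have 2: "(\<Sum>k\<in>UNIV. X c q $ k * partial c k (\<lambda>q. lower g X c q $ i) q)
        = (\<Sum>a\<in>UNIV. w q $ a * (\<Sum>k\<in>UNIV. partial c i (\<lambda>q. J q $ a $ k) q * X c q $ k))
        + (\<Sum>a\<in>UNIV. J q $ a $ i * (\<Sum>k\<in>UNIV. X c q $ k * partial c k (\<lambda>q. w q $ a) q))"
    proof -
      have "(\<Sum>k\<in>UNIV. X c q $ k * (\<Sum>a\<in>UNIV. partial c i (\<lambda>q. J q $ a $ k) q * w q $ a))
          = (\<Sum>a\<in>UNIV. w q $ a * (\<Sum>k\<in>UNIV. partial c i (\<lambda>q. J q $ a $ k) q * X c q $ k))"
        unfolding sum_distrib_left by (subst sum.swap) (simp add: mult_ac)
      moreover have "(\<Sum>k\<in>UNIV. X c q $ k * (\<Sum>a\<in>UNIV. J q $ a $ i * partial c k (\<lambda>q. w q $ a) q))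
          = (\<Sum>a\<in>UNIV. J q $ a $ i * (\<Sum>k\<in>UNIV. X c q $ k * partial c k (\<lambda>q. w q $ a) q))"
        unfolding sum_distrib_left by (subst sum.swap) (simp add: mult_ac)
      ultimately show ?thesis unfolding dw by (simp add: distrib_left sum.distrib)
    qed
    have 3: "(\<Sum>k\<in>UNIV. X c q $ k * partial c k (\<lambda>q. w q $ a) q) = (\<Sum>b\<in>UNIV. X d q $ b * partial d b (\<lambda>q. w q $ a) q)" for a
    proof -
      have "(\<Sum>k\<in>UNIV. X c q $ k * partial c k (\<lambda>q. w q $ a) q)
          = (\<Sum>k\<in>UNIV. \<Sum>b\<in>UNIV. J q $ b $ k * X c q $ k * partial d b (\<lambda>q. w q $ a) q)"
        by (simp add: partial_change[OF Cw q] sum_distrib_left mult_ac)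
      also have "\<dots> = (\<Sum>b\<in>UNIV. X d q $ b * partial d b (\<lambda>q. w q $ a) q)"
        by (subst sum.swap) (simp add: X_change[OF q] matrix_vector_mult_def sum_distrib_right)
      finally show ?thesis .
    qed
    have 4: "(\<Sum>a\<in>UNIV. w q $ a * partial c i (\<lambda>q. X d q $ a) q)
        = (\<Sum>b\<in>UNIV. J q $ b $ i * (\<Sum>a\<in>UNIV. w q $ a * partial d b (\<lambda>q. X d q $ a) q))"
      unfolding partial_change[OF CX q] sum_distrib_left by (subst sum.swap) (simp add: mult_ac)
    show ?thesis
      using fc.T_X_entry[of q i] fd.T_X_entry[of q] q
      by (simp only: tw 1 2 3 4 IntE w_def[symmetric]) (simp add: w_def distrib_left sum.distrib 4)
  qed
  then show ?thesis by (simp add: vec_eq_iff)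
qed

text \<open>The law is checked for the lowered fields, on which the Jacobian acts by its transpose;
  invertibility of \<open>transpose (J q)\<close> and \<open>g d q\<close> then removes both
  factors.\<close>

lemma lie_flux_change:
  assumes q: "q \<in> V"
  shows "lie_flux g X d q = J q *v lie_flux g X c q"
proof -
  let ?W = "lie_flux g X"
  have inner: "X c q \<bullet> lower g X c q = X d q \<bullet> lower g X d q"
    using inner_matrix_vector_right[of "X c q" "transpose (J q)"]
    by (simp only: lower_change[OF q] X_change[OF q] transpose_transpose)
  have "g c q *v ?W c q = transpose (J q) *v (g d q *v ?W d q)"
    unfolding fc.lower_lie_flux[OF IntD1[OF q]] fd.lower_lie_flux[OF IntD2[OF q]] inner
    by (simp only: T_X_change[OF q] lower_change[OF q] matrix_vector_right_distrib
        matrix_vector_mult_scaleR)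
  then have "transpose (J q) *v (g d q *v (J q *v ?W c q)) = transpose (J q) *v (g d q *v ?W d q)"
    by (simp only: g_change[OF q] matrix_vector_mul_assoc matrix_mul_assoc)
  moreover have "inj ((*v) (transpose (J q)))" "inj ((*v) (g d q))"
    using q det_J_nonzero[OF q] md.det_g_nonzero[of q]
    by (auto intro!: inj_matrix_vector_mult simp: invertible_det_nz det_transpose
        simp del: transpose_matrix_vector)
  ultimately show ?thesis by (simp only: inj_eq)
qed

end

lemma smooth_lie_flux:
  assumes "smooth_atlas M A" "riemannian_metric A g" "smooth_vector_field A X"
  shows "smooth_vector_field A (lie_flux g X)"
  unfolding smooth_vector_field_def
proof (intro conjI ballI)
  fix c assume c: "c \<in> A"
  interpret field_chart M A g c X
    by unfold_locales (use assms c in \<open>auto simp: smooth_vector_field_def\<close>)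
  show "smooth_in_chart c (lie_flux g X c)"
    using smooth_in_chart_Ck_in_vec[OF chart_c] Ck_in_lie_flux by blast
next
  fix c d p assume cd: "c \<in> A" "d \<in> A" "p \<in> fst c \<inter> fst d"
  interpret field_overlap M A c d g X
    by unfold_locales (use assms cd in auto)
  show "lie_flux g X d p = transition_jacobian c d p *v lie_flux g X c p"
    by (rule lie_flux_change[OF cd(3)])
qed

section \<open>Integration in Euclidean space\<close>

text \<open>Difference quotients of \<open>h\<close> have integral zero by translation invariance.
  The mean value theorem bounds them by the maximum of the derivative, so dominated convergence
  passes to the limit.\<close>

lemma integral_derivative_compact_support:
  fixes h :: "'e::euclidean_space \<Rightarrow> real"
  assumes h: "Ck_on (Suc 0) h UNIV" and K: "compact K" and supp: "\<And>x. x \<notin> K \<Longrightarrow> h x = 0"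
  shows "integrable lborel (\<lambda>x. frechet_derivative h (at x) u)"
    and "(\<integral>x. frechet_derivative h (at x) u \<partial>lborel) = 0"
proof -
  let ?D = "\<lambda>x. frechet_derivative h (at x) u"
  have contD: "continuous_on UNIV ?D" using h by simp
  have der: "(h has_derivative frechet_derivative h (at x)) (at x)" for x
    using Ck_on_Suc_derivative[OF h] by blast
  have conth: "continuous_on UNIV h" using Ck_on_imp_continuous_on[OF h] .
  have D0: "?D x = 0" if "x \<notin> K" for x
  proof -
    have "open (- K)" using K compact_imp_closed by blast
    then have "frechet_derivative h (at x) = frechet_derivative (\<lambda>x. 0) (at x)"
      by (rule frechet_derivative_cong_open) (use that supp in auto)
    then show ?thesis by simp
  qed
  have int_K: "integrable lborel f" if "continuous_on UNIV f" "\<And>x. x \<notin> K \<Longrightarrow> f x = 0" for f :: "'e \<Rightarrow> real"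
  proof -
    have "integrable lborel (\<lambda>x. indicator K x *\<^sub>R f x)"
      by (rule borel_integrable_compact[OF K]) (rule continuous_on_subset[OF that(1)], simp)
    moreover have "(\<lambda>x. indicator K x *\<^sub>R f x) = f"
      using that(2) by (auto simp: fun_eq_iff indicator_def)
    ultimately show ?thesis by simp
  qed
  show "integrable lborel ?D" by (rule int_K[OF contD D0])
  obtain B where B: "\<And>x. x \<in> K \<Longrightarrow> \<bar>?D x\<bar> \<le> B" "B \<ge> 0"
  proof -
    have "compact (?D ` K)" using compact_continuous_image[OF continuous_on_subset[OF contD] K] by simp
    then obtain B where "\<And>y. y \<in> ?D ` K \<Longrightarrow> norm y \<le> B"
      using compact_imp_bounded bounded_iff by metis
    then show ?thesis by (intro that[of "max B 0"]) (auto simp: le_max_iff_disj)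
  qed
  have B': "\<bar>?D x\<bar> \<le> B" for x using B D0[of x] by (cases "x \<in> K") auto
  obtain R where R: "K \<subseteq> cball 0 R"
    using compact_imp_bounded[OF K] by (auto simp: bounded_iff subset_iff)
  define s where "s n x = real (Suc n) * (h (x + (1 / real (Suc n)) *\<^sub>R u) - h x)" for n x
  have line: "((\<lambda>t. h (x + t *\<^sub>R u)) has_real_derivative ?D (x + t *\<^sub>R u)) (at t)" for x t
  proof -
    have "((\<lambda>t. x + t *\<^sub>R u) has_derivative (\<lambda>r. r *\<^sub>R u)) (at t)"
      by (auto intro!: derivative_eq_intros)
    from has_derivative_compose[OF this der]
    have "((\<lambda>t. h (x + t *\<^sub>R u)) has_derivative (\<lambda>r. frechet_derivative h (at (x + t *\<^sub>R u)) (r *\<^sub>R u))) (at t)" .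
    also have "(\<lambda>r. frechet_derivative h (at (x + t *\<^sub>R u)) (r *\<^sub>R u)) = (*) (?D (x + t *\<^sub>R u))"
      by (rule ext) (simp only: linear_scale[OF has_derivative_linear[OF der]] real_scaleR_def mult.commute)
    finally show ?thesis by (simp only: has_field_derivative_def)
  qed
  have lim: "(\<lambda>n. s n x) \<longlonglongrightarrow> ?D x" for x
  proof -
    have "((\<lambda>t. h (x + t *\<^sub>R u)) has_real_derivative ?D x) (at 0)" using line[of x 0] by simp
    then have "((\<lambda>t. (h (x + t *\<^sub>R u) - h x) / t) \<longlongrightarrow> ?D x) (at 0)"
      by (simp add: has_field_derivative_iff)
    moreover have "filterlim (\<lambda>n. 1 / real (Suc n)) (at 0) sequentially"
      using LIMSEQ_inverse_real_of_nat by (auto simp: filterlim_at inverse_eq_divide)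
    ultimately have "(\<lambda>n. (h (x + (1 / real (Suc n)) *\<^sub>R u) - h x) / (1 / real (Suc n))) \<longlonglongrightarrow> ?D x"
      by (rule filterlim_compose)
    then show ?thesis by (simp add: s_def mult.commute)
  qed
  have bound: "\<bar>s n x\<bar> \<le> B" for n x
  proof -
    obtain t where "h (x + (1 / real (Suc n)) *\<^sub>R u) - h (x + 0 *\<^sub>R u) = (1 / real (Suc n) - 0) * ?D (x + t *\<^sub>R u)"
      using MVT2[of 0 "1 / real (Suc n)" "\<lambda>t. h (x + t *\<^sub>R u)" "\<lambda>t. ?D (x + t *\<^sub>R u)"] line by auto
    then have "s n x = ?D (x + t *\<^sub>R u)" by (simp add: s_def)
    then show ?thesis using B' by simp
  qed
  \<comment> \<open>A step is never longer than \<open>norm u\<close>, so all difference quotients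
    vanish outside one ball.\<close>
  have s0: "s n x = 0" if "x \<notin> cball 0 (R + norm u)" for n x
  proof -
    have "norm ((1 / real (Suc n)) *\<^sub>R u) \<le> norm u"
      by (simp add: divide_le_eq mult_le_cancel_left1)
    then have "norm x \<le> norm (x + (1 / real (Suc n)) *\<^sub>R u) + norm u"
      using norm_triangle_ineq4[of "x + (1 / real (Suc n)) *\<^sub>R u" "(1 / real (Suc n)) *\<^sub>R u"] by simp
    moreover have "norm z \<le> R" if "z \<in> K" for z using R that by auto
    moreover have "norm x > R + norm u" using that by simp
    ultimately have "x + (1 / real (Suc n)) *\<^sub>R u \<notin> K" "x \<notin> K"
      using norm_ge_zero[of u] by fastforce+
    then show ?thesis by (simp add: s_def supp)
  qed
  have inth: "integrable lborel h" by (rule int_K[OF conth supp])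
  have trans: "integrable lborel (\<lambda>x. h (x + a))" "(\<integral>x. h (x + a) \<partial>lborel) = (\<integral>x. h x \<partial>lborel)" for a
  proof -
    have hm: "h \<in> borel_measurable borel" using conth by (rule borel_measurable_continuous_onI)
    show "(\<integral>x. h (x + a) \<partial>lborel) = (\<integral>x. h x \<partial>lborel)"
      using integral_distr[of "(+) a" lborel borel h] hm by (simp add: lborel_distr_plus add.commute)
    show "integrable lborel (\<lambda>x. h (x + a))"
      using integrable_distr_eq[of "(+) a" lborel borel h] hm inth by (simp add: lborel_distr_plus add.commute)
  qed
  have int_s: "(\<integral>x. s n x \<partial>lborel) = 0" for n
    unfolding s_def using trans[of "(1 / real (Suc n)) *\<^sub>R u"] inth
    by simp
  have "(\<lambda>n. \<integral>x. s n x \<partial>lborel) \<longlonglongrightarrow> (\<integral>x. ?D x \<partial>lborel)"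
  proof (rule integral_dominated_convergence[where w = "\<lambda>x. indicator (cball 0 (R + norm u)) x *\<^sub>R B"])
    show "?D \<in> borel_measurable lborel" using contD by (simp add: borel_measurable_continuous_onI)
    show "s n \<in> borel_measurable lborel" for n
      unfolding s_def[abs_def] using conth
      by (auto intro!: borel_measurable_continuous_onI continuous_intros continuous_on_compose2[OF conth])
    show "integrable lborel (\<lambda>x. indicator (cball 0 (R + norm u)) x *\<^sub>R B)"
      by (rule borel_integrable_compact) auto
    show "AE x in lborel. (\<lambda>n. s n x) \<longlonglongrightarrow> ?D x" using lim by simp
    show "AE x in lborel. norm (s n x) \<le> indicator (cball 0 (R + norm u)) x *\<^sub>R B" for n
      using bound s0 B by (intro AE_I2) (auto simp: indicator_def)
  qed
  then show "(\<integral>x. ?D x \<partial>lborel) = 0"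
    by (simp add: int_s LIMSEQ_const_iff)
qed

text \<open>The change of variables theorem of the library needs a well-ordered index type. It is
  transferred to any finite index type along a copy carrying such an order.\<close>

typedef 'i ordered_copy = "UNIV :: 'i set" by simp

instance ordered_copy :: (finite) finite
proof
  have "(UNIV :: 'a ordered_copy set) = Abs_ordered_copy ` UNIV"
    by (metis Abs_ordered_copy_cases surj_def)
  then show "finite (UNIV :: 'a ordered_copy set)" by (metis finite finite_imageI)
qed

definition copy_index :: "'i::finite ordered_copy \<Rightarrow> nat" where
  "copy_index = (SOME f. inj f)"

lemma inj_copy_index: "inj (copy_index :: 'i::finite ordered_copy \<Rightarrow> nat)"
proof -
  have "\<exists>f :: 'i ordered_copy \<Rightarrow> nat. inj f"
    using finite_imp_inj_to_nat_seg[of "UNIV :: 'i ordered_copy set"] by auto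
  then show ?thesis unfolding copy_index_def by (rule someI_ex)
qed

instantiation ordered_copy :: (finite) wellorder
begin

definition less_eq_ordered_copy :: "'a ordered_copy \<Rightarrow> 'a ordered_copy \<Rightarrow> bool" where
  "x \<le> y \<longleftrightarrow> copy_index x \<le> copy_index y"

definition less_ordered_copy :: "'a ordered_copy \<Rightarrow> 'a ordered_copy \<Rightarrow> bool" where
  "x < y \<longleftrightarrow> copy_index x < copy_index y"

instance
proof
  fix P :: "'a ordered_copy \<Rightarrow> bool" and a
  assume step: "\<And>x. (\<And>y. y < x \<Longrightarrow> P y) \<Longrightarrow> P x"
  show "P a"
    by (induction "copy_index a" arbitrary: a rule: less_induct)
      (use step in \<open>auto simp: less_ordered_copy_def\<close>)
qed (auto simp: less_eq_ordered_copy_def less_ordered_copy_def inj_eq[OF inj_copy_index])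

end

text \<open>\<open>has_absolute_integral_change_of_variables\<close> yields a gauge integral.
  Through \<open>meas\<close> the pulled-back integrand is integrable for \<open>lborel\<close>
  itself and not just for its completion, so the result is an equality of Lebesgue
  integrals.\<close>

lemma change_of_variables_ordered:
  fixes \<tau> :: "real^'m::{finite,wellorder} \<Rightarrow> real^'m::_" and f :: "real^'m::_ \<Rightarrow> real"
  assumes U: "open U" and der: "\<And>x. x \<in> U \<Longrightarrow> (\<tau> has_derivative (\<lambda>v. J x *v v)) (at x)"
    and inj: "inj_on \<tau> U" and f: "integrable lborel f" and f0: "\<And>y. y \<notin> \<tau> ` U \<Longrightarrow> f y = 0"
    and meas: "(\<lambda>x. if x \<in> U then \<bar>det (J x)\<bar> * f (\<tau> x) else 0) \<in> borel_measurable borel"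
  shows "(\<integral>x. (if x \<in> U then \<bar>det (J x)\<bar> * f (\<tau> x) else 0) \<partial>lborel) = (\<integral>y. f y \<partial>lborel)"
proof -
  \<comment> \<open>The integrands of that theorem are vector-valued; the reals enter as
    \<open>real^1\<close>.\<close>
  let ?F = "\<lambda>y. vec (f y) :: real^1"
  let ?h = "\<lambda>x. if x \<in> U then \<bar>det (J x)\<bar> * f (\<tau> x) else 0"
  have abs_f: "f absolutely_integrable_on UNIV"
    using f by (simp add: set_integrable_def integrable_completion)
  have fif: "(\<lambda>y. if y \<in> \<tau> ` U then f y else 0) = f" using f0 by auto
  have "f absolutely_integrable_on (\<tau> ` U)"
    using abs_f absolutely_integrable_restrict_UNIV[of "\<tau> ` U" f] fif by simp
  moreover have "integral (\<tau> ` U) f = (\<integral>y. f y \<partial>lborel)"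
    using integral_restrict_UNIV[of "\<tau> ` U" f] fif integral_lborel[OF f] by simp
  ultimately have "(\<lambda>x. \<bar>det (matrix (\<lambda>v. J x *v v))\<bar> *\<^sub>R ?F (\<tau> x)) absolutely_integrable_on U \<and>
     integral U (\<lambda>x. \<bar>det (matrix (\<lambda>v. J x *v v))\<bar> *\<^sub>R ?F (\<tau> x)) = vec (\<integral>y. f y \<partial>lborel)"
    using has_absolute_integral_change_of_variables[of U \<tau> "\<lambda>x v. J x *v v" ?F "vec (\<integral>y. f y \<partial>lborel)"]
      U der inj
    by (auto simp: has_derivative_at_withinI absolutely_integrable_on_1_iff integral_on_1_eq vec_eq_iff
        absolutely_integrable_on_def)
  then have *: "(\<lambda>x. \<bar>det (J x)\<bar> * f (\<tau> x)) absolutely_integrable_on U"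
     "integral U (\<lambda>x. \<bar>det (J x)\<bar> * f (\<tau> x)) = (\<integral>y. f y \<partial>lborel)"
    by (auto simp: absolutely_integrable_on_1_iff integral_on_1_eq vec_eq_iff)
  have "?h absolutely_integrable_on UNIV"
    using *(1) absolutely_integrable_restrict_UNIV[of U "\<lambda>x. \<bar>det (J x)\<bar> * f (\<tau> x)"] by simp
  then have "integrable lborel ?h"
    using meas by (simp add: set_integrable_def integrable_completion)
  from integral_lborel[OF this] show ?thesis
    using *(2) integral_restrict_UNIV[of U "\<lambda>x. \<bar>det (J x)\<bar> * f (\<tau> x)"] by simp
qed

definition copy_vec :: "real^'i::finite \<Rightarrow> real^'i ordered_copy" where
  "copy_vec x = (\<chi> i. x $ Rep_ordered_copy i)"

definition uncopy_vec :: "real^'i ordered_copy \<Rightarrow> real^'i::finite" where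
  "uncopy_vec x = (\<chi> i. x $ Abs_ordered_copy i)"

lemma uncopy_copy [simp]: "uncopy_vec (copy_vec x) = x" "copy_vec (uncopy_vec y) = y"
  by (simp_all add: vec_eq_iff copy_vec_def uncopy_vec_def Abs_ordered_copy_inverse Rep_ordered_copy_inverse)

lemma bounded_linear_copy: "bounded_linear copy_vec" "bounded_linear uncopy_vec"
  by (auto intro!: linear_conv_bounded_linear[THEN iffD1] linearI simp: copy_vec_def uncopy_vec_def vec_eq_iff)

lemma measurable_copy [measurable]: "copy_vec \<in> borel_measurable borel" "uncopy_vec \<in> borel_measurable borel"
  by (auto intro!: borel_measurable_continuous_onI linear_continuous_on bounded_linear_copy)

lemma bij_Abs_ordered_copy: "bij Abs_ordered_copy"
  by (rule bij_betw_byWitness[of _ Rep_ordered_copy]) (auto simp: Abs_ordered_copy_inverse Rep_ordered_copy_inverse)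

lemma bij_Rep_ordered_copy: "bij Rep_ordered_copy"
  by (rule bij_betw_byWitness[of _ Abs_ordered_copy]) (auto simp: Abs_ordered_copy_inverse Rep_ordered_copy_inverse)

text \<open>Lebesgue measure is determined by its values on boxes, and renaming the coordinates
  permutes the side lengths of a box.\<close>

lemma lborel_copy: "distr lborel borel uncopy_vec = (lborel :: (real^'i::finite) measure)"
proof (rule lborel_eqI[symmetric])
  fix l u :: "real^'i" assume lu: "\<And>b. b \<in> Basis \<Longrightarrow> l \<bullet> b \<le> u \<bullet> b"
  have le: "l $ i \<le> u $ i" for i using lu[of "axis i 1"] by (simp add: inner_axis)
  have prod: "(\<Prod>b\<in>Basis. x \<bullet> b) = (\<Prod>i\<in>UNIV. x $ i)" for x :: "real^'k::finite"
  proof -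
    have B: "(Basis :: (real^'k) set) = (\<lambda>i. axis i 1) ` UNIV" by (auto simp: Basis_vec_def)
    have inj: "inj (\<lambda>i. axis i 1 :: real^'k)" by (auto simp: inj_on_def axis_eq_axis)
    show ?thesis by (simp add: B prod.reindex[OF inj] inner_axis o_def)
  qed
  have "uncopy_vec -` box l u = box (copy_vec l) (copy_vec u)"
  proof -
    have "(\<forall>i. l $ i < y $ Abs_ordered_copy i \<and> y $ Abs_ordered_copy i < u $ i) \<longleftrightarrow>
        (\<forall>j. l $ Rep_ordered_copy j < y $ j \<and> y $ j < u $ Rep_ordered_copy j)" for y :: "real^'i ordered_copy"
      by (metis Abs_ordered_copy_inverse Rep_ordered_copy_inverse UNIV_I)
    then show ?thesis by (auto simp: mem_box_cart uncopy_vec_def copy_vec_def)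
  qed
  then have "emeasure (distr lborel borel uncopy_vec) (box l u) = emeasure lborel (box (copy_vec l) (copy_vec u))"
    by (simp add: emeasure_distr)
  also have "\<dots> = (\<Prod>b\<in>Basis. (copy_vec u - copy_vec l) \<bullet> b)"
  proof (rule emeasure_lborel_box)
    fix b :: "real^'i ordered_copy" assume "b \<in> Basis"
    then show "copy_vec l \<bullet> b \<le> copy_vec u \<bullet> b"
      by (auto simp: Basis_vec_def inner_axis copy_vec_def le)
  qed
  also have "(\<Prod>b\<in>Basis. (copy_vec u - copy_vec l) \<bullet> b) = (\<Prod>b\<in>Basis. (u - l) \<bullet> b)"
    unfolding prod
    by (rule prod.reindex_bij_betw[symmetric, OF bij_Abs_ordered_copy, THEN trans])
       (simp add: copy_vec_def Abs_ordered_copy_inverse)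
  finally show "emeasure (distr lborel borel uncopy_vec) (box l u) = (\<Prod>b\<in>Basis. (u - l) \<bullet> b)" .
qed simp

lemma integral_uncopy:
  fixes f :: "real^'i::finite \<Rightarrow> real"
  assumes "f \<in> borel_measurable borel"
  shows "(\<integral>y. f (uncopy_vec y) \<partial>lborel) = (\<integral>x. f x \<partial>(lborel :: (real^'i) measure))"
    and "integrable lborel (\<lambda>y. f (uncopy_vec y)) \<longleftrightarrow> integrable (lborel :: (real^'i) measure) f"
  using integral_distr[of uncopy_vec lborel borel f] integrable_distr_eq[of uncopy_vec lborel borel f] assms
  by (simp_all add: lborel_copy)

text \<open>In the Leibniz formula, conjugation with \<open>f\<close> carries the permutations of
  one index type to those of the other and preserves signs.\<close>

lemma det_reindex:
  fixes B :: "real^'i::finite^'i" and f :: "'j::finite \<Rightarrow> 'i"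
  assumes f: "bij f"
  shows "det (\<chi> i j. B $ f i $ f j) = det B"
proof -
  have inj: "inj f" "inj (inv f)" and inv: "inv f (f j) = j" "f (inv f i) = i" for i j
    using f by (simp_all add: bij_is_inj bij_is_surj bij_imp_bij_inv surj_f_inv_f)
  have img: "bij_betw f UNIV UNIV" "bij_betw (inv f) UNIV UNIV"
    using f bij_imp_bij_inv by auto
  have bij: "bij_betw (map_permutation UNIV f) {q. q permutes UNIV} {p. p permutes UNIV}"
    by (rule bij_betw_byWitness[of _ "map_permutation UNIV (inv f)"])
      (use map_permutation_permutes[OF img(1)] map_permutation_permutes[OF img(2)]
          map_permutation_compose_inv[OF img(1) _ inv(1)] map_permutation_compose_inv[OF img(2) _ inv(2)]
        in auto)
  have "det B = (\<Sum>q | q permutes UNIV. of_int (sign (map_permutation UNIV f q)) *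
      (\<Prod>i\<in>UNIV. B $ i $ map_permutation UNIV f q i))"
    unfolding det_def by (rule sum.reindex_bij_betw[OF bij, symmetric])
  also have "\<dots> = det (\<chi> i j. B $ f i $ f j)"
    unfolding det_def
  proof (rule sum.cong[OF refl])
    fix q :: "'j \<Rightarrow> 'j" assume "q \<in> {q. q permutes UNIV}"
    then have q: "q permutes UNIV" by simp
    have "(\<Prod>i\<in>UNIV. B $ i $ map_permutation UNIV f q i)
        = (\<Prod>j\<in>UNIV. B $ f j $ map_permutation UNIV f q (f j))"
      by (rule prod.reindex_bij_betw[OF f, symmetric])
    then show "of_int (sign (map_permutation UNIV f q)) * (\<Prod>i\<in>UNIV. B $ i $ map_permutation UNIV f q i)
        = of_int (sign q) * (\<Prod>i\<in>UNIV. (\<chi> i j. B $ f i $ f j) $ i $ q i)"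
      by (simp add: sign_map_permutation[OF inj(1) q] map_permutation_apply[OF inj(1)])
  qed
  finally show ?thesis ..
qed

lemma change_of_variables:
  fixes \<tau> :: "real^'n::finite \<Rightarrow> real^'n" and f :: "real^'n \<Rightarrow> real"
  assumes U: "open U" and der: "\<And>x. x \<in> U \<Longrightarrow> (\<tau> has_derivative (\<lambda>v. J x *v v)) (at x)"
    and inj: "inj_on \<tau> U" and f: "integrable lborel f" and f0: "\<And>y. y \<notin> \<tau> ` U \<Longrightarrow> f y = 0"
    and meas: "(\<lambda>x. if x \<in> U then \<bar>det (J x)\<bar> * f (\<tau> x) else 0) \<in> borel_measurable borel"
  shows "(\<integral>x. (if x \<in> U then \<bar>det (J x)\<bar> * f (\<tau> x) else 0) \<partial>lborel) = (\<integral>y. f y \<partial>lborel)"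
proof -
  let ?h = "\<lambda>x. if x \<in> U then \<bar>det (J x)\<bar> * f (\<tau> x) else 0"
  let ?U = "uncopy_vec -` U" and ?\<tau> = "\<lambda>y. copy_vec (\<tau> (uncopy_vec y))"
  let ?J = "\<lambda>y. \<chi> i j. J (uncopy_vec y) $ Rep_ordered_copy i $ Rep_ordered_copy j"
  have fm: "f \<in> borel_measurable borel" using f by auto
  have "(\<integral>y. (if y \<in> ?U then \<bar>det (?J y)\<bar> * f (uncopy_vec (?\<tau> y)) else 0) \<partial>lborel) = (\<integral>y. f (uncopy_vec y) \<partial>lborel)"
  proof (rule change_of_variables_ordered)
    show "open ?U"
      by (rule open_vimage[OF U]) (rule linear_continuous_on[OF bounded_linear_copy(2)])
    show "(?\<tau> has_derivative (\<lambda>v. ?J y *v v)) (at y)" if "y \<in> ?U" for y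
    proof -
      have 1: "(uncopy_vec has_derivative uncopy_vec) (at y)"
        by (rule bounded_linear_imp_has_derivative[OF bounded_linear_copy(2)])
      have 2: "(\<tau> has_derivative (\<lambda>v. J (uncopy_vec y) *v v)) (at (uncopy_vec y))"
        using der that by simp
      have 3: "(copy_vec has_derivative copy_vec) (at z)" for z :: "real^'n"
        by (rule bounded_linear_imp_has_derivative[OF bounded_linear_copy(1)])
      have "copy_vec (J (uncopy_vec y) *v uncopy_vec v) = ?J y *v v" for v
      proof -
        have "(\<Sum>j\<in>UNIV. J (uncopy_vec y) $ Rep_ordered_copy i $ j * v $ Abs_ordered_copy j)
            = (\<Sum>j\<in>UNIV. J (uncopy_vec y) $ Rep_ordered_copy i $ Rep_ordered_copy j * v $ j)" for i
          by (rule sum.reindex_bij_betw[OF bij_Abs_ordered_copy, symmetric, THEN trans, THEN sym])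
            (simp add: Abs_ordered_copy_inverse)
        then show ?thesis
          by (simp add: vec_eq_iff copy_vec_def uncopy_vec_def matrix_vector_mult_def)
      qed
      then show ?thesis
        using has_derivative_compose[OF has_derivative_compose[OF 1 2] 3] by simp
    qed
    show "inj_on ?\<tau> ?U"
    proof (rule inj_onI)
      fix a b assume ab: "a \<in> ?U" "b \<in> ?U" "?\<tau> a = ?\<tau> b"
      then have "uncopy_vec a = uncopy_vec b"
        using inj_onD[OF inj] by (metis uncopy_copy(1) vimageD)
      then show "a = b" by (metis uncopy_copy(2))
    qed
    show "integrable lborel (\<lambda>y. f (uncopy_vec y))"
      using integral_uncopy(2)[OF fm] f by simp
    show "f (uncopy_vec y) = 0" if "y \<notin> ?\<tau> ` ?U" for y
    proof (rule f0, rule notI)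
      assume "uncopy_vec y \<in> \<tau> ` U"
      then obtain x where "x \<in> U" "uncopy_vec y = \<tau> x" by auto
      then have "y = ?\<tau> (copy_vec x)" by (metis uncopy_copy)
      moreover have "copy_vec x \<in> ?U" by (simp add: \<open>x \<in> U\<close>)
      ultimately show False using that by blast
    qed
    have "(\<lambda>y. ?h (uncopy_vec y)) \<in> borel_measurable borel"
      using measurable_compose[OF measurable_copy(2) meas] .
    then show "(\<lambda>y. if y \<in> ?U then \<bar>det (?J y)\<bar> * f (uncopy_vec (?\<tau> y)) else 0) \<in> borel_measurable borel"
      by (simp add: det_reindex[OF bij_Rep_ordered_copy] cong: if_cong)
  qed
  then show ?thesis
    using integral_uncopy(1)[OF fm] integral_uncopy(1)[OF meas] by (simp add: det_reindex[OF bij_Rep_ordered_copy] cong: if_cong)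
qed

section \<open>Integration over charts\<close>

text \<open>This is \<open>sqrt (det g)\<close>, in a form whose positivity only needs \<open>det g \<noteq> 0\<close>.\<close>

definition volume_density :: "('a, 'n::finite) bil_field \<Rightarrow> ('a, 'n) chart \<Rightarrow> 'a \<Rightarrow> real" where
  "volume_density g c q = sqrt (sqrt ((det (g c q))\<^sup>2))"

text \<open>Zero off the coordinate image, where the value of \<open>chart_inv\<close> is
  arbitrary.\<close>

definition chart_integrand ::
    "('a, 'n::finite) bil_field \<Rightarrow> ('a, 'n) chart \<Rightarrow> ('a \<Rightarrow> real) \<Rightarrow> real^'n \<Rightarrow> real" where
  "chart_integrand g c f x =
     (if x \<in> snd c ` fst c then f (chart_inv c x) * volume_density g c (chart_inv c x) else 0)"

definition chart_integral :: "('a, 'n::finite) bil_field \<Rightarrow> ('a, 'n) chart \<Rightarrow> ('a \<Rightarrow> real) \<Rightarrow> real" where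
  "chart_integral g c f = (\<integral>x. chart_integrand g c f x \<partial>lborel)"

lemma compact_chart_image:
  assumes "is_chart M c" "compactin M K" "K \<subseteq> fst c"
  shows "compact (snd c ` K)"
proof -
  have "continuous_map (subtopology M (fst c)) euclidean (snd c)"
    using assms(1) unfolding is_chart_def
    by (metis homeomorphic_imp_continuous_map continuous_map_in_subtopology)
  moreover have "compactin (subtopology M (fst c)) K"
    using assms by (simp add: compactin_subtopology)
  ultimately have "compactin euclidean (snd c ` K)"
    by (rule image_compactin[rotated])
  then show ?thesis by simp
qed

lemma compactin_chart_preimage:
  assumes "is_chart M c" "compact C" "C \<subseteq> snd c ` fst c"
  shows "compactin M (chart_inv c ` C)"
proof -
  have "homeomorphic_maps (subtopology M (fst c)) (top_of_set (snd c ` fst c)) (snd c) (chart_inv c)"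
  proof -
    obtain h where h: "homeomorphic_maps (subtopology M (fst c)) (top_of_set (snd c ` fst c)) (snd c) h"
      using assms(1) unfolding is_chart_def homeomorphic_map_maps by blast
    have "h y = chart_inv c y" if y: "y \<in> snd c ` fst c" for y
    proof -
      have "fst c \<subseteq> topspace M" using assms(1) openin_subset by (auto simp: is_chart_def)
      moreover obtain q where q: "q \<in> fst c" "y = snd c q" using y by blast
      ultimately have "q \<in> topspace (subtopology M (fst c))" by auto
      then have "h (snd c q) = q" using h unfolding homeomorphic_maps_def by blast
      then show ?thesis using chart_inv_chart[OF assms(1) q(1)] q(2) by simp
    qed
    then show ?thesis by (intro homeomorphic_maps_eq[OF h]) simp_all
  qed
  then have "continuous_map (top_of_set (snd c ` fst c)) (subtopology M (fst c)) (chart_inv c)"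
    by (simp add: homeomorphic_maps_def)
  moreover have "compactin (top_of_set (snd c ` fst c)) C"
    using assms by (simp add: compactin_subtopology)
  ultimately have "compactin (subtopology M (fst c)) (chart_inv c ` C)"
    by (rule image_compactin[rotated])
  then show ?thesis by (simp add: compactin_subtopology)
qed

section \<open>Volume density and integration by parts in one chart\<close>

context metric_chart
begin

lemma density_pos: "q \<in> fst c \<Longrightarrow> volume_density g c q > 0"
  using det_g_nonzero by (simp add: volume_density_def)

lemma det_g_square_pos: "q \<in> fst c \<Longrightarrow> det (g c q) * det (g c q) > 0"
  using det_g_nonzero[of q] not_real_square_gt_zero by blast

lemma Ck_in_density: "Ck_in k c (fst c) (volume_density g c)"
  unfolding volume_density_def[abs_def] power2_eq_square
  by (intro Ck_in_sqrt Ck_in_mult Ck_in_det Ck_in_g real_sqrt_gt_zero det_g_square_pos)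

text \<open>The density is the fourth root of the squared determinant, so its logarithmic derivative
  is \<open>1/4 * 2\<close> times that of \<open>det g\<close>, which by
  \<open>partial_det_g\<close> is twice the trace of \<Gamma>.\<close>

lemma partial_density:
  assumes p: "p \<in> fst c"
  shows "partial c a (volume_density g c) p = trace (\<Gamma> a p) * volume_density g c p"
proof -
  let ?e = "\<lambda>q. det (g c q) * det (g c q)"
  have d: "Ck_in (Suc 0) c (fst c) (\<lambda>q. det (g c q))" by (intro Ck_in_det Ck_in_g)
  note e = det_g_square_pos
  have Ce: "Ck_in (Suc 0) c (fst c) ?e" by (intro Ck_in_mult d)
  have "partial c a (volume_density g c) p = partial c a (\<lambda>q. sqrt (?e q)) p / (2 * sqrt (sqrt (?e p)))"
    unfolding volume_density_def[abs_def] power2_eq_square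
    by (rule partial_sqrt[OF p Ck_in_sqrt[OF Ce e] real_sqrt_gt_zero[OF e]])
  also have "partial c a (\<lambda>q. sqrt (?e q)) p = partial c a ?e p / (2 * sqrt (?e p))"
    by (rule partial_sqrt[OF p Ce e])
  also have "partial c a ?e p = 4 * trace (\<Gamma> a p) * ?e p"
    by (simp add: partial_mult[OF p d d] partial_det_g[OF p])
  also have "4 * trace (\<Gamma> a p) * ?e p / (2 * sqrt (?e p)) / (2 * sqrt (sqrt (?e p)))
      = trace (\<Gamma> a p) * ((?e p / sqrt (?e p)) / sqrt (sqrt (?e p)))"
    by simp
  also have "?e p / sqrt (?e p) = sqrt (?e p)" using e[OF p] by (intro real_div_sqrt) simp
  also have "sqrt (?e p) / sqrt (sqrt (?e p)) = sqrt (sqrt (?e p))" using e[OF p] by (intro real_div_sqrt) simp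
  finally show ?thesis by (simp only: volume_density_def[abs_def] power2_eq_square)
qed

text \<open>Torsion-freeness turns the connection term into traces of \<Gamma>. By
  \<open>partial_density\<close>, div \<open>W\<close> times the density is therefore the ordinary
  coordinate divergence of \<open>W\<close> times the density.\<close>

lemma divergence_density:
  assumes p: "p \<in> fst c"
  shows "divergence g W c p = (\<Sum>i\<in>UNIV. partial c i (\<lambda>q. W c q $ i) p) + (\<Sum>i\<in>UNIV. trace (\<Gamma> i p) * W c p $ i)"
proof -
  have "(\<Sum>i\<in>UNIV. (\<Gamma> i p *v W c p) $ i) = (\<Sum>i\<in>UNIV. \<Sum>j\<in>UNIV. \<Gamma> j p $ i $ i * W c p $ j)"
    by (simp add: matrix_vector_mult_def \<Gamma>_def christoffel_sym[OF p, of i i for i] cong: sum.cong)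
      (intro sum.cong refl arg_cong2[where f="(*)"] christoffel_sym[OF p])
  also have "\<dots> = (\<Sum>i\<in>UNIV. trace (\<Gamma> i p) * W c p $ i)"
    by (subst sum.swap) (simp add: trace_def sum_distrib_right)
  finally show ?thesis by (simp add: divergence_eq sum.distrib partial_vec_def)
qed

lemma integrable_chart_integrand:
  assumes K: "compactin M K" "K \<subseteq> W" and W: "W \<subseteq> fst c"
    and f: "Ck_in 0 c W f" and f0: "\<And>q. q \<notin> K \<Longrightarrow> f q = 0"
  shows "integrable lborel (chart_integrand g c f)"
proof -
  let ?F = "\<lambda>x. f (chart_inv c x) * volume_density g c (chart_inv c x)"
  have "compact (snd c ` K)" using compact_chart_image[OF chart_c] K W by blast
  moreover have "continuous_on (snd c ` K) ?F"
  proof (rule continuous_on_subset)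
    show "continuous_on (snd c ` W) ?F"
      using f Ck_in_subset[OF Ck_in_density[of 0] W] by (simp add: Ck_in_def o_def continuous_on_mult)
    show "snd c ` K \<subseteq> snd c ` W" using K by auto
  qed
  ultimately have "integrable lborel (\<lambda>x. indicator (snd c ` K) x *\<^sub>R ?F x)"
    by (rule borel_integrable_compact)
  also have "(\<lambda>x. indicator (snd c ` K) x *\<^sub>R ?F x) = chart_integrand g c f"
  proof
    fix x
    show "indicator (snd c ` K) x *\<^sub>R ?F x = chart_integrand g c f x"
    proof (cases "x \<in> snd c ` K")
      case True then show ?thesis using K W by (auto simp: chart_integrand_def)
    next
      case False
      then have "f (chart_inv c x) = 0" if "x \<in> snd c ` fst c"
        by (intro f0) (metis chart_chart_inv[OF that] imageI)
      then show ?thesis using False by (simp add: chart_integrand_def)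
    qed
  qed
  finally show ?thesis .
qed

lemma chart_integral_add:
  assumes "integrable lborel (chart_integrand g c f)" "integrable lborel (chart_integrand g c h)"
  shows "chart_integral g c (\<lambda>q. f q + h q) = chart_integral g c f + chart_integral g c h"
proof -
  have "chart_integrand g c (\<lambda>q. f q + h q) = (\<lambda>x. chart_integrand g c f x + chart_integrand g c h x)"
    by (auto simp: chart_integrand_def fun_eq_iff distrib_right)
  then show ?thesis using assms by (simp add: chart_integral_def)
qed

lemma chart_integral_sum:
  assumes "\<And>i. i \<in> I \<Longrightarrow> integrable lborel (chart_integrand g c (f i))"
  shows "chart_integral g c (\<lambda>q. \<Sum>i\<in>I. f i q) = (\<Sum>i\<in>I. chart_integral g c (f i))"
proof -
  have "chart_integrand g c (\<lambda>q. \<Sum>i\<in>I. f i q) = (\<lambda>x. \<Sum>i\<in>I. chart_integrand g c (f i) x)"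
    by (auto simp: chart_integrand_def fun_eq_iff sum_distrib_right)
  then show ?thesis using assms by (simp add: chart_integral_def)
qed

lemma chart_integral_cong:
  assumes "\<And>q. q \<in> fst c \<Longrightarrow> f q = h q"
  shows "chart_integral g c f = chart_integral g c h"
proof -
  have "chart_integrand g c f = chart_integrand g c h"
    using assms inv_chart by (auto simp: chart_integrand_def fun_eq_iff)
  then show ?thesis by (simp add: chart_integral_def)
qed

text \<open>Multiplied by the density, the integrand is the sum of the derivatives of the functions
  \<open>\<rho> W^i\<close> times the density. Extended by zero these are of class C^1 with compact
  support, so each derivative integrates to zero.\<close>

lemma integral_divergence_chart:
  assumes K: "compactin M K" "K \<subseteq> fst c"
    and \<rho>: "Ck_in (Suc 0) c (fst c) \<rho>" "\<And>q. q \<notin> K \<Longrightarrow> \<rho> q = 0"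
    and W: "\<And>i. Ck_in (Suc 0) c (fst c) (\<lambda>q. W c q $ i)"
  shows "chart_integral g c (\<lambda>q. \<rho> q * divergence g W c q + (\<Sum>i\<in>UNIV. partial c i \<rho> q * W c q $ i)) = 0"
proof -
  let ?U = "snd c ` fst c" and ?K = "snd c ` K"
  let ?f = "\<lambda>i q. \<rho> q * W c q $ i * volume_density g c q"
  define h where "h i x = (if x \<in> ?U then ?f i (chart_inv c x) else 0)" for i x
  have cK: "compact ?K" using compact_chart_image[OF chart_c K] .
  have oK: "open (- ?K)" using cK compact_imp_closed by blast
  have fC: "Ck_in (Suc 0) c (fst c) (?f i)" for i
    by (intro Ck_in_mult \<rho> W Ck_in_density)
  have h0: "h i x = 0" if "x \<notin> ?K" for i x
  proof -
    have "\<rho> (chart_inv c x) = 0" if "x \<in> ?U"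
      using \<open>x \<notin> ?K\<close> by (intro \<rho>(2)) (metis chart_chart_inv[OF that] imageI)
    then show ?thesis by (simp add: h_def)
  qed
  \<comment> \<open>Two open sets cover the space: on one the extension is the given function in
    coordinates, on the other it is zero. This gives its regularity across the boundary of the
    coordinate image.\<close>
  have cover: "\<Union>{?U, - ?K} = UNIV" using K by auto
  have Ch: "Ck_on (Suc 0) (h i) UNIV" for i
    unfolding cover[symmetric]
  proof (rule Ck_on_Union)
    fix S assume S: "S \<in> {?U, - ?K}"
    then show "open S" using open_image oK by auto
    have "Ck_on (Suc 0) (h i) ?U"
      using fC[of i] unfolding Ck_in_def
      by (rule iffD1[OF Ck_on_cong[OF open_image], rotated]) (simp add: h_def)
    moreover have "Ck_on (Suc 0) (h i) (- ?K)"
      by (rule iffD1[OF Ck_on_cong[OF oK] Ck_on_const[OF oK, of _ 0]]) (simp add: h0)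
    ultimately show "Ck_on (Suc 0) (h i) S" using S by auto
  qed
  note I = integral_derivative_compact_support[OF Ch cK h0]
  have D: "frechet_derivative (h i) (at x) (axis i 1) = (if x \<in> ?U then partial c i (?f i) (chart_inv c x) else 0)" for i x
  proof (cases "x \<in> ?U")
    case True
    have "frechet_derivative (h i) (at x) = frechet_derivative (?f i \<circ> chart_inv c) (at x)"
      by (rule frechet_derivative_cong_open[OF open_image True]) (simp add: h_def)
    then show ?thesis using True image_inv[OF True] by (simp add: partial_def)
  next
    case False
    then have "x \<in> - ?K" using K by auto
    then have "frechet_derivative (h i) (at x) = frechet_derivative (\<lambda>x. 0) (at x)"
      by (rule frechet_derivative_cong_open[OF oK]) (simp add: h0)
    then show ?thesis using False by simp
  qed
  have sum: "(\<Sum>i\<in>UNIV. partial c i (?f i) q)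
      = (\<rho> q * divergence g W c q + (\<Sum>i\<in>UNIV. partial c i \<rho> q * W c q $ i)) * volume_density g c q" if q: "q \<in> fst c" for q
  proof -
    have "partial c i (?f i) q = (partial c i \<rho> q * W c q $ i + \<rho> q * partial c i (\<lambda>q. W c q $ i) q
        + \<rho> q * (trace (\<Gamma> i q) * W c q $ i)) * volume_density g c q" for i
      by (simp only: partial_mult[OF q Ck_in_mult[OF \<rho>(1) W] Ck_in_density] partial_mult[OF q \<rho>(1) W]
          partial_density[OF q]) (simp add: algebra_simps)
    then show ?thesis
      by (simp add: divergence_density[OF q] sum.distrib sum_distrib_left sum_distrib_right algebra_simps)
  qed
  have "chart_integrand g c (\<lambda>q. \<rho> q * divergence g W c q + (\<Sum>i\<in>UNIV. partial c i \<rho> q * W c q $ i))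
      = (\<lambda>x. \<Sum>i\<in>UNIV. frechet_derivative (h i) (at x) (axis i 1))"
  proof
    fix x
    show "chart_integrand g c (\<lambda>q. \<rho> q * divergence g W c q + (\<Sum>i\<in>UNIV. partial c i \<rho> q * W c q $ i)) x
      = (\<Sum>i\<in>UNIV. frechet_derivative (h i) (at x) (axis i 1))"
      unfolding D chart_integrand_def using sum[of "chart_inv c x"] image_inv[of x] by auto
  qed
  then show ?thesis
    unfolding chart_integral_def using I by simp
qed

end

text \<open>The density picks up the factor \<open>|det J|\<close>, which is the factor of the
  change of variables. The support lies in the overlap, so neither integral sees the rest of its
  chart.\<close>

lemma (in metric_overlap) chart_integral_change:
  assumes K: "compactin M K" "K \<subseteq> V"
    and f: "Ck_in 0 c V f" and f0: "\<And>q. q \<notin> K \<Longrightarrow> f q = 0"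
  shows "chart_integral g c f = chart_integral g d f"
proof -
  \<comment> \<open>The opposite change of chart provides the continuity of \<open>f\<close> in the
    coordinates of \<open>d\<close>.\<close>
  interpret dc: metric_overlap M A d c g
    by unfold_locales (rule atlas metric cA dA)+
  have f': "Ck_in 0 d V f"
    using dc.Ck_in_change f by (simp add: Int_commute)
  let ?U = "snd c ` V" and ?\<tau> = "transition c d" and ?J = "\<lambda>x. J (chart_inv c x)"
  let ?F = "chart_integrand g d f"
  have img: "?\<tau> ` ?U = snd d ` V"
    by (force simp: image_iff transition_chart)
  have intF: "integrable lborel ?F"
    by (rule md.integrable_chart_integrand[OF K _ f' f0]) auto
  have intC: "integrable lborel (chart_integrand g c f)"
    by (rule mc.integrable_chart_integrand[OF K _ f f0]) auto
  have eq: "chart_integrand g c f = (\<lambda>x. if x \<in> ?U then \<bar>det (?J x)\<bar> * ?F (?\<tau> x) else 0)"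
  proof
    fix x
    show "chart_integrand g c f x = (if x \<in> ?U then \<bar>det (?J x)\<bar> * ?F (?\<tau> x) else 0)"
    proof (cases "x \<in> ?U")
      case True
      then obtain q where q: "q \<in> V" "x = snd c q" by auto
      have "volume_density g c q = \<bar>det (J q)\<bar> * volume_density g d q"
        by (simp add: volume_density_def det_g_change[OF q(1)] abs_mult real_sqrt_mult)
      moreover have "chart_inv c x = q" "?\<tau> x = snd d q" "chart_inv d (snd d q) = q"
        using q by (simp_all add: c.inv_chart d.inv_chart transition_chart)
      ultimately show ?thesis
        using q True by (auto simp: chart_integrand_def)
    next
      case False
      have "f (chart_inv c x) = 0" if "x \<in> snd c ` fst c"
      proof (rule f0, rule notI)
        assume "chart_inv c x \<in> K"
        then have "x \<in> ?U" using K(2) by (metis chart_chart_inv[OF that] imageI subsetD)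
        then show False using False by simp
      qed
      then show ?thesis using False by (auto simp: chart_integrand_def)
    qed
  qed
  have "(\<integral>x. (if x \<in> ?U then \<bar>det (?J x)\<bar> * ?F (?\<tau> x) else 0) \<partial>lborel) = (\<integral>y. ?F y \<partial>lborel)"
  proof (rule change_of_variables)
    show "open ?U" by (rule c.open_image)
    show "(?\<tau> has_derivative (\<lambda>v. ?J x *v v)) (at x)" if "x \<in> ?U" for x
      using transition_derivative c.inv_chart that by auto
    show "inj_on ?\<tau> ?U"
      by (rule inj_on_inverseI[of _ "\<lambda>y. snd c (chart_inv d y)"])
        (use chart_inv_transition c.image_inv in auto)
    show "integrable lborel ?F" by (rule intF)
    show "?F y = 0" if "y \<notin> ?\<tau> ` ?U" for y
    proof -
      have "f (chart_inv d y) = 0" if y: "y \<in> snd d ` fst d"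
      proof (rule f0, rule notI)
        assume "chart_inv d y \<in> K"
        then have "y \<in> snd d ` V" using K(2) by (metis chart_chart_inv[OF y] imageI subsetD)
        then show False using \<open>y \<notin> ?\<tau> ` ?U\<close> img by simp
      qed
      then show ?thesis by (simp add: chart_integrand_def)
    qed
    show "(\<lambda>x. if x \<in> ?U then \<bar>det (?J x)\<bar> * ?F (?\<tau> x) else 0) \<in> borel_measurable borel"
      unfolding eq[symmetric] using intC by auto
  qed
  then show ?thesis by (simp add: chart_integral_def eq)
qed

section \<open>Partitions of unity\<close>

lemma Ck_on_ident: "open S \<Longrightarrow> Ck_on k (\<lambda>x. x) S"
  by (cases k) (auto intro!: Ck_on_SucI[where f' = "\<lambda>x v. v"] Ck_on_const)

text \<open>Squaring smooths the corner of \<open>max 0 t\<close>: the derivative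
  \<open>2 * max 0 t\<close> is continuous. This is the profile of the bumps below.\<close>

lemma Ck_on_square_positive_part: "Ck_on (Suc 0) (\<lambda>t::real. (max 0 t)\<^sup>2) UNIV"
proof (rule Ck_on_SucI)
  fix t :: real
  let ?f = "\<lambda>t::real. (max 0 t)\<^sup>2"
  consider "t > 0" | "t < 0" | "t = 0" by linarith
  then have "(?f has_real_derivative 2 * max 0 t) (at t)"
  proof cases
    case 1
    have "((\<lambda>t::real. t\<^sup>2) has_real_derivative 2 * t) (at t)" by (auto intro!: derivative_eq_intros)
    then show ?thesis
      using 1 has_field_derivative_transform_within_open[of _ "2 * t" t "{0<..}" ?f] by auto
  next
    case 2
    have "((\<lambda>t::real. 0) has_real_derivative 0) (at t)" by simp
    then show ?thesis
      using 2 has_field_derivative_transform_within_open[of "\<lambda>t. 0" 0 t "{..<0}" ?f] by (simp add: max_def)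
  next
    \<comment> \<open>At the seam the difference quotient is squeezed between
      \<open>- \<bar>h\<bar>\<close> and \<open>\<bar>h\<bar>\<close>.\<close>
    case 3
    have "((\<lambda>h. (?f (0 + h) - ?f 0) / h) \<longlongrightarrow> 0) (at 0)"
    proof (rule Lim_null_comparison[where g = "\<lambda>h. \<bar>h\<bar>"])
      show "\<forall>\<^sub>F h in at 0. norm ((?f (0 + h) - ?f 0) / h) \<le> \<bar>h\<bar>"
        by (rule always_eventually) (auto simp: max_def power2_eq_square)
      show "((\<lambda>h::real. \<bar>h\<bar>) \<longlongrightarrow> 0) (at 0)" by (intro tendsto_eq_intros) auto
    qed
    then show ?thesis using 3 by (simp add: DERIV_def)
  qed
  then show "(?f has_derivative (\<lambda>v. 2 * max 0 t * v)) (at t)"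
    by (simp add: has_field_derivative_def)
next
  show "Ck_on 0 (\<lambda>t::real. 2 * max 0 t * v) UNIV" for v
    by (auto intro!: continuous_intros)
qed simp

definition bump :: "('a, 'n::finite) chart \<Rightarrow> 'a \<Rightarrow> real \<Rightarrow> 'a \<Rightarrow> real" where
  "bump c p r q = (if q \<in> fst c then (max 0 (r\<^sup>2 - (snd c q - snd c p) \<bullet> (snd c q - snd c p)))\<^sup>2 else 0)"

definition bump_support :: "('a, 'n::finite) chart \<Rightarrow> 'a \<Rightarrow> real \<Rightarrow> 'a set" where
  "bump_support c p r = chart_inv c ` cball (snd c p) r"

lemma bump_nonneg: "bump c p r q \<ge> 0"
  by (simp add: bump_def)

lemma bump_pos_iff:
  assumes "r > 0"
  shows "bump c p r q > 0 \<longleftrightarrow> q \<in> fst c \<and> snd c q \<in> ball (snd c p) r"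
proof -
  have "dist (snd c p) (snd c q) < r \<longleftrightarrow> (norm (snd c q - snd c p))\<^sup>2 < r\<^sup>2"
    unfolding dist_norm norm_minus_commute[of "snd c p"]
    using power2_less_imp_less[of _ r] power_strict_mono[of _ r 2] assms by auto
  then show ?thesis by (auto simp: bump_def dot_square_norm max_def)
qed

lemma bump_region:
  assumes "is_chart M c" "p \<in> fst c" "r > 0" "cball (snd c p) r \<subseteq> snd c ` fst c"
  shows "compactin M (bump_support c p r)" "bump_support c p r \<subseteq> fst c"
    and "q \<notin> bump_support c p r \<Longrightarrow> bump c p r q = 0"
proof -
  show "compactin M (bump_support c p r)"
    unfolding bump_support_def using assms by (intro compactin_chart_preimage) auto
  show "bump_support c p r \<subseteq> fst c"
    using assms(4) chart_inv_chart[OF assms(1)] by (force simp: bump_support_def)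
  assume q: "q \<notin> bump_support c p r"
  have "\<not> bump c p r q > 0"
  proof
    assume "bump c p r q > 0"
    then have "q \<in> fst c" "snd c q \<in> cball (snd c p) r" by (auto simp: bump_pos_iff[OF assms(3)])
    then show False using q chart_inv_chart[OF assms(1)] unfolding bump_support_def by (metis imageI)
  qed
  then show "bump c p r q = 0" using bump_nonneg[of c p r q] by linarith
qed

text \<open>Regularity is needed in every chart \<open>d\<close>, not only in the one defining the
  bump. On the overlap it follows by changing coordinates; on the rest of \<open>d\<close> the bump
  vanishes off its support, which is closed because compact sets in a Hausdorff space are. These two
  open sets cover the domain of \<open>d\<close>.\<close>

lemma Ck_in_bump:
  assumes atlas: "smooth_atlas M A" and haus: "Hausdorff_space M" and cd: "c \<in> A" "d \<in> A"
    and p: "p \<in> fst c" "r > 0" "cball (snd c p) r \<subseteq> snd c ` fst c"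
  shows "Ck_in (Suc 0) d (fst d) (bump c p r)"
proof -
  interpret chart_overlap M A d c by unfold_locales (use atlas cd in auto)
  let ?K = "bump_support c p r" and ?b = "bump c p r"
  have chart: "is_chart M c" using charts by simp
  note K = bump_region[OF chart p]
  have clK: "closedin M ?K" using K(1) haus compactin_imp_closedin by blast
  have opd: "openin M (fst d)" using charts by (simp add: is_chart_def)
  interpret D: chart_region M d "fst d" by unfold_locales (use charts opd in auto)
  interpret E: chart_region M d "fst d - ?K" by unfold_locales (use charts openin_diff[OF opd clK] in auto)
  interpret C: chart_region M c "fst c" by unfold_locales (use chart in \<open>auto simp: is_chart_def\<close>)
  have sq: "Ck_on (Suc 0) (\<lambda>y. r\<^sup>2 + (-1) * ((y + - snd c p) \<bullet> (y + - snd c p))) (snd c ` fst c)"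
    by (intro Ck_on_add Ck_on_mult Ck_on_const Ck_on_ident C.open_image
        bounded_bilinear.Ck_on_bilinear[OF bounded_bilinear_inner])
  have "Ck_on (Suc 0) (\<lambda>y. (max 0 (r\<^sup>2 + (-1) * ((y + - snd c p) \<bullet> (y + - snd c p))))\<^sup>2) (snd c ` fst c)"
    by (rule Ck_on_compose[OF C.open_image open_UNIV sq UNIV_I Ck_on_square_positive_part])
  then have "Ck_in (Suc 0) c (fst c) ?b"
    unfolding Ck_in_def
    by (rule iffD1[OF Ck_on_cong[OF C.open_image], rotated])
      (use C.image_inv in \<open>auto simp: bump_def\<close>)
  then have "Ck_in (Suc 0) c V ?b" by (rule Ck_in_subset) simp
  then have 1: "Ck_in (Suc 0) d V ?b" by (rule Ck_in_change)
  have 2: "Ck_in (Suc 0) d (fst d - ?K) ?b"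
    by (rule iffD1[OF E.Ck_in_cong E.Ck_in_const[of _ 0]]) (simp add: K(3))
  have cover: "snd d ` fst d = \<Union>{snd d ` V, snd d ` (fst d - ?K)}"
    using K(2) by auto
  show ?thesis
    unfolding Ck_in_def cover
    by (rule Ck_on_Union) (use 1 2 c.open_image E.open_image in \<open>auto simp: Ck_in_def\<close>)
qed

text \<open>Bumps on finitely many coordinate balls are divided by their sum. A ball around
  \<open>p0\<close> in the chart \<open>c0\<close> is added to the subcover, so that one weight
  belongs to the prescribed chart and is positive at the prescribed point.\<close>

lemma partition_of_unity:
  fixes M :: "'a topology" and A :: "('a, 'n::finite) chart set"
  assumes M: "closed_manifold M A" and c0: "c0 \<in> A" "p0 \<in> fst c0"
  obtains I :: "(('a, 'n) chart \<times> 'a \<times> real) set" and \<rho> K i0 where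
    "finite I" "\<And>i. i \<in> I \<Longrightarrow> fst i \<in> A"
    "\<And>i. i \<in> I \<Longrightarrow> compactin M (K i)" "\<And>i. i \<in> I \<Longrightarrow> K i \<subseteq> fst (fst i)"
    "\<And>i q. i \<in> I \<Longrightarrow> q \<notin> K i \<Longrightarrow> \<rho> i q = 0" "\<And>i q. \<rho> i q \<ge> (0::real)"
    "\<And>i d. i \<in> I \<Longrightarrow> d \<in> A \<Longrightarrow> Ck_in (Suc 0) d (fst d) (\<rho> i)"
    "\<And>q. q \<in> topspace M \<Longrightarrow> (\<Sum>i\<in>I. \<rho> i q) = 1"
    "i0 \<in> I" "fst i0 = c0" "\<rho> i0 p0 > 0"
proof -
  have atlas: "smooth_atlas M A" and haus: "Hausdorff_space M" and comp: "compact_space M"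
    using M by (auto simp: closed_manifold_def smooth_manifold_def)
  have charts: "is_chart M c" if "c \<in> A" for c using atlas that by (simp add: smooth_atlas_def)
  define I0 where "I0 = {(c, p, r). c \<in> A \<and> p \<in> fst c \<and> r > 0 \<and> cball (snd c p) r \<subseteq> snd c ` fst c}"
  define b where "b = (\<lambda>(c :: ('a, 'n) chart, p, r). bump c p r)"
  define K where "K = (\<lambda>(c :: ('a, 'n) chart, p, r). bump_support c p r)"
  define N where "N i = {q. b i q > 0}" for i
  have ex: "\<exists>r. (c, p, r) \<in> I0" if "c \<in> A" "p \<in> fst c" for c p
  proof -
    have "open (snd c ` fst c)" "snd c p \<in> snd c ` fst c"
      using charts that by (auto simp: is_chart_def)
    then show ?thesis using that open_contains_cball unfolding I0_def by blast
  qed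
  have N: "N i = {q \<in> fst (fst i). snd (fst i) q \<in> ball (snd (fst i) (fst (snd i))) (snd (snd i))}" if "i \<in> I0" for i
    using that by (auto simp: N_def b_def I0_def bump_pos_iff split: prod.splits)
  have pN: "p \<in> N (c, p, r)" if "(c, p, r) \<in> I0" for c p r
    using that by (simp add: N) (simp add: I0_def)
  have openN: "openin M (N i)" if i: "i \<in> I0" for i
  proof -
    obtain c p r where i': "i = (c, p, r)" by (cases i) auto
    have c: "is_chart M c" using i charts by (simp add: I0_def i')
    then have fc: "openin M (fst c)" by (simp add: is_chart_def)
    have "continuous_map (subtopology M (fst c)) euclidean (snd c)"
      using c unfolding is_chart_def
      by (metis homeomorphic_imp_continuous_map continuous_map_in_subtopology)
    then have "openin (subtopology M (fst c)) {q \<in> topspace (subtopology M (fst c)). snd c q \<in> ball (snd c p) r}"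
      by (rule openin_continuous_map_preimage) simp
    moreover have "topspace (subtopology M (fst c)) = fst c"
      using fc openin_subset by auto
    moreover have "N i = {q \<in> fst c. snd c q \<in> ball (snd c p) r}"
      unfolding N[OF i] by (simp add: i')
    ultimately have "openin (subtopology M (fst c)) (N i)" by (simp only:)
    then show ?thesis using fc openin_trans_full by blast
  qed
  have "topspace M \<subseteq> \<Union>(N ` I0)"
  proof
    fix q assume "q \<in> topspace M"
    then obtain c where "c \<in> A" "q \<in> fst c" using atlas unfolding smooth_atlas_def by blast
    then show "q \<in> \<Union>(N ` I0)" using ex pN by blast
  qed
  moreover have "openin M U" if "U \<in> N ` I0" for U using that openN by blast
  moreover have "compactin M (topspace M)" using comp by (simp add: compact_space_def)
  ultimately obtain \<F> where \<F>: "finite \<F>" "\<F> \<subseteq> N ` I0" "topspace M \<subseteq> \<Union>\<F>"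
    using compactinD[of M "topspace M" "N ` I0"] by blast
  then obtain I1 where I1: "I1 \<subseteq> I0" "finite I1" "\<F> = N ` I1"
    using finite_subset_image by metis
  obtain r0 where r0: "(c0, p0, r0) \<in> I0" using ex c0 by blast
  define I where "I = insert (c0, p0, r0) I1"
  define s where "s q = (\<Sum>i\<in>I. b i q)" for q
  have I: "finite I" "I \<subseteq> I0" using I1 r0 by (auto simp: I_def)
  have b0: "b i q \<ge> 0" for i q by (simp add: b_def bump_nonneg split: prod.splits)
  have spos: "s q > 0" if q: "q \<in> topspace M" for q
  proof -
    obtain i where i: "i \<in> I" "q \<in> N i" using \<F>(3) I1 q unfolding I_def by blast
    then have "b i q > 0" by (simp add: N_def)
    then show ?thesis unfolding s_def by (rule sum_pos2[OF I(1) i(1) _ b0])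
  qed
  have Cb: "Ck_in (Suc 0) d (fst d) (b i)" if "i \<in> I" "d \<in> A" for i d
  proof -
    obtain c p r where i: "i = (c, p, r)" by (cases i) auto
    then have "c \<in> A" "p \<in> fst c" "r > 0" "cball (snd c p) r \<subseteq> snd c ` fst c"
      using that I(2) unfolding I0_def by blast+
    from Ck_in_bump[OF atlas haus this(1) that(2) this(2-4)] show ?thesis by (simp add: i b_def)
  qed
  show ?thesis
  proof (rule that[of I K "\<lambda>i q. b i q / s q" "(c0, p0, r0)"])
    show "finite I" by (rule I)
    fix i assume i: "i \<in> I"
    then obtain c p r where i': "i = (c, p, r)" and c: "c \<in> A" "p \<in> fst c" "r > 0" "cball (snd c p) r \<subseteq> snd c ` fst c"
      using I(2) unfolding I0_def by blast
    show "fst i \<in> A" "compactin M (K i)" "K i \<subseteq> fst (fst i)"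
      using bump_region[OF charts[OF c(1)] c(2-4)] c by (simp_all add: i' K_def)
    show "b i q / s q = 0" if "q \<notin> K i" for q
      using bump_region(3)[OF charts[OF c(1)] c(2-4)] that by (simp add: i' K_def b_def)
    fix d assume d: "d \<in> A"
    interpret D: chart_region M d "fst d" by unfold_locales (use charts[OF d] in \<open>auto simp: is_chart_def\<close>)
    have "fst d \<subseteq> topspace M" using D.openV openin_subset by blast
    then have "s q \<noteq> 0" if "q \<in> fst d" for q using spos that by force
    then show "Ck_in (Suc 0) d (fst d) (\<lambda>q. b i q / s q)"
      unfolding s_def by (intro D.Ck_in_divide D.Ck_in_sum Cb i d)
  next
    show "b i q / s q \<ge> 0" for i q using b0 by (simp add: s_def sum_nonneg)
    show "(\<Sum>i\<in>I. b i q / s q) = 1" if "q \<in> topspace M" for q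
      using spos[OF that] by (simp add: s_def flip: sum_divide_distrib)
    show "(c0, p0, r0) \<in> I" "fst (c0, p0, r0) = c0" by (simp_all add: I_def)
    have "p0 \<in> topspace M" using c0 atlas unfolding smooth_atlas_def by blast
    then show "b (c0, p0, r0) p0 / s p0 > 0"
      using spos pN[OF r0] by (simp add: N_def)
  qed
qed

section \<open>The divergence theorem\<close>

text \<open>The set where \<open>f\<close> is positive inside \<open>U\<close> is open and of
  measure zero, hence empty.\<close>

lemma continuous_nonneg_integral_zero:
  fixes f :: "'e::euclidean_space \<Rightarrow> real"
  assumes U: "open U" "continuous_on U f" and nn: "\<And>x. f x \<ge> 0"
    and f: "integrable lborel f" "(\<integral>x. f x \<partial>lborel) = 0" and x: "x \<in> U"
  shows "f x = 0"
proof -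
  have "AE x in lborel. f x = 0"
    using integral_nonneg_eq_0_iff_AE[OF f(1)] nn f(2) by simp
  then have ae: "AE x in lborel. \<not> (x \<in> U \<and> f x > 0)" by (rule AE_mp) simp
  define S where "S = U \<inter> f -` {0<..}"
  have S: "open S" unfolding S_def by (rule continuous_open_preimage[OF U(2,1)]) simp
  have "S \<in> null_sets lborel"
  proof -
    have "AE x in lborel. x \<notin> S" using ae by (rule AE_mp) (simp add: S_def)
    then show ?thesis using AE_iff_null_sets[of S lborel] S by simp
  qed
  then have "negligible S" by (simp add: negligible_iff_null_sets null_sets_completionI)
  then have "S = {}" using S open_not_negligible by blast
  then show ?thesis using x nn[of x] by (force simp: S_def)
qed

text \<open>The case distinction is needed because partial derivatives in a chart are junk outside its
  domain.\<close>

definition directional ::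
    "('a, 'n::finite) vec_field \<Rightarrow> ('a, 'n) chart \<Rightarrow> ('a \<Rightarrow> real) \<Rightarrow> 'a \<Rightarrow> real" where
  "directional W c f q = (if q \<in> fst c then \<Sum>k\<in>UNIV. partial c k f q * W c q $ k else 0)"

lemma directional_change:
  assumes "smooth_atlas M A" "smooth_vector_field A W" "c \<in> A" "d \<in> A" "q \<in> fst c \<inter> fst d"
    and f: "Ck_in (Suc 0) d (fst d) f"
  shows "directional W c f q = directional W d f q"
proof -
  interpret chart_overlap M A c d by unfold_locales (use assms in auto)
  have q: "q \<in> V" using assms by simp
  have W: "W d q = J q *v W c q" using assms unfolding smooth_vector_field_def by blast
  have "(\<Sum>k\<in>UNIV. partial c k f q * W c q $ k) = (\<Sum>k\<in>UNIV. \<Sum>a\<in>UNIV. J q $ a $ k * partial d a f q * W c q $ k)"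
    using partial_change[OF Ck_in_subset[OF f] q] by (simp add: sum_distrib_right)
  also have "\<dots> = (\<Sum>a\<in>UNIV. partial d a f q * W d q $ a)"
    by (subst sum.swap) (simp add: W matrix_vector_mult_def sum_distrib_left mult_ac)
  finally show ?thesis using assms(5) by (simp add: directional_def)
qed

text \<open>Each weighted integral of the divergence, taken in the chart of its weight, is
  nonnegative, and they sum to zero; so the one for \<open>i0\<close> is zero. Its integrand is
  continuous on the coordinate image and nonnegative, hence zero at \<open>p0\<close>, where weight
  and density are positive.\<close>

lemma divergence_nonneg_imp_zero:
  fixes M :: "'a topology" and A :: "('a, 'n::finite) chart set"
  assumes M: "closed_manifold M A" and metric: "riemannian_metric A g" and W: "smooth_vector_field A W"
    and nonneg: "\<And>c p. c \<in> A \<Longrightarrow> p \<in> fst c \<Longrightarrow> divergence g W c p \<ge> 0"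
    and c0: "c0 \<in> A" "p0 \<in> fst c0"
  shows "divergence g W c0 p0 = 0"
proof (rule partition_of_unity[OF M c0])
  have atlas: "smooth_atlas M A" and haus: "Hausdorff_space M"
    using M by (auto simp: closed_manifold_def smooth_manifold_def)
  fix I :: "(('a, 'n) chart \<times> 'a \<times> real) set" and \<rho> K i0
  assume I: "finite I" "\<And>i. i \<in> I \<Longrightarrow> fst i \<in> A"
    and K: "\<And>i. i \<in> I \<Longrightarrow> compactin M (K i)" "\<And>i. i \<in> I \<Longrightarrow> K i \<subseteq> fst (fst i)"
    and \<rho>0: "\<And>i q. i \<in> I \<Longrightarrow> q \<notin> K i \<Longrightarrow> \<rho> i q = 0" and \<rho>nn: "\<And>i q. \<rho> i q \<ge> (0::real)"
    and C\<rho>: "\<And>i d. i \<in> I \<Longrightarrow> d \<in> A \<Longrightarrow> Ck_in (Suc 0) d (fst d) (\<rho> i)"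
    and \<rho>1: "\<And>q. q \<in> topspace M \<Longrightarrow> (\<Sum>i\<in>I. \<rho> i q) = 1"
    and i0: "i0 \<in> I" "fst i0 = c0" "\<rho> i0 p0 > 0"
  let ?div = "\<lambda>c. divergence g W c" and ?D = "directional W"
  have fc: "field_chart M A g c W" if "c \<in> A" for c
    by unfold_locales (use atlas metric W that in \<open>auto simp: smooth_vector_field_def\<close>)
  have mc: "metric_chart M A g c" if "c \<in> A" for c
    by unfold_locales (use atlas metric that in auto)
  have rc: "chart_region M c (fst c)" if "c \<in> A" for c
    by unfold_locales (use atlas that in \<open>auto simp: smooth_atlas_def is_chart_def\<close>)
  have C\<rho>': "Ck_in 0 d (fst d) (\<rho> i)" if "i \<in> I" "d \<in> A" for i d
    using chart_region.Ck_in_Suc_imp[OF rc[OF that(2)] C\<rho>[OF that]] .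
  have CD: "Ck_in 0 c (fst c) (?D c (\<rho> i))" if "i \<in> I" "c \<in> A" for i c
  proof -
    interpret field_chart M A g c W by (rule fc[OF that(2)])
    have "Ck_in 0 c (fst c) (\<lambda>q. \<Sum>k\<in>UNIV. partial c k (\<rho> i) q * W c q $ k)"
      by (intro Ck_in_sum Ck_in_mult Ck_in_partial C\<rho> Ck_in_X that)
    then show ?thesis by (rule iffD1[OF Ck_in_cong, rotated]) (simp add: directional_def)
  qed
  have Cdiv: "Ck_in 0 c (fst c) (?div c)" if "c \<in> A" for c
  proof -
    interpret field_chart M A g c W by (rule fc[OF that])
    have "Ck_in 0 c (fst c) (\<lambda>q. \<Sum>i\<in>UNIV. N q $ i $ i)" by (intro Ck_in_sum Ck_in_N)
    then show ?thesis by (simp add: divergence_eq_trace[abs_def] trace_def N_def)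
  qed
  \<comment> \<open>The complement of the compact \<open>K i\<close> is open in a Hausdorff space,
    so the derivatives vanish there along with the function.\<close>
  have D0: "?D c (\<rho> i) q = 0" if "i \<in> I" "c \<in> A" "q \<notin> K i" for i c q
  proof (cases "q \<in> fst c")
    case True
    have "openin M (fst c)" using rc[OF that(2)] by (simp add: chart_region_def)
    then have "openin M (fst c - K i)"
      using compactin_imp_closedin[OF haus K(1)[OF that(1)]] by (rule openin_diff)
    then interpret chart_region M c "fst c - K i"
      using rc[OF that(2)] by unfold_locales (auto simp: chart_region_def)
    have "partial c k (\<rho> i) q = partial c k (\<lambda>q. 0) q" for k
      by (rule partial_cong_region) (use True that \<rho>0 in auto)
    then show ?thesis by (simp add: directional_def partial_const)
  qed (simp add: directional_def)
  \<comment> \<open>Outside the chart of \<open>i\<close> the left side is zero by the default of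
    \<open>directional\<close>, and the right side is zero because \<open>K i\<close> lies inside
    that chart.\<close>
  have Dchange: "?D (fst i) (\<rho> i) q = ?D (fst j) (\<rho> i) q" if "i \<in> I" "j \<in> I" "q \<in> fst (fst j)" for i j q
  proof (cases "q \<in> fst (fst i)")
    case True
    then show ?thesis
      using directional_change[OF atlas W I(2)[OF that(1)] I(2)[OF that(2)] _ C\<rho>[OF that(1) I(2)[OF that(2)]]] that
      by blast
  next
    case False
    then have "q \<notin> K i" using K(2) that by blast
    then show ?thesis using D0 that I by simp
  qed
  have dom: "fst c \<subseteq> topspace M" if "c \<in> A" for c
    using rc[OF that] openin_subset by (auto simp: chart_region_def)
  \<comment> \<open>The product vanishes off \<open>K i\<close> and off \<open>K j\<close>, so it
    may be integrated in either of the two charts.\<close>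
  have int\<rho>D: "integrable lborel (chart_integrand g (fst k) (\<lambda>q. \<rho> j q * ?D (fst k) (\<rho> i) q))"
    if "i \<in> I" "j \<in> I" "k = i \<or> k = j" for i j k
  proof -
    have k: "k \<in> I" using that by auto
    interpret metric_chart M A g "fst k" by (rule mc[OF I(2)[OF k]])
    show ?thesis
    proof (rule integrable_chart_integrand[OF K(1)[OF k] K(2)[OF k]])
      show "Ck_in 0 (fst k) (fst (fst k)) (\<lambda>q. \<rho> j q * ?D (fst k) (\<rho> i) q)"
        by (intro Ck_in_mult C\<rho>' CD that I(2) k)
      show "\<rho> j q * ?D (fst k) (\<rho> i) q = 0" if "q \<notin> K k" for q
        using that \<open>k = i \<or> k = j\<close> \<rho>0[OF \<open>j \<in> I\<close>] D0[OF \<open>i \<in> I\<close> I(2)[OF k]] by fastforce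
    qed simp
  qed
  have intdiv: "integrable lborel (chart_integrand g (fst i) (\<lambda>q. \<rho> i q * ?div (fst i) q))" if "i \<in> I" for i
  proof -
    interpret metric_chart M A g "fst i" by (rule mc[OF I(2)[OF that]])
    show ?thesis
      by (rule integrable_chart_integrand[OF K(1)[OF that] K(2)[OF that]])
        (auto intro!: Ck_in_mult C\<rho>' Cdiv that I(2) simp: \<rho>0[OF that])
  qed
  have intD: "integrable lborel (chart_integrand g (fst i) (?D (fst i) (\<rho> i)))" if "i \<in> I" for i
  proof -
    interpret metric_chart M A g "fst i" by (rule mc[OF I(2)[OF that]])
    show ?thesis
      by (rule integrable_chart_integrand[OF K(1)[OF that] K(2)[OF that]])
        (auto intro!: CD that I(2) simp: D0[OF that I(2)[OF that]])
  qed
  have parts: "chart_integral g (fst i) (\<lambda>q. \<rho> i q * ?div (fst i) q) = - chart_integral g (fst i) (?D (fst i) (\<rho> i))"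
    if "i \<in> I" for i
  proof -
    interpret field_chart M A g "fst i" W by (rule fc[OF I(2)[OF that]])
    have "chart_integral g (fst i) (\<lambda>q. \<rho> i q * ?div (fst i) q + ?D (fst i) (\<rho> i) q)
        = chart_integral g (fst i) (\<lambda>q. \<rho> i q * ?div (fst i) q + (\<Sum>k\<in>UNIV. partial (fst i) k (\<rho> i) q * W (fst i) q $ k))"
      by (rule chart_integral_cong) (simp add: directional_def)
    also have "\<dots> = 0"
      by (rule integral_divergence_chart[OF K(1)[OF that] K(2)[OF that] C\<rho>[OF that I(2)[OF that]]])
        (simp_all add: \<rho>0[OF that] Ck_in_X)
    finally show ?thesis
      using chart_integral_add[OF intdiv[OF that] intD[OF that]] by simp
  qed
  \<comment> \<open>Here 1 is inserted as the sum of all \<open>\<rho> j\<close>. The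
    \<open>j\<close>-th summand is supported in \<open>K i \<inter> K j\<close>, a compact part of
    the overlap, and can be moved to the chart of \<open>j\<close>.\<close>
  have split: "chart_integral g (fst i) (?D (fst i) (\<rho> i)) = (\<Sum>j\<in>I. chart_integral g (fst j) (\<lambda>q. \<rho> j q * ?D (fst j) (\<rho> i) q))"
    if "i \<in> I" for i
  proof -
    interpret metric_chart M A g "fst i" by (rule mc[OF I(2)[OF that]])
    have "chart_integral g (fst i) (?D (fst i) (\<rho> i)) = chart_integral g (fst i) (\<lambda>q. \<Sum>j\<in>I. \<rho> j q * ?D (fst i) (\<rho> i) q)"
      by (rule chart_integral_cong) (use \<rho>1 dom[OF I(2)[OF that]] in \<open>auto simp flip: sum_distrib_right\<close>)
    also have "\<dots> = (\<Sum>j\<in>I. chart_integral g (fst i) (\<lambda>q. \<rho> j q * ?D (fst i) (\<rho> i) q))"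
      by (rule chart_integral_sum) (use int\<rho>D that in blast)
    also have "\<dots> = (\<Sum>j\<in>I. chart_integral g (fst j) (\<lambda>q. \<rho> j q * ?D (fst j) (\<rho> i) q))"
    proof (rule sum.cong[OF refl])
      fix j assume j: "j \<in> I"
      interpret o: metric_overlap M A "fst i" "fst j" g
        by unfold_locales (use atlas metric I(2) that j in auto)
      have "chart_integral g (fst i) (\<lambda>q. \<rho> j q * ?D (fst i) (\<rho> i) q) = chart_integral g (fst j) (\<lambda>q. \<rho> j q * ?D (fst i) (\<rho> i) q)"
      proof (rule o.chart_integral_change)
        show "compactin M (K i \<inter> K j)"
          using compact_Int_closedin[OF K(1)[OF that] compactin_imp_closedin[OF haus K(1)[OF j]]] .
        show "K i \<inter> K j \<subseteq> fst (fst i) \<inter> fst (fst j)" using K(2) that j by blast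
        show "Ck_in 0 (fst i) (fst (fst i) \<inter> fst (fst j)) (\<lambda>q. \<rho> j q * ?D (fst i) (\<rho> i) q)"
          by (rule Ck_in_subset[of _ _ "fst (fst i)"]) (auto intro!: Ck_in_mult C\<rho>' CD that j I(2))
        show "\<rho> j q * ?D (fst i) (\<rho> i) q = 0" if "q \<notin> K i \<inter> K j" for q
          using that \<rho>0[OF j] D0[OF \<open>i \<in> I\<close> I(2)[OF \<open>i \<in> I\<close>]] by auto
      qed
      also have "\<dots> = chart_integral g (fst j) (\<lambda>q. \<rho> j q * ?D (fst j) (\<rho> i) q)"
        by (rule o.md.chart_integral_cong) (simp add: Dchange[OF that j])
      finally show "chart_integral g (fst i) (\<lambda>q. \<rho> j q * ?D (fst i) (\<rho> i) q) = \<dots>" .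
    qed
    finally show ?thesis .
  qed
  have "(\<Sum>i\<in>I. chart_integral g (fst i) (?D (fst i) (\<rho> i)))
      = (\<Sum>j\<in>I. \<Sum>i\<in>I. chart_integral g (fst j) (\<lambda>q. \<rho> j q * ?D (fst j) (\<rho> i) q))"
    by (simp add: split) (rule sum.swap)
  also have "\<dots> = 0"
  proof (rule sum.neutral, rule ballI)
    fix j assume j: "j \<in> I"
    interpret metric_chart M A g "fst j" by (rule mc[OF I(2)[OF j]])
    have "(\<Sum>i\<in>I. chart_integral g (fst j) (\<lambda>q. \<rho> j q * ?D (fst j) (\<rho> i) q))
        = chart_integral g (fst j) (\<lambda>q. \<Sum>i\<in>I. \<rho> j q * ?D (fst j) (\<rho> i) q)"
      by (rule chart_integral_sum[symmetric]) (use int\<rho>D j in blast)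
    also have "\<dots> = chart_integral g (fst j) (\<lambda>q. 0)"
    proof (rule chart_integral_cong)
      fix q assume q: "q \<in> fst (fst j)"
      \<comment> \<open>The differentials of the weights add up to the differential of the constant
        1.\<close>
      have "(\<Sum>i\<in>I. partial (fst j) k (\<rho> i) q) = 0" for k
      proof -
        have "(\<Sum>i\<in>I. partial (fst j) k (\<rho> i) q) = partial (fst j) k (\<lambda>q. \<Sum>i\<in>I. \<rho> i q) q"
          by (rule partial_sum[OF q, symmetric]) (rule C\<rho>[OF _ I(2)[OF j]])
        also have "\<dots> = partial (fst j) k (\<lambda>q. 1) q"
          by (rule partial_cong_region[OF q]) (use \<rho>1 dom[OF I(2)[OF j]] in blast)
        finally show ?thesis by (simp add: partial_const)
      qed
      then have "(\<Sum>i\<in>I. ?D (fst j) (\<rho> i) q) = 0"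
        using q by (simp add: directional_def) (subst sum.swap, simp flip: sum_distrib_right)
      then show "(\<Sum>i\<in>I. \<rho> j q * ?D (fst j) (\<rho> i) q) = 0"
        by (simp flip: sum_distrib_left)
    qed
    also have "\<dots> = 0" by (simp add: chart_integral_def chart_integrand_def cong: if_cong)
    finally show "(\<Sum>i\<in>I. chart_integral g (fst j) (\<lambda>q. \<rho> j q * ?D (fst j) (\<rho> i) q)) = 0" .
  qed
  finally have total: "(\<Sum>i\<in>I. chart_integral g (fst i) (\<lambda>q. \<rho> i q * ?div (fst i) q)) = 0"
    by (simp add: parts sum_negf)
  have nn: "chart_integrand g (fst i) (\<lambda>q. \<rho> i q * ?div (fst i) q) x \<ge> 0" if "i \<in> I" for i x
  proof -
    interpret metric_chart M A g "fst i" by (rule mc[OF I(2)[OF that]])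
    have "\<rho> i q * ?div (fst i) q * volume_density g (fst i) q \<ge> 0" if "q \<in> fst (fst i)" for q
      by (intro mult_nonneg_nonneg \<rho>nn nonneg[OF I(2)[OF \<open>i \<in> I\<close>] that] less_imp_le density_pos[OF that])
    then show ?thesis
      using image_inv[of x] by (simp add: chart_integrand_def)
  qed
  then have nn': "chart_integral g (fst i) (\<lambda>q. \<rho> i q * ?div (fst i) q) \<ge> 0" if "i \<in> I" for i
    unfolding chart_integral_def using that by (intro integral_nonneg_AE) simp
  have "\<forall>i\<in>I. chart_integral g (fst i) (\<lambda>q. \<rho> i q * ?div (fst i) q) = 0"
    by (rule sum_nonneg_eq_0_iff[OF I(1), THEN iffD1, OF nn' total])
  then have z: "chart_integral g c0 (\<lambda>q. \<rho> i0 q * ?div c0 q) = 0"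
    using i0(1) unfolding i0(2)[symmetric] by blast
  interpret metric_chart M A g c0 by (rule mc[OF c0(1)])
  have "chart_integrand g c0 (\<lambda>q. \<rho> i0 q * ?div c0 q) (snd c0 p0) = 0"
  proof (rule continuous_nonneg_integral_zero[OF open_image])
    have "Ck_in 0 c0 (fst c0) (\<lambda>q. \<rho> i0 q * ?div c0 q * volume_density g c0 q)"
      by (intro Ck_in_mult C\<rho>' Cdiv Ck_in_density i0 c0)
    then have "continuous_on (snd c0 ` fst c0) (\<lambda>x. \<rho> i0 (chart_inv c0 x) * ?div c0 (chart_inv c0 x) * volume_density g c0 (chart_inv c0 x))"
      by (simp add: Ck_in_def o_def)
    then show "continuous_on (snd c0 ` fst c0) (chart_integrand g c0 (\<lambda>q. \<rho> i0 q * ?div c0 q))"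
      by (rule continuous_on_eq) (simp add: chart_integrand_def)
    show "chart_integrand g c0 (\<lambda>q. \<rho> i0 q * ?div c0 q) x \<ge> 0" for x
      using nn[OF i0(1)] i0(2) by simp
    show "integrable lborel (chart_integrand g c0 (\<lambda>q. \<rho> i0 q * ?div c0 q))"
      using intdiv[OF i0(1)] i0(2) by simp
  qed (use z c0 in \<open>auto simp: chart_integral_def\<close>)
  then show ?thesis
    using c0 i0(3) density_pos[OF c0(2)] inv_chart[OF c0(2)] by (simp add: chart_integrand_def)
qed

theorem theorem3p3:
  fixes M :: "'a topology" and A :: "('a, 'n::finite) chart set"
    and g :: "('a, 'n) bil_field" and X :: "('a, 'n) vec_field"
  assumes "closed_manifold M A" and "orientable M A"
    and "riemannian_metric A g" and "smooth_vector_field A X"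
  shows "killing_field A g X \<longleftrightarrow>
    (\<forall>c\<in>A. \<forall>p\<in>fst c.
       0 = rough_laplacian g X c p + gradient g (divergence g X) c p
           + contract g (ricci g) X c p + contract g (lie_metric g X) X c p
           + (1/2 * divergence g X c p) *\<^sub>R X c p)"
    (is "_ \<longleftrightarrow> (\<forall>c\<in>A. \<forall>p\<in>fst c. 0 = ?E c p)")
proof -
  have atlas: "smooth_atlas M A"
    using assms(1) by (auto simp: closed_manifold_def smooth_manifold_def)
  have fc: "field_chart M A g c X" if "c \<in> A" for c
    by unfold_locales (use atlas assms(3,4) that in \<open>auto simp: smooth_vector_field_def\<close>)
  have killing: "killing_field A g X \<longleftrightarrow> (\<forall>c\<in>A. \<forall>p\<in>fst c. field_chart.T g c X p = 0)"
    using field_chart.T_entry[OF fc] unfolding killing_field_def by (simp add: vec_eq_iff)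
  show ?thesis
  proof
    assume k: "killing_field A g X"
    show "\<forall>c\<in>A. \<forall>p\<in>fst c. 0 = ?E c p"
    proof (intro ballI)
      fix c p assume c: "c \<in> A" "p \<in> fst c"
      show "0 = ?E c p"
        by (rule field_chart.equation_field_zero[OF fc[OF c(1)] _ c(2), symmetric]) (use k killing c in blast)
    qed
  next
    assume E: "\<forall>c\<in>A. \<forall>p\<in>fst c. 0 = ?E c p"
    \<comment> \<open>This is \<open>|T|^2\<close>. Under the equation it is the only contribution
      left in \<open>divergence_lie_flux\<close>.\<close>
    let ?q = "\<lambda>c p. trace (matrix_inv (g c p) ** (field_chart.T g c X p ** matrix_inv (g c p) ** transpose (field_chart.T g c X p)))"
    have div: "divergence g (lie_flux g X) c p = 1/2 * ?q c p" if "c \<in> A" "p \<in> fst c" for c p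
      using field_chart.divergence_lie_flux[OF fc[OF that(1)] that(2)] E that by simp
    have H: "transpose (matrix_inv (g c p)) = matrix_inv (g c p)"
      "x \<noteq> 0 \<Longrightarrow> x \<bullet> (matrix_inv (g c p) *v x) > 0" if "c \<in> A" "p \<in> fst c" for c p x
    proof -
      interpret field_chart M A g c X by (rule fc[OF that(1)])
      show "transpose (H p) = H p" "x \<noteq> 0 \<Longrightarrow> x \<bullet> (H p *v x) > 0"
        using H_sym[OF that(2)] H_pos[OF that(2)] by auto
    qed
    \<comment> \<open>Since \<open>|T|^2\<close> is nonnegative in every chart, the divergence
      theorem forces it to vanish, and positive definiteness of the inverse metric then gives
      \<open>T = 0\<close>.\<close>
    have "divergence g (lie_flux g X) c p = 0" if "c \<in> A" "p \<in> fst c" for c p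
      by (rule divergence_nonneg_imp_zero[OF assms(1,3) smooth_lie_flux[OF atlas assms(3,4)] _ that])
        (simp add: div trace_pd_square(1)[OF H])
    then have "field_chart.T g c X p = 0" if "c \<in> A" "p \<in> fst c" for c p
      using div[OF that] trace_pd_square(2)[OF H[OF that]] that by simp
    then show "killing_field A g X" using killing by blast
  qed
qed

end
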